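(* Let $a,b\in\mathbb{R}$ and $1\le p,q,r<\infty$ with $\frac{a+N}q=\frac{b-p+N}p\ne0$, and let $c^1:=\frac{r(b-p+N)}{p}-N$ (which equals $\frac{r(a+N)}{q}-N$). (i) If $p\le r\le p^*$, there is $C>0$ such that $\|u\|_{c^1,r}\le C\|\nabla u\|_{b,p}$ for all $u\in W^{1,(q,p)}_{\{a,b\}}(\mathbb{R}^N_* )$. (ii) If $r=p=q$, or if $p\ne q$ and $\min\{p,q\}\le r\le\max\{p,q\}$, there is $C>0$ such that $\|u\|_{c^1,r}\le C\|\nabla u\|_{b,p}^\theta\|u\|_{a,q}^{1-\theta}$ for all $u\in W^{1,(q,p)}_{\{a,b\}}(\mathbb{R}^N_* )$, where $\theta=0$ if $r=p=q$ and $\theta=\frac{p(r-q)}{r(p-q)}$ if $p\ne q$.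
   Context: $N\ge1$, $\mathbb{R}^N_*:=\mathbb{R}^N\setminus\{0\}$. For $d\in\mathbb{R}$, $0<s<\infty$, $\|u\|_{d,s}:=(\int_{\mathbb{R}^N}|x|^d|u|^s dx)^{1/s}$ ($\{0\}$ of measure $0$; Euclidean norm for vector-valued $u$). $W^{1,(q,p)}_{\{a,b\}}(\mathbb{R}^N_* )$ is the set of $u\in L^1_{loc}(\mathbb{R}^N_* )$ with $\|u\|_{a,q},\|\nabla u\|_{b,p}<\infty$ (distributional gradient on $\mathbb{R}^N_*$). $p^*:=\infty$ if $p\ge N$, $Np/(N-p)$ if $p<N$. *)

theory Defs
  imports "HOL-Analysis.Analysis"
begin

coinductive smooth_on :: "('a::euclidean_space) set \<Rightarrow> ('a \<Rightarrow> real) \<Rightarrow> bool" where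
  "f differentiable_on S \<Longrightarrow> (\<forall>i\<in>Basis. smooth_on S (\<lambda>x. frechet_derivative f (at x) i))
   \<Longrightarrow> smooth_on S f"

definition test_fun :: "('a::euclidean_space \<Rightarrow> real) \<Rightarrow> bool" where
  "test_fun \<phi> \<longleftrightarrow> smooth_on UNIV \<phi> \<and> compact (closure {x. \<phi> x \<noteq> 0})
     \<and> 0 \<notin> closure {x. \<phi> x \<noteq> 0}"

definition L1loc_punct :: "('a::euclidean_space \<Rightarrow> 'b::{banach,second_countable_topology}) \<Rightarrow> bool" where
  "L1loc_punct u \<longleftrightarrow> (\<forall>K. compact K \<and> K \<subseteq> - {0} \<longrightarrow> set_integrable lborel K u)"

definition weak_grad :: "(real^'n \<Rightarrow> real) \<Rightarrow> (real^'n \<Rightarrow> real^'n) \<Rightarrow> bool" where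
  "weak_grad u g \<longleftrightarrow> L1loc_punct u \<and> L1loc_punct g \<and>
     (\<forall>\<phi>. test_fun \<phi> \<longrightarrow> (\<forall>i.
        (\<integral>x. u x * frechet_derivative \<phi> (at x) (axis i 1) \<partial>lborel)
          = - (\<integral>x. g x $ i * \<phi> x \<partial>lborel)))"

definition wint :: "real \<Rightarrow> real \<Rightarrow> ('a::euclidean_space \<Rightarrow> 'b::real_normed_vector) \<Rightarrow> ennreal" where
  "wint d s u = (\<integral>\<^sup>+ x. ennreal (norm x powr d * norm (u x) powr s) \<partial>lborel)"

definition wnorm :: "real \<Rightarrow> real \<Rightarrow> ('a::euclidean_space \<Rightarrow> 'b::real_normed_vector) \<Rightarrow> ennreal" where
  "wnorm d s u = (if wint d s u = \<infinity> then \<infinity> else ennreal (enn2real (wint d s u) powr (1 / s)))"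

definition in_W :: "real \<Rightarrow> real \<Rightarrow> real \<Rightarrow> real \<Rightarrow> (real^'n \<Rightarrow> real) \<Rightarrow> (real^'n \<Rightarrow> real^'n) \<Rightarrow> bool" where
  "in_W q p a b u g \<longleftrightarrow> weak_grad u g \<and> wint a q u < \<infinity> \<and> wint b p g < \<infinity>"

text \<open>Real power with the convention x^0 = 1 (also for x = 0).\<close>
definition rpow :: "real \<Rightarrow> real \<Rightarrow> real" where
  "rpow x t = (if t = 0 then 1 else x powr t)"

text \<open>Critical Sobolev exponent p^* (infinity encoded as "no upper bound").\<close>
definition below_pstar :: "nat \<Rightarrow> real \<Rightarrow> real \<Rightarrow> bool" where
  "below_pstar N p r \<longleftrightarrow> (p < real N \<longrightarrow> r \<le> real N * p / (real N - p))"

end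

theory Submission
  imports Defs
begin

text \<open>
  With \<open>\<kappa> = (b - p + N) / p\<close>, \<open>U = \<bar>x\<bar>\<^sup>\<kappa> \<bar>u\<bar>\<close>, \<open>V = \<bar>x\<bar>\<^sup>\<kappa>\<^sup>+\<^sup>1 \<bar>\<nabla>u\<bar>\<close> and the dilation invariant measure
  \<open>d\<mu> = \<bar>x\<bar>\<^sup>-\<^sup>N dx\<close>, the three weighted norms are the norms of \<open>U\<close> in \<open>L\<^sup>r(\<mu>)\<close> and \<open>L\<^sup>q(\<mu>)\<close> and of \<open>V\<close> in
  \<open>L\<^sup>p(\<mu>)\<close>. Integrating \<open>\<nabla>u\<close> along rays, outwards or inwards according to the sign of \<open>\<kappa>\<close>, gives Hardy's
  inequality, which is (i) for \<open>r = p\<close>; the boundary term disappears because \<open>U\<close> lies in \<open>L\<^sup>q(\<mu>)\<close>. Gagliardo's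
  line argument for \<open>\<bar>x\<bar>\<^sup>\<beta> \<bar>u\<bar>\<^sup>s\<close> with \<open>\<beta> = s \<kappa> - (N - 1)\<close> carries the bound from an exponent \<open>t\<close> to
  \<open>N / (N - 1) * (1 + t (1 - 1/p))\<close>, which exceeds \<open>t\<close> below \<open>p\<^sup>*\<close>, and with a constant that does not
  depend on \<open>t\<close>. As the set of admissible exponents is closed (Fatou) and convex (Hoelder), it contains
  every \<open>r\<close> between \<open>p\<close> and \<open>p\<^sup>*\<close>; for \<open>N = 1\<close> the line argument bounds \<open>U\<close> pointwise instead. Part (ii) interpolates between Hardy's inequality and \<open>L\<^sup>q(\<mu>)\<close>.
\<close>

subsection \<open>Real powers and Hoelder inequalities on \<open>ennreal\<close>\<close>

text \<open>The weak gradient is tested only away from the origin, so everything is local on annuli.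
  \<open>C1_limit\<close> isolates what is used of u: local L^1 approximation by C^1 functions,
  which survives weights and truncated powers and yields the fundamental theorem of calculus on
  almost every segment. The line argument runs on half-lines that recede from the origin; no decay
  along them is assumed, and averaging the end point costs a term |w|/|x|, which Hoelder and Hardy
  control. With e the norm of V in L^p(\<mu>), \<omega> the Hardy constant and Z = C e, the bound
  \<integral> U^t d\<mu> \<le> Z^t reproduces itself: Hoelder gives a line integrand of mass at most
  Z * Z^(t(1 - 1/p)) = Z^s with s = 1 + t(1 - 1/p), and Gagliardo gives Z^(\<nu>s) for the exponent
  \<nu>s, where \<nu> = N/(N - 1). The factor s + (|\<beta>| + 3)\<omega> met on the way is at most
  C for all s between 1 and 1 + r. The new exponent exceeds t exactly when t(N - p) < Np. Finitely
  many such steps need not reach the critical exponent, whence the passage to limits.\<close>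

definition epow :: "ennreal \<Rightarrow> real \<Rightarrow> ennreal" where
  "epow x t = (if t = 0 then 1 else if x = \<infinity> then \<infinity> else ennreal (enn2real x powr t))"

lemma epow_0 [simp]: "epow x 0 = 1"
  by (simp add: epow_def)

lemma epow_1 [simp]: "epow x 1 = x"
  by (auto simp: epow_def less_top)

lemma epow_one [simp]: "epow 1 t = 1"
  by (auto simp: epow_def)

lemma epow_zero [simp]: "t \<noteq> 0 \<Longrightarrow> epow 0 t = 0"
  by (auto simp: epow_def)

lemma epow_ennreal: "x > 0 \<or> t \<noteq> 0 \<Longrightarrow> 0 \<le> x \<Longrightarrow> epow (ennreal x) t = ennreal (x powr t)"
  by (auto simp: epow_def)

lemma epow_cases:
  assumes "x = 0 \<Longrightarrow> P" "x = \<infinity> \<Longrightarrow> P" "\<And>r. r > 0 \<Longrightarrow> x = ennreal r \<Longrightarrow> P"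
  shows P
  using assms by (cases x) (auto simp: le_less)

lemma epow_mono: "x \<le> y \<Longrightarrow> 0 \<le> t \<Longrightarrow> epow x t \<le> epow y t"
  by (cases x; cases y) (auto simp: epow_def top_unique powr_mono2 ennreal_leI)

text \<open>The conventions 0^0 = \<infinity>^0 = 1 of \<open>epow\<close> make the law hold at 0
  and \<infinity> as well. Negative exponents are excluded because \<open>epow 0 t\<close> is 0 for
  them too. The same conventions let end-point cases such as p = 1 pass through the Hoelder
  inequalities below.\<close>

lemma epow_add: "0 \<le> s \<Longrightarrow> 0 \<le> t \<Longrightarrow> epow x (s + t) = epow x s * epow x t"
  by (cases x rule: epow_cases; cases "s = 0"; cases "t = 0")
     (auto simp: epow_def powr_add ennreal_mult ennreal_top_mult)

lemma epow_mult: "0 \<le> t \<Longrightarrow> epow (x * y) t = epow x t * epow y t"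
  by (cases x rule: epow_cases; cases y rule: epow_cases; cases "t = 0")
     (auto simp: epow_def powr_mult ennreal_mult[symmetric] ennreal_top_mult ennreal_mult_top)

lemma epow_epow: "0 \<le> s \<Longrightarrow> 0 \<le> t \<Longrightarrow> epow (epow x s) t = epow x (s * t)"
  by (cases x rule: epow_cases; cases "s = 0"; cases "t = 0")
     (auto simp: epow_def powr_powr)

lemma epow_prod: "0 \<le> t \<Longrightarrow> epow (\<Prod>i\<in>A. f i) t = (\<Prod>i\<in>A. epow (f i) t)"
  by (induction A rule: infinite_finite_induct) (auto simp: epow_mult)

lemma epow_le_iff: "0 < t \<Longrightarrow> epow x t \<le> epow y t \<longleftrightarrow> x \<le> y"
  using epow_mono[of "epow x t" "epow y t" "1 / t"] epow_mono[of x y t] by (auto simp: epow_epow)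

lemma measurable_epow [measurable]:
  "f \<in> borel_measurable M \<Longrightarrow> (\<lambda>x. epow (f x) t) \<in> borel_measurable M"
  unfolding epow_def using measurable_sets[of f M borel "{\<infinity>}"]
  by (cases "t = 0") (auto intro!: measurable_If simp: vimage_def Int_def conj_commute)

text \<open>Weighted arithmetic-geometric mean inequality. Both weights are positive, so an infinite
  argument makes the right-hand side infinite.\<close>

lemma epow_Young:
  assumes "0 < \<theta>" "\<theta> < 1"
  shows "epow a \<theta> * epow b (1 - \<theta>) \<le> ennreal \<theta> * a + ennreal (1 - \<theta>) * b"
proof (cases "a = \<infinity> \<or> b = \<infinity>")
  case True
  then show ?thesis using assms by (auto simp: ennreal_mult_top)
next
  case False
  then obtain x y where xy: "a = ennreal x" "b = ennreal y" "0 \<le> x" "0 \<le> y"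
    by (cases a; cases b) auto
  have "x powr \<theta> * y powr (1 - \<theta>) \<le> \<theta> * x + (1 - \<theta>) * y"
    using Youngs_inequality_0[of \<theta> "1 - \<theta>" x y] assms xy by (cases "x = 0 \<or> y = 0") auto
  then show ?thesis
    using xy assms
    by (simp add: epow_ennreal ennreal_mult[symmetric] ennreal_plus[symmetric] ennreal_leI del: ennreal_plus)
qed

text \<open>Hoelder's inequality for the exponents 1/\<theta> and 1/(1 - \<theta>), with the powers
  moved from the integrals to the integrand. Young's inequality is integrated for f/F and g/G, so
  the cases where F or G is 0 or \<infinity> are settled beforehand.\<close>

lemma nn_integral_Holder:
  assumes [measurable]: "f \<in> borel_measurable M" "g \<in> borel_measurable M"
    and \<theta>: "0 \<le> \<theta>" "\<theta> \<le> 1"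
  shows "(\<integral>\<^sup>+x. epow (f x) \<theta> * epow (g x) (1 - \<theta>) \<partial>M)
    \<le> epow (\<integral>\<^sup>+x. f x \<partial>M) \<theta> * epow (\<integral>\<^sup>+x. g x \<partial>M) (1 - \<theta>)"
proof (cases "\<theta> = 0 \<or> \<theta> = 1")
  case True
  then show ?thesis by auto
next
  case False
  then have \<theta>': "0 < \<theta>" "\<theta> < 1" using \<theta> by auto
  define F G where "F = (\<integral>\<^sup>+x. f x \<partial>M)" and "G = (\<integral>\<^sup>+x. g x \<partial>M)"
  show ?thesis
  proof (cases "F = 0 \<or> G = 0")
    case True
    have "AE x in M. epow (f x) \<theta> * epow (g x) (1 - \<theta>) = 0"
    proof (cases "F = 0")
      case True
      then have "AE x in M. f x = 0" by (simp add: F_def nn_integral_0_iff_AE)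
      then show ?thesis using \<theta>' by (auto elim: AE_mp)
    next
      case False
      with True have "AE x in M. g x = 0" by (simp add: G_def nn_integral_0_iff_AE)
      then show ?thesis using \<theta>' by (auto elim: AE_mp)
    qed
    then have "(\<integral>\<^sup>+x. epow (f x) \<theta> * epow (g x) (1 - \<theta>) \<partial>M) = 0"
      by (simp add: nn_integral_0_iff_AE)
    then show ?thesis by simp
  next
    case nz: False
    show ?thesis
    proof (cases "F = \<infinity> \<or> G = \<infinity>")
      case True
      then have "epow F \<theta> * epow G (1 - \<theta>) = \<infinity>"
        using nz \<theta>' 
        by (cases F rule: epow_cases; cases G rule: epow_cases)
           (auto simp: epow_def ennreal_mult_top ennreal_top_mult)
      then show ?thesis unfolding F_def G_def by simp
    next
      case False
      then obtain x y where xy: "F = ennreal x" "G = ennreal y" "0 < x" "0 < y"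
        using nz by (cases F rule: epow_cases; cases G rule: epow_cases) auto
      \<comment> \<open>Both functions are rescaled to integral 1, so the bracket integrates to
        \<theta> + (1 - \<theta>) = 1.\<close>
      have *: "epow (f z) \<theta> * epow (g z) (1 - \<theta>) \<le> epow F \<theta> * epow G (1 - \<theta>) *
          (ennreal (\<theta> / x) * f z + ennreal ((1 - \<theta>) / y) * g z)" for z
      proof -
        have 1: "f z = F * (ennreal (1/x) * f z)" "g z = G * (ennreal (1/y) * g z)"
          using xy by (simp_all add: mult.assoc[symmetric] ennreal_mult[symmetric])
        have "epow (f z) \<theta> * epow (g z) (1 - \<theta>) = epow F \<theta> * epow G (1 - \<theta>) *
          (epow (ennreal (1/x) * f z) \<theta> * epow (ennreal (1/y) * g z) (1 - \<theta>))"
          by (subst 1(1), subst 1(2)) (use \<theta>' in \<open>simp add: epow_mult mult_ac\<close>)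
        also have "\<dots> \<le> epow F \<theta> * epow G (1 - \<theta>) *
          (ennreal \<theta> * (ennreal (1/x) * f z) + ennreal (1 - \<theta>) * (ennreal (1/y) * g z))"
          by (intro mult_left_mono epow_Young \<theta>') auto
        finally show ?thesis
          using xy \<theta>' by (simp add: mult.assoc[symmetric] ennreal_mult[symmetric])
      qed
      have "(\<integral>\<^sup>+x. epow (f x) \<theta> * epow (g x) (1 - \<theta>) \<partial>M) \<le>
        (\<integral>\<^sup>+z. epow F \<theta> * epow G (1 - \<theta>) * (ennreal (\<theta> / x) * f z + ennreal ((1 - \<theta>) / y) * g z) \<partial>M)"
        by (intro nn_integral_mono *)
      also have "\<dots> = epow F \<theta> * epow G (1 - \<theta>) * (ennreal (\<theta> / x) * F + ennreal ((1 - \<theta>) / y) * G)"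
        by (simp add: nn_integral_cmult nn_integral_add F_def G_def)
      also have "ennreal (\<theta> / x) * F + ennreal ((1 - \<theta>) / y) * G = 1"
        using xy \<theta>' by (simp add: ennreal_mult[symmetric] ennreal_plus[symmetric] del: ennreal_plus)
      finally show ?thesis by (simp add: F_def G_def)
    qed
  qed
qed

text \<open>One factor is split off with its exponent, and the remaining exponents are divided by
  their sum \<open>c\<close> so that they add up to 1 again. If the split exponent is 1, that sum is
  0 and all the others vanish.\<close>

lemma nn_integral_Holder_prod:
  assumes "finite S" and [measurable]: "\<And>i. i \<in> S \<Longrightarrow> f i \<in> borel_measurable M"
    and "\<And>i. i \<in> S \<Longrightarrow> 0 \<le> \<alpha> i" "sum \<alpha> S = 1"
  shows "(\<integral>\<^sup>+x. (\<Prod>i\<in>S. epow (f i x) (\<alpha> i)) \<partial>M) \<le> (\<Prod>i\<in>S. epow (\<integral>\<^sup>+x. f i x \<partial>M) (\<alpha> i))"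
  using assms
proof (induction S arbitrary: \<alpha> rule: finite_induct)
  case empty
  then show ?case by simp
next
  case (insert j S)
  note [measurable] = insert.prems(1)
  have s: "sum \<alpha> S = 1 - \<alpha> j" using insert by simp
  have j: "0 \<le> \<alpha> j" "\<alpha> j \<le> 1"
    using insert.prems(2) s sum_nonneg[of S \<alpha>] by auto
  show ?case
  proof (cases "\<alpha> j = 1")
    case True
    then have "sum \<alpha> S = 0" using s by simp
    then have 0: "\<And>i. i \<in> S \<Longrightarrow> \<alpha> i = 0"
      using insert by (subst (asm) sum_nonneg_eq_0_iff) auto
    then show ?thesis using insert.hyps True by (simp cong: prod.cong)
  next
    case False
    define c where "c = 1 - \<alpha> j"
    have c: "c > 0" using False j by (simp add: c_def)
    define \<beta> where "\<beta> i = \<alpha> i / c" for i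
    have \<beta>: "sum \<beta> S = 1" "\<And>i. i \<in> S \<Longrightarrow> 0 \<le> \<beta> i"
      using s c insert.prems(2) by (auto simp: \<beta>_def sum_divide_distrib[symmetric] c_def)
    have e: "epow z (\<alpha> i) = epow (epow z (\<beta> i)) c" if "i \<in> S" for z i
      using \<beta>(2)[OF that] c by (simp add: epow_epow \<beta>_def)
    have "(\<integral>\<^sup>+x. (\<Prod>i\<in>insert j S. epow (f i x) (\<alpha> i)) \<partial>M) =
      (\<integral>\<^sup>+x. epow (f j x) (\<alpha> j) * epow (\<Prod>i\<in>S. epow (f i x) (\<beta> i)) (1 - \<alpha> j) \<partial>M)"
      using insert.hyps c by (simp add: e epow_prod c_def[symmetric] cong: prod.cong)
    also have "\<dots> \<le> epow (\<integral>\<^sup>+x. f j x \<partial>M) (\<alpha> j) * epow (\<integral>\<^sup>+x. (\<Prod>i\<in>S. epow (f i x) (\<beta> i)) \<partial>M) (1 - \<alpha> j)"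
      by (intro nn_integral_Holder j) auto
    also have "\<dots> \<le> epow (\<integral>\<^sup>+x. f j x \<partial>M) (\<alpha> j) * epow (\<Prod>i\<in>S. epow (\<integral>\<^sup>+x. f i x \<partial>M) (\<beta> i)) (1 - \<alpha> j)"
      using c by (intro mult_left_mono epow_mono insert.IH \<beta>) (auto simp: c_def)
    also have "\<dots> = (\<Prod>i\<in>insert j S. epow (\<integral>\<^sup>+x. f i x \<partial>M) (\<alpha> i))"
      using insert.hyps c by (simp add: e epow_prod c_def[symmetric] cong: prod.cong)
    finally show ?thesis .
  qed
qed

subsection \<open>Integrals along lines\<close>

text \<open>The result remains a function on the whole space, constant along \<open>b\<close>.
  Integrating over several coordinates thus requires no splitting of the space into a
  product.\<close>

definition line_int :: "'a::euclidean_space \<Rightarrow> ('a \<Rightarrow> ennreal) \<Rightarrow> 'a \<Rightarrow> ennreal" where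
  "line_int b G x = (\<integral>\<^sup>+t. G (x + t *\<^sub>R b) \<partial>lborel)"

abbreviation lines_int :: "'a::euclidean_space list \<Rightarrow> ('a \<Rightarrow> ennreal) \<Rightarrow> 'a \<Rightarrow> ennreal" where
  "lines_int bs G \<equiv> foldr line_int bs G"

lemma measurable_line_int [measurable (raw)]:
  assumes [measurable]: "G \<in> borel_measurable borel"
  shows "line_int b G \<in> borel_measurable borel"
  unfolding line_int_def by measurable

lemma measurable_lines_int [measurable (raw)]:
  "G \<in> borel_measurable borel \<Longrightarrow> lines_int bs G \<in> borel_measurable borel"
  by (induction bs) (auto intro: measurable_line_int)

lemma line_int_mono: "(\<And>x. F x \<le> G x) \<Longrightarrow> line_int b F x \<le> line_int b G x"
  unfolding line_int_def by (intro nn_integral_mono) auto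

lemma line_int_shift:
  assumes [measurable]: "G \<in> borel_measurable borel"
  shows "line_int b G (x + s *\<^sub>R b) = line_int b G x"
  unfolding line_int_def
  by (subst (2) nn_integral_real_affine[where c=1 and t=s]) (auto simp: algebra_simps)

lemma line_int_commute:
  assumes [measurable]: "G \<in> borel_measurable borel"
  shows "line_int a (line_int b G) x = line_int b (line_int a G) x"
  unfolding line_int_def
  by (subst lborel_pair.Fubini') (auto simp: algebra_simps)

text \<open>Lebesgue measure is the image of a product of one-dimensional measures indexed by the
  basis; this is the bridge to it from iterated line integrals.\<close>

lemma lines_int_eq_PiM:
  fixes G :: "'a::euclidean_space \<Rightarrow> ennreal"
  assumes [measurable]: "G \<in> borel_measurable borel" and "distinct bs"
  shows "lines_int bs G x = (\<integral>\<^sup>+f. G (x + (\<Sum>b\<in>set bs. f b *\<^sub>R b)) \<partial>(\<Pi>\<^sub>M b\<in>set bs. lborel))"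
  using assms(2)
proof (induction bs arbitrary: x)
  case Nil
  interpret product_sigma_finite "\<lambda>_::'a. lborel :: real measure"
    by standard
  show ?case by (simp add: space_PiM_empty)
next
  case (Cons b bs)
  interpret product_sigma_finite "\<lambda>_::'a. lborel :: real measure"
    by standard
  have b: "b \<notin> set bs" using Cons.prems by auto
  have s: "(\<Sum>c\<in>set bs. (f(b := y)) c *\<^sub>R c) = (\<Sum>c\<in>set bs. f c *\<^sub>R c)" for f :: "'a \<Rightarrow> real" and y
    using b by (intro sum.cong) auto
  have "lines_int (b # bs) G x =
    (\<integral>\<^sup>+t. (\<integral>\<^sup>+f. G (x + t *\<^sub>R b + (\<Sum>b\<in>set bs. f b *\<^sub>R b)) \<partial>(\<Pi>\<^sub>M b\<in>set bs. lborel)) \<partial>lborel)"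
    using Cons.IH Cons.prems by (simp add: line_int_def[of b "lines_int bs G"])
  also have "\<dots> = (\<integral>\<^sup>+f. G (x + (\<Sum>b\<in>insert b (set bs). f b *\<^sub>R b)) \<partial>(\<Pi>\<^sub>M b\<in>insert b (set bs). lborel))"
    using b by (subst product_nn_integral_insert_rev) (auto simp: s add.assoc fun_upd_same simp del: fun_upd_apply)
  finally show ?case by simp
qed

lemma lines_int_Basis:
  fixes G :: "'a::euclidean_space \<Rightarrow> ennreal"
  assumes [measurable]: "G \<in> borel_measurable borel" and bs: "distinct bs" "set bs = Basis"
  shows "lines_int bs G x = (\<integral>\<^sup>+y. G y \<partial>lborel)"
proof -
  have "lines_int bs G x = (\<integral>\<^sup>+y. G (x + y) \<partial>lborel)"
    unfolding lines_int_eq_PiM[OF assms(1) bs(1)] bs(2)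
    by (subst lborel_eq) (simp add: nn_integral_distr)
  also have "\<dots> = (\<integral>\<^sup>+y. G y \<partial>distr lborel borel ((+) x))"
    by (simp add: nn_integral_distr)
  finally show ?thesis by (simp add: lborel_distr_plus)
qed

text \<open>The induction behind the Gagliardo and Loomis-Whitney inequalities. When direction
  \<open>j\<close> is integrated, the factor with \<open>line_int j\<close> is constant along the
  line and leaves the integral. The other exponents are \<alpha> times \<open>length bs\<close>,
  once, and \<alpha> for each of the \<open>card B\<close> remaining directions; they sum to 1, so
  Hoelder applies.\<close>

lemma lines_int_prod_le:
  fixes G :: "'a::euclidean_space \<Rightarrow> ennreal"
  assumes [measurable]: "G \<in> borel_measurable borel" and dim: "DIM('a) \<ge> 2"
    and "distinct bs" "set bs \<subseteq> Basis"
  defines "\<alpha> \<equiv> 1 / (real DIM('a) - 1)"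
  shows "lines_int bs (\<lambda>x. \<Prod>i\<in>Basis. epow (line_int i G x) \<alpha>) x \<le>
    epow (lines_int bs G x) (\<alpha> * length bs) *
    (\<Prod>i\<in>Basis - set bs. epow (line_int i (lines_int bs G) x) \<alpha>)"
  using assms(3,4)
proof (induction bs arbitrary: x)
  case Nil
  then show ?case by simp
next
  case (Cons j bs)
  have \<alpha>: "\<alpha> \<ge> 0" using dim by (simp add: \<alpha>_def)
  define S where "S = Basis - set bs"
  define F where "F = lines_int bs G"
  have [measurable]: "F \<in> borel_measurable borel" unfolding F_def by measurable
  define B where "B = S - {j}"
  have j: "j \<in> S" "j \<notin> set bs" and S: "finite S" "S = insert j B" "j \<notin> B" "finite B" "B = Basis - set (j # bs)"
    using Cons.prems by (auto simp: S_def B_def)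
  have "card S = DIM('a) - length bs"
    using Cons.prems by (simp add: S_def card_Diff_subset distinct_card)
  moreover have "length bs < DIM('a)"
    using Cons.prems card_mono[of "Basis :: 'a set" "set (j # bs)"] by (simp add: distinct_card card_insert_if)
  ultimately have cB: "real (card B) = real DIM('a) - real (length bs) - 1"
    using S by auto
  \<comment> \<open>The slot \<open>j\<close> of the family, vacated by the constant factor, carries
    the power of \<open>F\<close> accumulated in the earlier directions.\<close>
  define f where "f i t = (if i = j then F (x + t *\<^sub>R j) else line_int i F (x + t *\<^sub>R j))" for i t
  have [measurable]: "f i \<in> borel_measurable borel" for i
    unfolding f_def by (cases "i = j") (auto intro!: measurable_compose[OF _ measurable_line_int])
  define w where "w i = (if i = j then \<alpha> * length bs else \<alpha>)" for i
  have sw: "sum w S = 1"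
  proof -
    have "sum w B = (\<Sum>i\<in>B. \<alpha>)" using S(3) by (intro sum.cong) (auto simp: w_def)
    then have "sum w S = \<alpha> * length bs + real (card B) * \<alpha>"
      using S by (simp add: w_def)
    also have "\<dots> = \<alpha> * (real DIM('a) - 1)" by (simp add: cB algebra_simps)
    finally show ?thesis using dim by (simp add: \<alpha>_def)
  qed
  have pr: "(\<Prod>i\<in>S. epow (f i t) (w i)) = epow (F (x + t *\<^sub>R j)) (\<alpha> * length bs) *
      (\<Prod>i\<in>B. epow (line_int i F (x + t *\<^sub>R j)) \<alpha>)" for t
  proof -
    have "(\<Prod>i\<in>B. epow (f i t) (w i)) = (\<Prod>i\<in>B. epow (line_int i F (x + t *\<^sub>R j)) \<alpha>)"
      using S(3) by (intro prod.cong) (auto simp: w_def f_def)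
    then show ?thesis using S by (simp add: w_def f_def)
  qed
  have pr2: "(\<Prod>i\<in>S. epow (\<integral>\<^sup>+t. f i t \<partial>lborel) (w i)) = epow (line_int j F x) (\<alpha> * length bs) *
      (\<Prod>i\<in>B. epow (line_int i (line_int j F) x) \<alpha>)"
  proof -
    have "(\<Prod>i\<in>B. epow (\<integral>\<^sup>+t. f i t \<partial>lborel) (w i)) = (\<Prod>i\<in>B. epow (line_int j (line_int i F) x) \<alpha>)"
      using S(3) by (intro prod.cong) (auto simp: w_def f_def line_int_def[of j])
    then show ?thesis using S by (simp add: w_def f_def line_int_def[of j F] line_int_commute[of F j])
  qed
  have "lines_int (j # bs) (\<lambda>x. \<Prod>i\<in>Basis. epow (line_int i G x) \<alpha>) x \<le>
     line_int j (\<lambda>x. epow (F x) (\<alpha> * length bs) * (\<Prod>i\<in>S. epow (line_int i F x) \<alpha>)) x"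
    using Cons by (auto simp: F_def S_def intro!: line_int_mono)
  also have "\<dots> = (\<integral>\<^sup>+t. epow (line_int j F x) \<alpha> * (\<Prod>i\<in>S. epow (f i t) (w i)) \<partial>lborel)"
  proof -
    have prodS: "(\<Prod>i\<in>S. h i) = h j * (\<Prod>i\<in>B. h i)" for h :: "'a \<Rightarrow> ennreal"
      unfolding S(2) by (rule prod.insert) (use S in auto)
    have fun_eq: "(\<lambda>y. epow (F y) (\<alpha> * length bs) * (\<Prod>i\<in>S. epow (line_int i F y) \<alpha>)) =
      (\<lambda>y. epow (line_int j F y) \<alpha> *
        (epow (F y) (\<alpha> * length bs) * (\<Prod>i\<in>B. epow (line_int i F y) \<alpha>)))"
      unfolding prodS by (simp only: mult_ac)
    have "line_int j (\<lambda>x. epow (F x) (\<alpha> * length bs) * (\<Prod>i\<in>S. epow (line_int i F x) \<alpha>)) x =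
      (\<integral>\<^sup>+t. epow (line_int j F (x + t *\<^sub>R j)) \<alpha> * (\<Prod>i\<in>S. epow (f i t) (w i)) \<partial>lborel)"
      unfolding fun_eq pr by (rule line_int_def)
    also have "\<dots> = (\<integral>\<^sup>+t. epow (line_int j F x) \<alpha> * (\<Prod>i\<in>S. epow (f i t) (w i)) \<partial>lborel)"
      by (simp only: line_int_shift[OF \<open>F \<in> borel_measurable borel\<close>])
    finally show ?thesis .
  qed
  also have "\<dots> = epow (line_int j F x) \<alpha> * (\<integral>\<^sup>+t. (\<Prod>i\<in>S. epow (f i t) (w i)) \<partial>lborel)"
    by (rule nn_integral_cmult) measurable
  also have "\<dots> \<le> epow (line_int j F x) \<alpha> * (\<Prod>i\<in>S. epow (\<integral>\<^sup>+t. f i t \<partial>lborel) (w i))"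
    using S(1) sw \<alpha> by (intro mult_left_mono nn_integral_Holder_prod) (auto simp: w_def)
  also have "\<dots> = epow (line_int j F x) (\<alpha> * length (j # bs)) *
    (\<Prod>i\<in>B. epow (line_int i (line_int j F) x) \<alpha>)"
    using \<alpha> by (simp add: pr2 distrib_left epow_add mult_ac)
  finally show ?case using S(5) by (simp add: F_def)
qed

text \<open>The power N/(N - 1) splits into N factors of exponent 1/(N - 1), each estimated by the
  line integral in a different direction. Once all directions are integrated, every line integral
  has become the full integral.\<close>

lemma nn_integral_Gagliardo:
  fixes G :: "'a::euclidean_space \<Rightarrow> ennreal"
  assumes [measurable]: "G \<in> borel_measurable borel" and dim: "DIM('a) \<ge> 2"
    and f: "AE x in lborel. \<forall>b\<in>Basis. f x \<le> line_int b G x"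
  shows "(\<integral>\<^sup>+x. epow (f x) (real DIM('a) / (real DIM('a) - 1)) \<partial>lborel)
    \<le> epow (\<integral>\<^sup>+x. G x \<partial>lborel) (real DIM('a) / (real DIM('a) - 1))"
proof -
  define \<alpha> where "\<alpha> = 1 / (real DIM('a) - 1)"
  have \<alpha>: "\<alpha> \<ge> 0" using dim by (simp add: \<alpha>_def)
  obtain bs where bs: "distinct bs" "set bs = (Basis :: 'a set)"
    using finite_distinct_list[of "Basis :: 'a set"] by auto
  have l: "length bs = DIM('a)" using bs distinct_card by metis
  have e: "real DIM('a) / (real DIM('a) - 1) = \<alpha> * real DIM('a)" by (simp add: \<alpha>_def)
  have *: "epow z (\<alpha> * real DIM('a)) = (\<Prod>i\<in>(Basis::'a set). epow z \<alpha>)" for z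
  proof -
    have "epow z (\<alpha> * real n) = epow z \<alpha> ^ n" for n
      using \<alpha> by (induction n) (auto simp: distrib_left epow_add)
    then show ?thesis by simp
  qed
  have "(\<integral>\<^sup>+x. epow (f x) (\<alpha> * real DIM('a)) \<partial>lborel) \<le>
      (\<integral>\<^sup>+x. (\<Prod>i\<in>Basis. epow (line_int i G x) \<alpha>) \<partial>lborel)"
  proof (rule nn_integral_mono_AE, rule AE_mp[OF f], rule AE_I2, rule impI)
    fix x assume "\<forall>b\<in>Basis. f x \<le> line_int b G x"
    then show "epow (f x) (\<alpha> * real DIM('a)) \<le> (\<Prod>i\<in>Basis. epow (line_int i G x) \<alpha>)"
      unfolding * by (intro prod_mono_ennreal epow_mono) (auto simp: \<alpha>)
  qed
  also have "\<dots> = lines_int bs (\<lambda>x. \<Prod>i\<in>Basis. epow (line_int i G x) \<alpha>) 0"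
    by (rule lines_int_Basis[symmetric]) (use bs in auto)
  also have "\<dots> \<le> epow (lines_int bs G 0) (\<alpha> * length bs) *
    (\<Prod>i\<in>Basis - set bs. epow (line_int i (lines_int bs G) 0) \<alpha>)"
    unfolding \<alpha>_def by (rule lines_int_prod_le) (use bs dim in auto)
  also have "\<dots> = epow (\<integral>\<^sup>+x. G x \<partial>lborel) (\<alpha> * real DIM('a))"
    using bs by (simp add: l lines_int_Basis)
  finally show ?thesis by (simp add: e)
qed

subsection \<open>Smooth bump functions\<close>

text \<open>Differentiating exp(-1/t) produces powers of 1/t; carrying them in the index
  \<open>k\<close> makes the span of the family closed under differentiation.\<close>

definition exp_inv :: "nat \<Rightarrow> real \<Rightarrow> real" where
  "exp_inv k t = (if t \<le> 0 then 0 else exp (- (1 / t)) / t ^ k)"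

lemma exp_inv_nonneg: "0 \<le> exp_inv k t"
  by (simp add: exp_inv_def)

lemma exp_inv_pos: "0 < t \<Longrightarrow> 0 < exp_inv k t"
  by (simp add: exp_inv_def)

lemma exp_inv_tendsto_0: "(exp_inv k \<longlongrightarrow> 0) (at 0)"
proof (rule filterlim_split_at)
  have "((\<lambda>t. 0) \<longlongrightarrow> (0::real)) (at_left 0)" by simp
  then show "(exp_inv k \<longlongrightarrow> 0) (at_left 0)"
    by (rule Lim_transform_eventually) (auto simp: eventually_at_filter exp_inv_def)
  have "((\<lambda>t::real. inverse t ^ k / exp (inverse t)) \<longlongrightarrow> 0) (at_right 0)"
    by (rule filterlim_compose[OF tendsto_power_div_exp_0 filterlim_inverse_at_top_right])
  then show "(exp_inv k \<longlongrightarrow> 0) (at_right 0)"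
    by (rule Lim_transform_eventually)
       (auto simp: eventually_at_filter exp_inv_def exp_minus field_simps)
qed

lemma exp_inv_DERIV:
  "(exp_inv k has_field_derivative (exp_inv (k + 2) t - k * exp_inv (k + 1) t)) (at t)"
proof (cases t "0 :: real" rule: linorder_cases)
  case less
  have "((\<lambda>t. 0 :: real) has_field_derivative 0) (at t)" by simp
  then have "(exp_inv k has_field_derivative 0) (at t)"
    by (rule DERIV_cong_ev[THEN iffD1, rotated -1, OF _ refl _ refl])
       (use less in \<open>auto simp: exp_inv_def intro!: eventually_mono[OF eventually_nhds_in_open[of "{..<0}"]]\<close>)
  then show ?thesis using less by (simp add: exp_inv_def)
next
  case equal
  \<comment> \<open>The difference quotient of \<open>exp_inv k\<close> at 0 is
    \<open>exp_inv (k + 1)\<close>, whose limit is known.\<close>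
  have "((\<lambda>h. exp_inv (k + 1) h) \<longlongrightarrow> 0) (at 0)" by (rule exp_inv_tendsto_0)
  then have "((\<lambda>h. (exp_inv k (0 + h) - exp_inv k 0) / h) \<longlongrightarrow> 0) (at 0)"
    by (rule Lim_transform_eventually) (auto simp: eventually_at_filter exp_inv_def)
  then have "(exp_inv k has_field_derivative 0) (at 0)" by (simp add: DERIV_def)
  then show ?thesis using equal by (simp add: exp_inv_def)
next
  case greater
  have "((\<lambda>t. exp (- (1 / t)) / t ^ k) has_field_derivative
     (exp (- (1 / t)) / t ^ (k + 2) - k * (exp (- (1 / t)) / t ^ (k + 1)))) (at t)"
    using greater by (cases k; auto intro!: derivative_eq_intros simp: field_simps power2_eq_square;
        metis power_eq_if One_nat_def)
  then have "(exp_inv k has_field_derivative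
     (exp (- (1 / t)) / t ^ (k + 2) - k * (exp (- (1 / t)) / t ^ (k + 1)))) (at t)"
    by (rule DERIV_cong_ev[THEN iffD1, rotated -1, OF _ refl _ refl])
       (use greater in \<open>auto simp: exp_inv_def intro!: eventually_mono[OF eventually_nhds_in_open[of "{0<..}"]]\<close>)
  then show ?thesis using greater by (simp add: exp_inv_def)
qed

text \<open>An algebra of functions that contains the bump and is closed under partial derivatives;
  this closure is what the coinductive smoothness predicate asks for.\<close>
inductive bump_alg :: "'a::euclidean_space \<Rightarrow> real \<Rightarrow> ('a \<Rightarrow> real) \<Rightarrow> bool" for c \<delta> where
  const: "bump_alg c \<delta> (\<lambda>y. a)"
| coord: "bump_alg c \<delta> (\<lambda>y. (y - c) \<bullet> i)"
| bump: "bump_alg c \<delta> (\<lambda>y. exp_inv k (\<delta> - (y - c) \<bullet> (y - c)))"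
| add: "bump_alg c \<delta> f \<Longrightarrow> bump_alg c \<delta> g \<Longrightarrow> bump_alg c \<delta> (\<lambda>y. f y + g y)"
| mult: "bump_alg c \<delta> f \<Longrightarrow> bump_alg c \<delta> g \<Longrightarrow> bump_alg c \<delta> (\<lambda>y. f y * g y)"

lemma bump_alg_derivative:
  assumes "bump_alg c \<delta> f"
  shows "\<exists>f'. (\<forall>x. (f has_derivative f' x) (at x)) \<and> (\<forall>i. bump_alg c \<delta> (\<lambda>x. f' x i))"
  using assms
proof induction
  case (const a)
  show ?case by (intro exI[of _ "\<lambda>x d. 0"]) (auto intro: bump_alg.const)
next
  case (coord i)
  show ?case
    by (intro exI[of _ "\<lambda>x d. d \<bullet> i"]) (auto intro!: bump_alg.const derivative_eq_intros)
next
  case (bump k)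
  have "((\<lambda>y. exp_inv k (\<delta> - (y - c) \<bullet> (y - c))) has_derivative
    (\<lambda>d. (exp_inv (k + 2) (\<delta> - (x - c) \<bullet> (x - c)) + (- real k) * exp_inv (k + 1) (\<delta> - (x - c) \<bullet> (x - c)))
       * ((-2) * ((x - c) \<bullet> d)))) (at x)" for x
    by (rule has_derivative_eq_rhs[OF has_derivative_compose[OF _ exp_inv_DERIV[unfolded has_field_derivative_def]]])
       (auto intro!: derivative_eq_intros simp: inner_commute fun_eq_iff algebra_simps)
  then show ?case
    by (intro exI[of _ "\<lambda>x d. (exp_inv (k + 2) (\<delta> - (x - c) \<bullet> (x - c)) + (- real k) * exp_inv (k + 1) (\<delta> - (x - c) \<bullet> (x - c)))
       * ((-2) * ((x - c) \<bullet> d))"] conjI allI bump_alg.intros) auto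
next
  case (add f g)
  then obtain f' g' where "\<forall>x. (f has_derivative f' x) (at x)" "\<forall>i. bump_alg c \<delta> (\<lambda>x. f' x i)"
    "\<forall>x. (g has_derivative g' x) (at x)" "\<forall>i. bump_alg c \<delta> (\<lambda>x. g' x i)" by blast
  then show ?case
    by (intro exI[of _ "\<lambda>x d. f' x d + g' x d"]) (auto intro!: bump_alg.add has_derivative_add)
next
  case (mult f g)
  then obtain f' g' where "\<forall>x. (f has_derivative f' x) (at x)" "\<forall>i. bump_alg c \<delta> (\<lambda>x. f' x i)"
    "\<forall>x. (g has_derivative g' x) (at x)" "\<forall>i. bump_alg c \<delta> (\<lambda>x. g' x i)" by blast
  then show ?case using mult.hyps
    by (intro exI[of _ "\<lambda>x d. f x * g' x d + f' x d * g x"])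
       (auto intro!: bump_alg.add bump_alg.mult has_derivative_mult)
qed

lemma bump_alg_smooth: "bump_alg c \<delta> f \<Longrightarrow> smooth_on UNIV f"
proof (coinduction arbitrary: f)
  case smooth_on
  then obtain f' where f': "\<And>x. (f has_derivative f' x) (at x)" "\<And>i. bump_alg c \<delta> (\<lambda>x. f' x i)"
    using bump_alg_derivative by blast
  then have "frechet_derivative f (at x) = f' x" for x
    by (metis frechet_derivative_at)
  then show ?case using f' by (auto simp: differentiable_on_def differentiable_def intro: has_derivative_at_withinI)
qed

definition bump0 :: "real \<Rightarrow> 'a::euclidean_space \<Rightarrow> real" where
  "bump0 \<epsilon> z = exp_inv 0 (\<epsilon>\<^sup>2 - z \<bullet> z)"

text \<open>The gradient of \<open>bump0 \<epsilon>\<close>: the derivative of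
  \<open>exp_inv 0\<close> is \<open>exp_inv 2\<close>, and the inner function has gradient
  -2z.\<close>

definition dbump0 :: "real \<Rightarrow> 'a::euclidean_space \<Rightarrow> 'a" where
  "dbump0 \<epsilon> z = (-2 * exp_inv 2 (\<epsilon>\<^sup>2 - z \<bullet> z)) *\<^sub>R z"

lemma bump0_has_derivative: "(bump0 \<epsilon> has_derivative (\<lambda>d. dbump0 \<epsilon> z \<bullet> d)) (at z)"
  unfolding bump0_def dbump0_def
  by (rule has_derivative_eq_rhs[OF has_derivative_compose[OF _ exp_inv_DERIV[unfolded has_field_derivative_def]]])
     (auto intro!: derivative_eq_intros simp: inner_commute fun_eq_iff algebra_simps numeral_2_eq_2)

lemma continuous_exp_inv: "continuous_on S (exp_inv k)"
  using exp_inv_DERIV[of k] by (intro continuous_at_imp_continuous_on) (auto intro: DERIV_isCont)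

lemma continuous_dbump0: "continuous_on S (dbump0 \<epsilon>)"
  unfolding dbump0_def
  by (intro continuous_intros continuous_on_compose2[OF continuous_exp_inv[of UNIV]]) auto

lemma continuous_bump0: "continuous_on S (bump0 \<epsilon>)"
  unfolding bump0_def
  by (intro continuous_intros continuous_on_compose2[OF continuous_exp_inv[of UNIV]]) auto

lemma bump0_nonneg: "0 \<le> bump0 \<epsilon> z"
  by (simp add: bump0_def exp_inv_nonneg)

lemma bump0_eq_0: "0 < \<epsilon> \<Longrightarrow> norm z \<ge> \<epsilon> \<Longrightarrow> bump0 \<epsilon> z = 0"
  by (simp add: bump0_def exp_inv_def dot_square_norm)

lemma dbump0_eq_0: "0 < \<epsilon> \<Longrightarrow> norm z \<ge> \<epsilon> \<Longrightarrow> dbump0 \<epsilon> z = 0"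
  by (simp add: dbump0_def exp_inv_def dot_square_norm)

lemma bump0_pos: "norm z < \<epsilon> \<Longrightarrow> 0 < bump0 \<epsilon> z"
  by (simp add: bump0_def dot_square_norm exp_inv_pos power_strict_mono)

text \<open>As a function of \<open>y\<close> the kernel is a bump around \<open>x\<close>, and
  \<open>\<epsilon> < norm x\<close> keeps its support off the origin. Through this test function
  the weak gradient enters; \<open>a\<close> leaves room for the normalisation.\<close>

lemma test_fun_bump0:
  assumes "0 < \<epsilon>" "\<epsilon> < norm x"
  shows "test_fun (\<lambda>y. a * bump0 \<epsilon> (x - y))"
proof -
  have "{y. a * bump0 \<epsilon> (x - y) \<noteq> 0} \<subseteq> cball x \<epsilon>"
    using bump0_eq_0[OF assms(1)] by (force simp: dist_norm)
  then have cl: "closure {y. a * bump0 \<epsilon> (x - y) \<noteq> 0} \<subseteq> cball x \<epsilon>"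
    by (rule closure_minimal) simp
  have "bump_alg x (\<epsilon>\<^sup>2) (\<lambda>y. a * exp_inv 0 (\<epsilon>\<^sup>2 - (y - x) \<bullet> (y - x)))"
    by (intro bump_alg.mult bump_alg.const bump_alg.bump)
  also have "(\<lambda>y. a * exp_inv 0 (\<epsilon>\<^sup>2 - (y - x) \<bullet> (y - x))) = (\<lambda>y. a * bump0 \<epsilon> (x - y))"
    by (simp add: bump0_def fun_eq_iff algebra_simps)
  finally have "smooth_on UNIV (\<lambda>y. a * bump0 \<epsilon> (x - y))" by (rule bump_alg_smooth)
  moreover have "0 \<notin> cball x \<epsilon>" using assms by (simp add: dist_norm)
  moreover have "compact (closure {y. a * bump0 \<epsilon> (x - y) \<noteq> 0})"
    using compact_Int_closed[OF compact_cball closed_closure] cl by (metis Int_absorb1)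
  ultimately show ?thesis using cl by (auto simp: test_fun_def)
qed

subsection \<open>Mollification\<close>

lemma sets_borel_inner_compact_outer_open:
  fixes A :: "'a::euclidean_space set"
  assumes A: "A \<in> sets borel" "emeasure lborel A < \<infinity>" and e: "0 < e"
  obtains K V where "compact K" "open V" "K \<subseteq> A" "A \<subseteq> V" "emeasure lborel (V - K) \<le> ennreal e"
proof -
  have leb: "A \<in> sets lebesgue" "emeasure lebesgue A < \<infinity>" using A by auto
  have e3: "e / 3 > 0" using e by simp
  obtain V where V: "open V" "A \<subseteq> V" "V - A \<in> lmeasurable" "emeasure lebesgue (V - A) < ennreal (e/3)"
    by (rule sets_lebesgue_outer_open[OF leb(1) e3])
  obtain T where T: "closed T" "T \<subseteq> A" "A - T \<in> lmeasurable" "emeasure lebesgue (A - T) < ennreal (e/3)"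
    by (rule sets_lebesgue_inner_closed[OF leb(1) e3])
  have Tm: "T \<in> sets borel" "V \<in> sets borel" using T V by auto
  have "(\<lambda>n. emeasure lborel (T - cball 0 (real n))) \<longlonglongrightarrow> emeasure lborel (\<Inter>n. T - cball 0 (real n))"
  proof (rule Lim_emeasure_decseq)
    show "range (\<lambda>n. T - cball 0 (real n)) \<subseteq> sets lborel" using Tm by auto
    show "decseq (\<lambda>n. T - cball 0 (real n))"
      by (auto simp: decseq_def)
    have "emeasure lborel (T - cball 0 (real n)) \<le> emeasure lborel A" for n
      using T A by (intro emeasure_mono) auto
    then show "emeasure lborel (T - cball 0 (real n)) \<noteq> \<infinity>" for n
      using A(2) by (metis leD infinity_ennreal_def)
  qed
  moreover have "(\<Inter>n. T - cball 0 (real n)) = {}"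
    by (auto simp: not_le) (meson real_arch_simple)
  ultimately have "(\<lambda>n. emeasure lborel (T - cball 0 (real n))) \<longlonglongrightarrow> 0"
    by (simp only: emeasure_empty)
  then have "eventually (\<lambda>n. emeasure lborel (T - cball 0 (real n)) < ennreal (e/3)) sequentially"
    by (rule order_tendstoD(2)) (use e in auto)
  then obtain n where n: "emeasure lborel (T - cball 0 (real n)) < ennreal (e/3)"
    by (auto simp: eventually_sequentially)
  define K where "K = T \<inter> cball 0 (real n)"
  have K: "compact K" unfolding K_def using T by (simp add: closed_Int_compact)
  have Km: "K \<in> sets borel" using K by (simp add: borel_compact)
  have "V - K = (V - A) \<union> ((A - T) \<union> (T - cball 0 (real n)))"
    using T V by (auto simp: K_def)
  then have "emeasure lborel (V - K) \<le> emeasure lborel (V - A) + (emeasure lborel (A - T) + emeasure lborel (T - cball 0 (real n)))"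
    using Tm A by (auto intro!: order_trans[OF emeasure_subadditive] add_mono)
  also have "\<dots> \<le> ennreal (e/3) + (ennreal (e/3) + ennreal (e/3))"
    using V(4) T(4) n A Tm by (intro add_mono) auto
  also have "\<dots> = ennreal e" using e by (simp add: ennreal_plus[symmetric] del: ennreal_plus)
  finally show ?thesis using that[of K V] K V T by (auto simp: K_def)
qed

lemma nn_integral_lborel_translate:
  fixes f :: "'a::euclidean_space \<Rightarrow> ennreal"
  assumes [measurable]: "f \<in> borel_measurable borel"
  shows "(\<integral>\<^sup>+x. f (c + x) \<partial>lborel) = (\<integral>\<^sup>+x. f x \<partial>lborel)"
proof -
  have "(\<integral>\<^sup>+x. f (c + x) \<partial>lborel) = (\<integral>\<^sup>+x. f x \<partial>distr lborel borel ((+) c))"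
    by (simp add: nn_integral_distr)
  then show ?thesis by (simp add: lborel_distr_plus)
qed

lemma nn_integral_lborel_scale:
  fixes f :: "'a::euclidean_space \<Rightarrow> ennreal"
  assumes [measurable]: "f \<in> borel_measurable borel" and "c \<noteq> 0"
  shows "(\<integral>\<^sup>+x. f x \<partial>lborel) = ennreal (\<bar>c\<bar> ^ DIM('a)) * (\<integral>\<^sup>+x. f (t + c *\<^sub>R x) \<partial>lborel)"
  by (subst lborel_affine[OF assms(2), of t]) (simp add: nn_integral_density nn_integral_distr nn_integral_cmult)

lemma nn_integral_lborel_reflect:
  fixes f :: "'a::euclidean_space \<Rightarrow> ennreal"
  assumes [measurable]: "f \<in> borel_measurable borel"
  shows "(\<integral>\<^sup>+x. f (c - x) \<partial>lborel) = (\<integral>\<^sup>+x. f x \<partial>lborel)"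
  using nn_integral_lborel_scale[OF assms, of "-1" c] by simp

text \<open>Induction over integrable functions. For an indicator take K compact inside and V open
  outside A with V - K small: if \<open>z\<close> is so short that K moved by z or -z stays in V,
  then A and its translate differ only inside V - K and its translate. Sums and limits follow from
  the triangle inequality and translation invariance.\<close>

lemma L1_translation_continuous:
  fixes F :: "'a::euclidean_space \<Rightarrow> 'b::{banach, second_countable_topology}"
  assumes "integrable lborel F"
  shows "\<forall>e>0. \<exists>\<delta>>0. \<forall>z. norm z < \<delta> \<longrightarrow> (\<integral>\<^sup>+x. norm (F (x - z) - F x) \<partial>lborel) \<le> ennreal e"
  using assms
proof induction
  case (base A c)
  show ?case
  proof (intro allI impI)
    fix e :: real assume e: "e > 0"
    \<comment> \<open>Two copies of V - K are charged, each weighted by \<open>norm c\<close>; the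
      summand 1 covers \<open>c = 0\<close>.\<close>
    define e' where "e' = e / (2 * (norm c + 1))"
    have e': "e' > 0" "2 * norm c * e' \<le> e" using e by (auto simp: e'_def field_simps add_pos_nonneg)
    obtain K V where KV: "compact K" "open V" "K \<subseteq> A" "A \<subseteq> V" "emeasure lborel (V - K) \<le> ennreal e'"
      using sets_borel_inner_compact_outer_open[of A e'] base e' by auto
    have m [measurable]: "V - K \<in> sets borel" using KV by (auto simp: borel_compact)
    have Am [measurable]: "A \<in> sets borel" using base by simp
    obtain \<delta> where \<delta>: "\<delta> > 0" "(\<Union>x\<in>K. ball x \<delta>) \<subseteq> V"
      using compact_subset_open_imp_ball_epsilon_subset[of K V] KV by blast
    have "(\<integral>\<^sup>+x. norm (indicator A (x - z) *\<^sub>R c - indicator A x *\<^sub>R c) \<partial>lborel) \<le> ennreal e"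
      if z: "norm z < \<delta>" for z
    proof -
      have pt: "ennreal (norm (indicator A (x - z) *\<^sub>R c - indicator A x *\<^sub>R c))
          \<le> ennreal (norm c) * (indicator (V - K) x + indicator (V - K) (- z + x))" for x
      proof -
        have "x \<in> K \<Longrightarrow> x - z \<in> V" "x - z \<in> K \<Longrightarrow> x \<in> V"
          using \<delta>(2) z by (force simp: dist_norm)+
        moreover have "ennreal (norm c) \<le> ennreal (norm c) * 2"
          using mult_left_mono[of 1 "2::ennreal" "ennreal (norm c)"] by simp
        ultimately show ?thesis
          using KV(3,4) by (auto simp: indicator_def)
      qed
      have "(\<integral>\<^sup>+x. norm (indicator A (x - z) *\<^sub>R c - indicator A x *\<^sub>R c) \<partial>lborel)
        \<le> (\<integral>\<^sup>+x. ennreal (norm c) * (indicator (V - K) x + indicator (V - K) (- z + x)) \<partial>lborel)"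
        by (intro nn_integral_mono pt)
      also have "\<dots> = ennreal (norm c) * (emeasure lborel (V - K) + emeasure lborel (V - K))"
        using nn_integral_lborel_translate[of "indicator (V - K)" "- z"]
        by (simp add: nn_integral_cmult nn_integral_add)
      also have "\<dots> \<le> ennreal (norm c) * (ennreal e' + ennreal e')"
        by (intro mult_left_mono add_mono KV) auto
      also have "\<dots> \<le> ennreal e"
        using e' by (simp add: ennreal_plus[symmetric] ennreal_mult[symmetric] ennreal_leI algebra_simps del: ennreal_plus)
      finally show ?thesis .
    qed
    then show "\<exists>\<delta>>0. \<forall>z. norm z < \<delta> \<longrightarrow>
      (\<integral>\<^sup>+x. norm (indicator A (x - z) *\<^sub>R c - indicator A x *\<^sub>R c) \<partial>lborel) \<le> ennreal e"
      using \<delta> by blast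
  qed
next
  case (add f g)
  have [measurable]: "f \<in> borel_measurable borel" "g \<in> borel_measurable borel"
    using add.hyps by (auto dest: borel_measurable_integrable)
  show ?case
  proof (intro allI impI)
    fix e :: real assume e: "e > 0"
    then have e2: "e / 2 > 0" by simp
    obtain d1 where d1: "d1 > 0"
      "\<And>z. norm z < d1 \<Longrightarrow> (\<integral>\<^sup>+x. norm (f (x - z) - f x) \<partial>lborel) \<le> ennreal (e/2)"
      using add.IH(1)[rule_format, OF e2] by blast
    obtain d2 where d2: "d2 > 0"
      "\<And>z. norm z < d2 \<Longrightarrow> (\<integral>\<^sup>+x. norm (g (x - z) - g x) \<partial>lborel) \<le> ennreal (e/2)"
      using add.IH(2)[rule_format, OF e2] by blast
    note d = d1 d2
    have "(\<integral>\<^sup>+x. norm (f (x - z) + g (x - z) - (f x + g x)) \<partial>lborel) \<le> ennreal e"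
      if "norm z < min d1 d2" for z
    proof -
      have "(\<integral>\<^sup>+x. norm (f (x - z) + g (x - z) - (f x + g x)) \<partial>lborel)
        \<le> (\<integral>\<^sup>+x. ennreal (norm (f (x - z) - f x)) + ennreal (norm (g (x - z) - g x)) \<partial>lborel)"
        by (intro nn_integral_mono)
           (simp add: ennreal_plus[symmetric] add_diff_add norm_triangle_ineq ennreal_leI del: ennreal_plus)
      also have "\<dots> \<le> ennreal (e/2) + ennreal (e/2)"
        using d that by (subst nn_integral_add) (auto intro!: add_mono)
      also have "\<dots> = ennreal e" using e by (simp add: ennreal_plus[symmetric] del: ennreal_plus)
      finally show ?thesis .
    qed
    then show "\<exists>\<delta>>0. \<forall>z. norm z < \<delta> \<longrightarrow>
      (\<integral>\<^sup>+x. norm (f (x - z) + g (x - z) - (f x + g x)) \<partial>lborel) \<le> ennreal e"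
      using d by (intro exI[of _ "min d1 d2"]) auto
  qed
next
  case (lim f s)
  have [measurable]: "f \<in> borel_measurable borel" "\<And>i. s i \<in> borel_measurable borel"
    using lim.hyps by (auto dest: borel_measurable_integrable)
  \<comment> \<open>The induction rule supplies approximants bounded by twice the norm of
    \<open>f\<close>, hence the dominating function.\<close>
  have conv: "(\<lambda>i. \<integral>\<^sup>+x. norm (f x - s i x) \<partial>lborel) \<longlonglongrightarrow> 0"
  proof (rule nn_integral_dominated_convergence_norm[where w="\<lambda>x. 2 * norm (f x)"])
    show "(\<integral>\<^sup>+x. ennreal (2 * norm (f x)) \<partial>lborel) < \<infinity>"
      using lim.hyps by (simp add: integrable_iff_bounded ennreal_mult nn_integral_cmult ennreal_mult_less_top)
  qed (use lim.hyps in auto)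
  show ?case
  proof (intro allI impI)
    fix e :: real assume e: "e > 0"
    then have "eventually (\<lambda>i. (\<integral>\<^sup>+x. norm (f x - s i x) \<partial>lborel) < ennreal (e/3)) sequentially"
      by (intro order_tendstoD(2)[OF conv]) auto
    then obtain i where i: "(\<integral>\<^sup>+x. norm (f x - s i x) \<partial>lborel) < ennreal (e/3)"
      by (auto simp: eventually_sequentially)
    obtain d where d: "d > 0"
      "\<And>z. norm z < d \<Longrightarrow> (\<integral>\<^sup>+x. norm (s i (x - z) - s i x) \<partial>lborel) \<le> ennreal (e/3)"
      using lim.IH[of i, rule_format, of "e/3"] e by auto
    have "(\<integral>\<^sup>+x. norm (f (x - z) - f x) \<partial>lborel) \<le> ennreal e" if "norm z < d" for z
    proof -
      have tr: "(\<integral>\<^sup>+x. norm (f (x - z) - s i (x - z)) \<partial>lborel) = (\<integral>\<^sup>+x. norm (f x - s i x) \<partial>lborel)"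
        using nn_integral_lborel_translate[of "\<lambda>x. ennreal (norm (f x - s i x))" "-z"] by simp
      have "(\<integral>\<^sup>+x. norm (f (x - z) - f x) \<partial>lborel)
        \<le> (\<integral>\<^sup>+x. ennreal (norm (f (x - z) - s i (x - z))) + (ennreal (norm (s i (x - z) - s i x))
             + ennreal (norm (f x - s i x))) \<partial>lborel)"
      proof (intro nn_integral_mono)
        fix x
        have "norm (f (x - z) - f x) \<le> norm (f (x - z) - s i (x - z)) + (norm (s i (x - z) - s i x) + norm (f x - s i x))"
          by norm
        then show "ennreal (norm (f (x - z) - f x)) \<le> ennreal (norm (f (x - z) - s i (x - z))) + (ennreal (norm (s i (x - z) - s i x))
             + ennreal (norm (f x - s i x)))"
          by (simp add: ennreal_plus[symmetric] ennreal_leI del: ennreal_plus)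
      qed
      also have "\<dots> \<le> ennreal (e/3) + (ennreal (e/3) + ennreal (e/3))"
        using d(2)[OF that] i by (simp add: nn_integral_add tr add_mono)
      also have "\<dots> = ennreal e" using e by (simp add: ennreal_plus[symmetric] del: ennreal_plus)
      finally show ?thesis .
    qed
    then show "\<exists>\<delta>>0. \<forall>z. norm z < \<delta> \<longrightarrow> (\<integral>\<^sup>+x. norm (f (x - z) - f x) \<partial>lborel) \<le> ennreal e"
      using d by blast
  qed
qed

section \<open>Differentiation of convolutions with compactly supported kernels\<close>

lemma compact_support_imp_bounded:
  fixes D :: "'a::euclidean_space \<Rightarrow> 'b::real_normed_vector"
  assumes "continuous_on UNIV D" "\<And>z. R \<le> norm z \<Longrightarrow> D z = 0"
  obtains B where "0 \<le> B" "\<And>z. norm (D z) \<le> B"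
proof -
  have "compact (D ` cball 0 R)"
    by (rule compact_continuous_image[OF continuous_on_subset[OF assms(1)]]) auto
  then obtain B where B: "\<And>z. z \<in> cball 0 R \<Longrightarrow> norm (D z) \<le> B"
    using compact_imp_bounded[of "D ` cball 0 R"] unfolding bounded_iff by blast
  have "norm (D z) \<le> max B 0" for z
    using B[of z] assms(2)[of z] by (cases "norm z \<le> R") auto
  then show ?thesis using that[of "max B 0"] by auto
qed

lemma compact_support_imp_uniformly_continuous:
  fixes D :: "'a::euclidean_space \<Rightarrow> 'b::real_normed_vector"
  assumes "continuous_on UNIV D" "\<And>z. R \<le> norm z \<Longrightarrow> D z = 0" and e: "0 < e"
  obtains d where "0 < d" "\<And>z z'. norm (z - z') < d \<Longrightarrow> norm (D z - D z') < e"
proof -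
  have "uniformly_continuous_on (cball 0 (R + 1)) D"
    by (rule compact_uniformly_continuous[OF continuous_on_subset[OF assms(1)]]) auto
  then obtain d where d: "d > 0"
    "\<And>z z'. z \<in> cball 0 (R + 1) \<Longrightarrow> z' \<in> cball 0 (R + 1) \<Longrightarrow> dist z' z < d \<Longrightarrow> dist (D z') (D z) < e"
    using e unfolding uniformly_continuous_on_def by metis
  have "norm (D z - D z') < e" if z: "norm (z - z') < min d 1" for z z'
  proof (cases "norm z < R \<or> norm z' < R")
    case True
    then have "norm z \<le> R + 1" "norm z' \<le> R + 1"
      using z norm_triangle_ineq2[of z z'] norm_triangle_ineq2[of z' z] by (auto simp: norm_minus_commute)
    then show ?thesis using d(2)[of z' z] z by (auto simp: dist_norm)
  next
    case False
    then show ?thesis using assms(2)[of z] assms(2)[of z'] e by auto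
  qed
  then show ?thesis using that[of "min d 1"] d by auto
qed

lemma integrable_bounded_scaleR:
  fixes U :: "'a::euclidean_space \<Rightarrow> 'b::{banach, second_countable_topology}" and f :: "'a \<Rightarrow> real"
  assumes "integrable lborel U" "f \<in> borel_measurable borel" "\<And>y. \<bar>f y\<bar> \<le> B"
  shows "integrable lborel (\<lambda>y. f y *\<^sub>R U y)"
proof (rule Bochner_Integration.integrable_bound)
  show "integrable lborel (\<lambda>y. B * norm (U y))" using assms(1) by simp
  show "(\<lambda>y. f y *\<^sub>R U y) \<in> borel_measurable lborel"
    using assms(2) borel_measurable_integrable[OF assms(1)] by simp
  show "AE y in lborel. norm (f y *\<^sub>R U y) \<le> norm (B * norm (U y))"
  proof (intro AE_I2)
    fix y
    have "\<bar>f y\<bar> \<le> \<bar>B\<bar>" using assms(3)[of y] by linarith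
    then show "norm (f y *\<^sub>R U y) \<le> norm (B * norm (U y))"
      by (simp add: abs_mult mult_right_mono)
  qed
qed

lemma integrable_scaleR_bounded:
  fixes U :: "'a::euclidean_space \<Rightarrow> real" and f :: "'a \<Rightarrow> 'b::{banach, second_countable_topology}"
  assumes "integrable lborel U" "f \<in> borel_measurable borel" "\<And>y. norm (f y) \<le> B"
  shows "integrable lborel (\<lambda>y. U y *\<^sub>R f y)"
proof (rule Bochner_Integration.integrable_bound)
  show "integrable lborel (\<lambda>y. B * norm (U y))" using assms(1) by simp
  show "(\<lambda>y. U y *\<^sub>R f y) \<in> borel_measurable lborel"
    using assms(2) borel_measurable_integrable[OF assms(1)] by simp
  show "AE y in lborel. norm (U y *\<^sub>R f y) \<le> norm (B * norm (U y))"
  proof (intro AE_I2)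
    fix y
    have "norm (f y) \<le> \<bar>B\<bar>" using assms(3)[of y] by linarith
    then show "norm (U y *\<^sub>R f y) \<le> norm (B * norm (U y))"
      by (simp add: abs_mult mult.commute[of "\<bar>U y\<bar>"] mult_right_mono)
  qed
qed

context
  fixes U :: "'a::euclidean_space \<Rightarrow> real" and \<rho> :: "'a \<Rightarrow> real" and D :: "'a \<Rightarrow> 'a" and R :: real
  assumes U: "integrable lborel U"
    and \<rho>: "\<And>z. (\<rho> has_derivative (\<lambda>d. D z \<bullet> d)) (at z)" "\<And>z. R \<le> norm z \<Longrightarrow> \<rho> z = 0"
    and D: "continuous_on UNIV D" "\<And>z. R \<le> norm z \<Longrightarrow> D z = 0"
begin

lemma conv_D_integrable: "integrable lborel (\<lambda>y. U y *\<^sub>R D (x - y))"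
proof -
  obtain B where B: "\<And>z. norm (D z) \<le> B" using compact_support_imp_bounded[OF D] by blast
  have [measurable]: "D \<in> borel_measurable borel" using D(1) by (rule borel_measurable_continuous_onI)
  show ?thesis by (rule integrable_scaleR_bounded[OF U _ B]) measurable
qed

lemma conv_\<rho>_integrable: "integrable lborel (\<lambda>y. U y * \<rho> (x - y))"
proof -
  have c: "continuous_on UNIV \<rho>"
    using \<rho>(1) by (intro continuous_at_imp_continuous_on) (auto intro: has_derivative_continuous)
  obtain B where B: "\<And>z. norm (\<rho> z) \<le> B" using compact_support_imp_bounded[OF c \<rho>(2)] by blast
  have [measurable]: "\<rho> \<in> borel_measurable borel" using c by (rule borel_measurable_continuous_onI)
  have "integrable lborel (\<lambda>y. U y *\<^sub>R \<rho> (x - y))"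
    by (rule integrable_scaleR_bounded[OF U _ B]) measurable
  then show ?thesis by simp
qed

lemma conv_D_continuous: "continuous_on UNIV (\<lambda>x. \<integral>y. U y *\<^sub>R D (x - y) \<partial>lborel)"
  unfolding continuous_on_iff
proof (intro ballI allI impI)
  fix x :: 'a and e :: real assume e: "e > 0"
  define I where "I = (\<integral>y. norm (U y) \<partial>lborel)"
  have I: "I \<ge> 0" by (simp add: I_def)
  define e' where "e' = e / (I + 1)"
  have e': "e' > 0" "I * e' < e" using e I by (auto simp: e'_def field_simps)
  obtain d where d: "d > 0" "\<And>z z'. norm (z - z') < d \<Longrightarrow> norm (D z - D z') < e'"
    using compact_support_imp_uniformly_continuous[OF D e'(1)] by blast
  have "norm ((\<integral>y. U y *\<^sub>R D (x' - y) \<partial>lborel) - (\<integral>y. U y *\<^sub>R D (x - y) \<partial>lborel)) < e"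
    if "dist x' x < d" for x'
  proof -
    have "norm ((\<integral>y. U y *\<^sub>R D (x' - y) \<partial>lborel) - (\<integral>y. U y *\<^sub>R D (x - y) \<partial>lborel))
      = norm (\<integral>y. U y *\<^sub>R (D (x' - y) - D (x - y)) \<partial>lborel)"
      by (simp add: Bochner_Integration.integral_diff[OF conv_D_integrable conv_D_integrable, symmetric]
          scaleR_diff_right)
    also have "\<dots> \<le> (\<integral>y. norm (U y) * e' \<partial>lborel)"
    proof (rule Bochner_Integration.integral_norm_bound_integral)
      show "integrable lborel (\<lambda>y. U y *\<^sub>R (D (x' - y) - D (x - y)))"
        using conv_D_integrable[of x] conv_D_integrable[of x'] by (simp add: scaleR_diff_right)
      show "integrable lborel (\<lambda>y. norm (U y) * e')" using U by simp
      show "norm (U y *\<^sub>R (D (x' - y) - D (x - y))) \<le> norm (U y) * e'" for y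
        using d(2)[of "x' - y" "x - y"] that by (auto simp: dist_norm intro!: mult_left_mono)
    qed
    also have "\<dots> = I * e'" by (simp add: I_def)
    finally show ?thesis using e' by simp
  qed
  then show "\<exists>d>0. \<forall>x'\<in>UNIV. dist x' x < d \<longrightarrow>
      dist (\<integral>y. U y *\<^sub>R D (x' - y) \<partial>lborel) (\<integral>y. U y *\<^sub>R D (x - y) \<partial>lborel) < e"
    using d(1) by (auto simp: dist_norm)
qed

text \<open>Differentiation under the integral sign, done directly: by uniform continuity of D the
  linearisation error of \<rho> on a segment shorter than \<open>d\<close> is at most
  \<open>e'\<close> times its length, uniformly in \<open>y\<close>, and this is integrated against
  |U|.\<close>

lemma conv_has_derivative:
  "((\<lambda>x. \<integral>y. U y * \<rho> (x - y) \<partial>lborel) has_derivative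
    (\<lambda>d. (\<integral>y. U y *\<^sub>R D (x - y) \<partial>lborel) \<bullet> d)) (at x)"
  unfolding has_derivative_at_alt
proof (intro conjI allI impI)
  show "bounded_linear (\<lambda>d. (\<integral>y. U y *\<^sub>R D (x - y) \<partial>lborel) \<bullet> d)"
    by (rule bounded_linear_inner_right)
  fix e :: real assume e: "e > 0"
  define I where "I = (\<integral>y. norm (U y) \<partial>lborel)"
  have I: "I \<ge> 0" by (simp add: I_def)
  define e' where "e' = e / (I + 1)"
  have e': "e' > 0" "I * e' \<le> e" using e I by (auto simp: e'_def field_simps)
  obtain d where d: "d > 0" "\<And>z z'. norm (z - z') < d \<Longrightarrow> norm (D z - D z') < e'"
    using compact_support_imp_uniformly_continuous[OF D e'(1)] by blast
  have "norm ((\<integral>y. U y * \<rho> (x' - y) \<partial>lborel) - (\<integral>y. U y * \<rho> (x - y) \<partial>lborel)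
      - (\<integral>y. U y *\<^sub>R D (x - y) \<partial>lborel) \<bullet> (x' - x)) \<le> e * norm (x' - x)"
    if x': "norm (x' - x) < d" for x'
  proof -
    have pt: "norm (\<rho> (x' - y) - \<rho> (x - y) - D (x - y) \<bullet> (x' - x)) \<le> norm (x' - x) * e'" for y
    proof -
      have "norm (\<rho> (x' - y) - \<rho> (x - y) - D (x - y) \<bullet> ((x' - y) - (x - y)))
        \<le> norm ((x' - y) - (x - y)) * e'"
      proof (rule differentiable_bound_linearization[of "x - y" "x' - y" "ball (x - y) d" \<rho> "\<lambda>z d. D z \<bullet> d" "x - y"])
        show "(x - y) + t *\<^sub>R ((x' - y) - (x - y)) \<in> ball (x - y) d" if "t \<in> {0..1}" for t
        proof -
          have "norm (t *\<^sub>R (x' - x)) \<le> norm (x' - x)"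
            using that by (simp add: mult_left_le_one_le)
          then show ?thesis using x' by (simp add: dist_norm norm_minus_commute)
        qed
        show "(\<rho> has_derivative (\<lambda>d. D z \<bullet> d)) (at z within ball (x - y) d)" for z
          using \<rho>(1) by (rule has_derivative_at_withinI)
        show "onorm ((\<lambda>d. D z \<bullet> d) - (\<lambda>d. D (x - y) \<bullet> d)) \<le> e'" if "z \<in> ball (x - y) d" for z
        proof (rule onorm_bound)
          show "0 \<le> e'" using e' by simp
          fix v
          have "norm (((\<lambda>d. D z \<bullet> d) - (\<lambda>d. D (x - y) \<bullet> d)) v) = norm ((D z - D (x - y)) \<bullet> v)"
            by (simp add: inner_diff_left)
          also have "\<dots> \<le> norm (D z - D (x - y)) * norm v"
            using Cauchy_Schwarz_ineq2 by simp
          also have "\<dots> \<le> e' * norm v"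
            using d(2)[of z "x - y"] that by (intro mult_right_mono) (auto simp: dist_norm norm_minus_commute)
          finally show "norm (((\<lambda>d. D z \<bullet> d) - (\<lambda>d. D (x - y) \<bullet> d)) v) \<le> e' * norm v" .
        qed
        show "x - y \<in> ball (x - y) d" using d by simp
      qed
      then show ?thesis by simp
    qed
    have "integrable lborel (\<lambda>y. (U y *\<^sub>R D (x - y)) \<bullet> (x' - x))"
      by (intro integrable_inner_left conv_D_integrable)
    then have i1: "integrable lborel (\<lambda>y. U y * (D (x - y) \<bullet> (x' - x)))" by simp
    have i2: "(\<integral>y. U y *\<^sub>R D (x - y) \<partial>lborel) \<bullet> (x' - x) = (\<integral>y. U y * (D (x - y) \<bullet> (x' - x)) \<partial>lborel)"
      by (subst integral_inner_left[symmetric]) (auto intro: conv_D_integrable)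
    have eq: "(\<integral>y. U y * \<rho> (x' - y) \<partial>lborel) - (\<integral>y. U y * \<rho> (x - y) \<partial>lborel)
      - (\<integral>y. U y *\<^sub>R D (x - y) \<partial>lborel) \<bullet> (x' - x) =
      (\<integral>y. U y * (\<rho> (x' - y) - \<rho> (x - y) - D (x - y) \<bullet> (x' - x)) \<partial>lborel)"
      using conv_\<rho>_integrable[of x] conv_\<rho>_integrable[of x'] i1
      by (simp add: i2 right_diff_distrib)
    have "norm (\<integral>y. U y * (\<rho> (x' - y) - \<rho> (x - y) - D (x - y) \<bullet> (x' - x)) \<partial>lborel)
       \<le> (\<integral>y. norm (U y) * (norm (x' - x) * e') \<partial>lborel)"
    proof (rule Bochner_Integration.integral_norm_bound_integral)
      show "integrable lborel (\<lambda>y. U y * (\<rho> (x' - y) - \<rho> (x - y) - D (x - y) \<bullet> (x' - x)))"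
        using conv_\<rho>_integrable[of x] conv_\<rho>_integrable[of x'] i1 by (simp add: right_diff_distrib)
      show "integrable lborel (\<lambda>y. norm (U y) * (norm (x' - x) * e'))" using U by simp
      show "norm (U y * (\<rho> (x' - y) - \<rho> (x - y) - D (x - y) \<bullet> (x' - x))) \<le> norm (U y) * (norm (x' - x) * e')" for y
        using mult_left_mono[OF pt[of y], of "norm (U y)"] by (simp only: norm_mult norm_ge_zero)
    qed
    also have "\<dots> = (I * e') * norm (x' - x)" by (simp add: I_def)
    also have "\<dots> \<le> e * norm (x' - x)" using e' by (intro mult_right_mono) auto
    finally show ?thesis unfolding eq .
  qed
  then show "\<exists>d>0. \<forall>x'. norm (x' - x) < d \<longrightarrow>
    norm ((\<integral>y. U y * \<rho> (x' - y) \<partial>lborel) - (\<integral>y. U y * \<rho> (x - y) \<partial>lborel)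
      - (\<integral>y. U y *\<^sub>R D (x - y) \<partial>lborel) \<bullet> (x' - x)) \<le> e * norm (x' - x)"
    using d(1) by blast
qed

end

section \<open>The normalised mollifier\<close>

definition bump :: "real \<Rightarrow> 'a::euclidean_space \<Rightarrow> real" where
  "bump \<epsilon> z = inverse (\<integral>y. bump0 \<epsilon> (y :: 'a) \<partial>lborel) * bump0 \<epsilon> z"

definition dbump :: "real \<Rightarrow> 'a::euclidean_space \<Rightarrow> 'a" where
  "dbump \<epsilon> z = inverse (\<integral>y. bump0 \<epsilon> (y :: 'a) \<partial>lborel) *\<^sub>R dbump0 \<epsilon> z"

definition mollify :: "real \<Rightarrow> ('a::euclidean_space \<Rightarrow> 'b::{banach, second_countable_topology}) \<Rightarrow> 'a \<Rightarrow> 'b" where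
  "mollify \<epsilon> F x = (\<integral>y. bump \<epsilon> (x - y) *\<^sub>R F y \<partial>lborel)"

lemma bump_has_derivative: "(bump \<epsilon> has_derivative (\<lambda>d. dbump \<epsilon> z \<bullet> d)) (at z)"
  unfolding bump_def dbump_def inner_scaleR_left
  by (intro has_derivative_mult_right bump0_has_derivative)

lemma continuous_dbump: "continuous_on S (dbump \<epsilon>)"
  unfolding dbump_def by (intro continuous_intros continuous_dbump0)

lemma continuous_bump: "continuous_on S (bump \<epsilon>)"
  unfolding bump_def by (intro continuous_intros continuous_bump0)

lemma measurable_bump [measurable]: "bump \<epsilon> \<in> borel_measurable borel"
  by (rule borel_measurable_continuous_onI[OF continuous_bump])

lemma bump_eq_0: "0 < \<epsilon> \<Longrightarrow> norm z \<ge> \<epsilon> \<Longrightarrow> bump \<epsilon> z = 0"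
  by (simp add: bump_def bump0_eq_0)

lemma dbump_eq_0: "0 < \<epsilon> \<Longrightarrow> norm z \<ge> \<epsilon> \<Longrightarrow> dbump \<epsilon> z = 0"
  by (simp add: dbump_def dbump0_eq_0)

lemma bump_nonneg: "0 \<le> bump \<epsilon> z"
  by (simp add: bump_def bump0_nonneg)

lemma bump0_integrable:
  assumes "0 < \<epsilon>"
  shows "integrable lborel (bump0 \<epsilon> :: 'a::euclidean_space \<Rightarrow> real)"
proof -
  have "integrable lborel (\<lambda>x::'a. indicator (cball 0 \<epsilon>) x *\<^sub>R bump0 \<epsilon> x)"
    by (rule borel_integrable_compact) (auto intro: continuous_bump0)
  also have "(\<lambda>x::'a. indicator (cball 0 \<epsilon>) x *\<^sub>R bump0 \<epsilon> x) = bump0 \<epsilon>"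
    using bump0_eq_0[OF assms] by (force simp: indicator_def)
  finally show ?thesis .
qed

lemma nn_integral_bump:
  assumes "0 < \<epsilon>"
  shows "(\<integral>\<^sup>+z. bump \<epsilon> (z :: 'a::euclidean_space) \<partial>lborel) = 1"
proof -
  let ?I = "\<integral>y. bump0 \<epsilon> (y :: 'a) \<partial>lborel"
  have nn: "0 \<le> ?I" by (simp add: bump0_nonneg)
  have "?I \<noteq> 0"
  proof
    assume "?I = 0"
    then have "AE z in lborel. bump0 \<epsilon> (z::'a) = 0"
      using integral_nonneg_eq_0_iff_AE[OF bump0_integrable[OF assms, where 'a='a]] bump0_nonneg by auto
    then have "AE z in lborel. (z::'a) \<notin> ball 0 \<epsilon>"
      by eventually_elim (use bump0_pos in fastforce)
    then have "ball (0::'a) \<epsilon> \<in> null_sets lborel"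
      by (subst AE_iff_null_sets) auto
    then have "emeasure lborel (ball (0::'a) \<epsilon>) = 0" by (rule null_setsD1)
    then show False
      using content_ball_pos[OF assms, of "0::'a"] by (simp add: measure_def)
  qed
  with nn have "integrable lborel (bump \<epsilon> :: 'a \<Rightarrow> real)" "(\<integral>z. bump \<epsilon> (z :: 'a) \<partial>lborel) = 1"
    using bump0_integrable[OF assms, where 'a='a] by (simp_all add: bump_def[abs_def])
  then show ?thesis by (simp add: nn_integral_eq_integral bump_nonneg)
qed

lemma bump_bounded:
  assumes "0 < \<epsilon>"
  obtains B where "\<And>z::'a::euclidean_space. \<bar>bump \<epsilon> z\<bar> \<le> B"
  using compact_support_imp_bounded[OF continuous_bump, of \<epsilon> \<epsilon>] bump_eq_0[OF assms]
  by (metis real_norm_def)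

lemma bump_integrable:
  fixes x :: "'a::euclidean_space"
  assumes "0 < \<epsilon>"
  shows "integrable lborel (\<lambda>y. bump \<epsilon> (x - y))" "(\<integral>y. bump \<epsilon> (x - y) \<partial>lborel) = 1"
proof -
  have "has_bochner_integral lborel (\<lambda>y::'a. bump \<epsilon> (x - y)) 1"
    using nn_integral_lborel_reflect[of "\<lambda>z::'a. ennreal (bump \<epsilon> z)" x] nn_integral_bump[OF assms, where 'a='a]
    by (intro has_bochner_integral_nn_integral) (auto simp: bump_nonneg)
  then show "integrable lborel (\<lambda>y. bump \<epsilon> (x - y))" "(\<integral>y. bump \<epsilon> (x - y) \<partial>lborel) = 1"
    by (auto simp: has_bochner_integral_iff)
qed

lemma mollify_integrand_integrable:
  fixes F :: "'a::euclidean_space \<Rightarrow> 'b::{banach, second_countable_topology}"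
  assumes "0 < \<epsilon>" "integrable lborel F"
  shows "integrable lborel (\<lambda>y. bump \<epsilon> (x - y) *\<^sub>R F y)"
proof -
  obtain B where B: "\<And>z::'a. \<bar>bump \<epsilon> z\<bar> \<le> B" using bump_bounded[OF assms(1)] by blast
  show ?thesis
    by (rule integrable_bounded_scaleR[OF assms(2) _ B]) measurable
qed

lemma measurable_mollify [measurable]:
  fixes F :: "'a::euclidean_space \<Rightarrow> 'b::{banach, second_countable_topology}"
  assumes [measurable]: "F \<in> borel_measurable borel"
  shows "mollify \<epsilon> F \<in> borel_measurable borel"
  unfolding mollify_def by measurable

text \<open>Averaging translates: the mollification error is a mean of \<open>L\<^sup>1\<close> translation errors.\<close>
lemma mollify_L1_tendsto:
  fixes F :: "'a::euclidean_space \<Rightarrow> 'b::{banach, second_countable_topology}"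
  assumes F: "integrable lborel F" and e: "0 < e"
  shows "\<exists>\<delta>>0. \<forall>\<epsilon>. 0 < \<epsilon> \<and> \<epsilon> < \<delta> \<longrightarrow> (\<integral>\<^sup>+x. norm (mollify \<epsilon> F x - F x) \<partial>lborel) \<le> ennreal e"
proof -
  have [measurable]: "F \<in> borel_measurable borel" using borel_measurable_integrable[OF F] by simp
  obtain \<delta> where \<delta>: "\<delta> > 0" "\<And>z. norm z < \<delta> \<Longrightarrow> (\<integral>\<^sup>+x. norm (F (x - z) - F x) \<partial>lborel) \<le> ennreal e"
    using L1_translation_continuous[OF F] e by blast
  have "(\<integral>\<^sup>+x. norm (mollify \<epsilon> F x - F x) \<partial>lborel) \<le> ennreal e" if \<epsilon>: "0 < \<epsilon>" "\<epsilon> < \<delta>" for \<epsilon>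
  proof -
    have pt: "ennreal (norm (mollify \<epsilon> F x - F x)) \<le> (\<integral>\<^sup>+z. ennreal (bump \<epsilon> z) * ennreal (norm (F (x - z) - F x)) \<partial>lborel)" for x
    proof -
      have i: "integrable lborel (\<lambda>y. bump \<epsilon> (x - y) *\<^sub>R F x)"
        using bump_integrable(1)[OF \<epsilon>(1), of x] by simp
      have "mollify \<epsilon> F x - F x = (\<integral>y. bump \<epsilon> (x - y) *\<^sub>R F y - bump \<epsilon> (x - y) *\<^sub>R F x \<partial>lborel)"
        using mollify_integrand_integrable[OF \<epsilon>(1) F, of x] i bump_integrable[OF \<epsilon>(1), of x]
        by (simp add: mollify_def)
      also have "ennreal (norm \<dots>) \<le> (\<integral>\<^sup>+y. norm (bump \<epsilon> (x - y) *\<^sub>R F y - bump \<epsilon> (x - y) *\<^sub>R F x) \<partial>lborel)"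
        using mollify_integrand_integrable[OF \<epsilon>(1) F, of x] i
        by (intro integral_norm_bound_ennreal) auto
      also have "\<dots> = (\<integral>\<^sup>+y. ennreal (bump \<epsilon> (x - y)) * ennreal (norm (F (x - (x - y)) - F x)) \<partial>lborel)"
        by (intro nn_integral_cong)
           (simp add: scaleR_diff_right[symmetric] ennreal_mult bump_nonneg)
      also have "\<dots> = (\<integral>\<^sup>+z. ennreal (bump \<epsilon> z) * ennreal (norm (F (x - z) - F x)) \<partial>lborel)"
        by (rule nn_integral_lborel_reflect) measurable
      finally show ?thesis .
    qed
    have "(\<integral>\<^sup>+x. norm (mollify \<epsilon> F x - F x) \<partial>lborel) \<le>
      (\<integral>\<^sup>+x. (\<integral>\<^sup>+z. ennreal (bump \<epsilon> z) * ennreal (norm (F (x - z) - F x)) \<partial>lborel) \<partial>lborel)"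
      by (intro nn_integral_mono pt)
    also have "\<dots> = (\<integral>\<^sup>+z. (\<integral>\<^sup>+x. ennreal (bump \<epsilon> z) * ennreal (norm (F (x - z) - F x)) \<partial>lborel) \<partial>lborel)"
      by (rule lborel_pair.Fubini') measurable
    also have "\<dots> = (\<integral>\<^sup>+z. ennreal (bump \<epsilon> z) * (\<integral>\<^sup>+x. ennreal (norm (F (x - z) - F x)) \<partial>lborel) \<partial>lborel)"
      by (intro nn_integral_cong nn_integral_cmult) measurable
    also have "\<dots> \<le> (\<integral>\<^sup>+z. ennreal (bump \<epsilon> (z::'a)) * ennreal e \<partial>lborel)"
    \<comment> \<open>The bump vanishes unless |z| < \<epsilon> < \<delta>, so only short
      translations contribute.\<close>
    proof (rule nn_integral_mono)
      fix z :: 'a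
      show "ennreal (bump \<epsilon> z) * (\<integral>\<^sup>+x. ennreal (norm (F (x - z) - F x)) \<partial>lborel) \<le> ennreal (bump \<epsilon> z) * ennreal e"
        using \<delta>(2)[of z] bump_eq_0[of \<epsilon> z] \<epsilon> by (cases "norm z < \<delta>") (auto intro!: mult_left_mono)
    qed
    also have "\<dots> = ennreal e" by (simp add: nn_integral_multc nn_integral_bump[OF \<epsilon>(1)])
    finally show ?thesis .
  qed
  then show ?thesis using \<delta>(1) by blast
qed

subsection \<open>Local limits of continuously differentiable functions\<close>

text \<open>For positive \<eta> a compact subset of the punctured space; these sets exhaust it as
  \<eta> tends to 0, so one real parameter encodes local integrability and local convergence away
  from the origin.\<close>

definition annulus :: "real \<Rightarrow> 'a::euclidean_space set" where
  "annulus \<eta> = {x. \<eta> \<le> norm x \<and> norm x \<le> 1 / \<eta>}"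

lemma compact_annulus: "compact (annulus \<eta>)"
proof -
  have "annulus \<eta> = cball 0 (1 / \<eta>) - (ball 0 \<eta> :: 'a set)" by (auto simp: annulus_def)
  then show ?thesis by (simp add: compact_diff)
qed

lemma annulus_sets [measurable]: "annulus \<eta> \<in> sets borel"
  by (rule borel_compact[OF compact_annulus])

lemma annulus_nz: "0 < \<eta> \<Longrightarrow> annulus \<eta> \<subseteq> - {0}"
  by (auto simp: annulus_def)

lemma annulus_mono: "0 < \<eta> \<Longrightarrow> \<eta> \<le> \<zeta> \<Longrightarrow> annulus \<zeta> \<subseteq> annulus \<eta>"
  by (auto simp: annulus_def intro: order_trans[OF _ frac_le])

lemma annulus_exhausts:
  assumes "x \<noteq> 0" shows "eventually (\<lambda>n. x \<in> annulus (1 / real (Suc n))) sequentially"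
proof -
  obtain m where m: "real m \<ge> max (norm x) (1 / norm x)" by (meson real_arch_simple)
  have "x \<in> annulus (1 / real (Suc n))" if "n \<ge> m" for n
  proof -
    have "1 \<le> real m * norm x" using m assms by (simp add: field_simps)
    also have "\<dots> \<le> real n * norm x" using that by (intro mult_right_mono) auto
    finally have "1 \<le> norm x + real n * norm x" by (simp add: add_increasing)
    then show ?thesis using m that by (simp add: annulus_def field_simps)
  qed
  then show ?thesis by (auto simp: eventually_sequentially)
qed

lemma ennreal_tendsto_0I:
  fixes f :: "'a \<Rightarrow> ennreal"
  assumes "\<And>e. 0 < e \<Longrightarrow> eventually (\<lambda>k. f k \<le> ennreal e) F"
  shows "(f \<longlongrightarrow> 0) F"
proof (rule order_tendstoI)
  fix a :: ennreal assume "0 < a"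
  then obtain b where b: "0 < b" "b < a" using dense by blast
  then obtain e where e: "b = ennreal e" "0 < e" by (cases b) auto
  show "eventually (\<lambda>k. f k < a) F"
    using assms[OF e(2)] by eventually_elim (use b e in auto)
qed auto

abbreviation L1_gap :: "real \<Rightarrow> ('a::euclidean_space \<Rightarrow> real) \<Rightarrow> ('a \<Rightarrow> 'a) \<Rightarrow> ('a \<Rightarrow> real) \<Rightarrow> ('a \<Rightarrow> 'a) \<Rightarrow> ennreal" where
  "L1_gap \<eta> v h u g \<equiv> \<integral>\<^sup>+x. ennreal (norm (v x - u x) + norm (h x - g x)) * indicator (annulus \<eta>) x \<partial>lborel"

text \<open>Local L^1 convergence on the punctured space of C^1 functions together with their
  gradients. It replaces the weak gradient from here on: chain rule, product rule and fundamental
  theorem pass from \<open>v\<close>, \<open>h\<close> to \<open>u\<close>, \<open>g\<close> without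
  test functions.\<close>

definition C1_limit :: "('a::euclidean_space \<Rightarrow> real) \<Rightarrow> ('a \<Rightarrow> 'a) \<Rightarrow> bool" where
  "C1_limit u g \<longleftrightarrow> u \<in> borel_measurable borel \<and> g \<in> borel_measurable borel \<and>
    (\<forall>\<eta>>0. (\<integral>\<^sup>+x. ennreal (norm (u x) + norm (g x)) * indicator (annulus \<eta>) x \<partial>lborel) < \<infinity>) \<and>
    (\<exists>v h. (\<forall>k x. x \<noteq> 0 \<longrightarrow> (v k has_derivative (\<lambda>d. h k x \<bullet> d)) (at x)) \<and>
      (\<forall>k. continuous_on (- {0}) (h k)) \<and>
      (\<forall>\<eta>>0. (\<lambda>k. L1_gap \<eta> (v k) (h k) u g)
         \<longlonglongrightarrow> 0))"

lemma L1loc_punct_integrable: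
  "L1loc_punct u \<Longrightarrow> 0 < \<eta> \<Longrightarrow> integrable lborel (\<lambda>x. indicator (annulus \<eta>) x *\<^sub>R u x)"
  using compact_annulus[of \<eta>] annulus_nz[of \<eta>] unfolding L1loc_punct_def set_integrable_def by blast

text \<open>The restrictions to annuli converge pointwise to \<open>u\<close> except at the origin,
  and changing one value does not affect measurability.\<close>

lemma L1loc_punct_measurable:
  fixes u :: "'a::euclidean_space \<Rightarrow> 'b::{banach, second_countable_topology}"
  assumes "L1loc_punct u" shows "u \<in> borel_measurable borel"
proof -
  have "(\<lambda>x. indicator (- {0}) x *\<^sub>R u x) \<in> borel_measurable borel"
  proof (rule borel_measurable_LIMSEQ_metric)
    show "(\<lambda>x. indicator (annulus (1 / real (Suc n))) x *\<^sub>R u x) \<in> borel_measurable borel" for n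
      using borel_measurable_integrable[OF L1loc_punct_integrable[OF assms, of "1 / real (Suc n)"]] by simp
    show "(\<lambda>n. indicator (annulus (1 / real (Suc n))) x *\<^sub>R u x) \<longlonglongrightarrow> indicator (- {0}) x *\<^sub>R u x" for x
    proof (cases "x = 0")
      case True
      then have "x \<notin> annulus (1 / real (Suc n))" for n by (simp add: annulus_def)
      then show ?thesis using True by simp
    next
      case False
      show ?thesis
        by (rule tendsto_eventually, rule eventually_mono[OF annulus_exhausts[OF False]]) (use False in auto)
    qed
  qed
  then show ?thesis
    by (rule measurable_discrete_difference[where X="{0}"]) auto
qed

text \<open>The approximants are mollifications of u cut off to an annulus. On a fixed annulus the
  cut-off is eventually invisible and the kernel is an admissible test function, so the gradient of
  the mollified u is the mollified g.\<close>

lemma weak_grad_imp_C1_limit: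
  fixes u :: "real^'n \<Rightarrow> real" and g :: "real^'n \<Rightarrow> real^'n"
  assumes wg: "weak_grad u g"
  shows "C1_limit u g"
proof -
  have L: "L1loc_punct u" "L1loc_punct g" using wg by (auto simp: weak_grad_def)
  have [measurable]: "u \<in> borel_measurable borel" "g \<in> borel_measurable borel"
    using L by (auto intro: L1loc_punct_measurable)
  \<comment> \<open>The same sequence serves as mollification radius and as cut-off
    parameter.\<close>
  define \<epsilon> where "\<epsilon> k = 1 / real (k + 2)" for k
  have \<epsilon>: "\<epsilon> k > 0" for k by (simp add: \<epsilon>_def)
  define Fu where "Fu \<zeta> = (\<lambda>y. indicator (annulus \<zeta>) y *\<^sub>R u y)" for \<zeta>
  define Fg where "Fg \<zeta> = (\<lambda>y. indicator (annulus \<zeta>) y *\<^sub>R g y)" for \<zeta>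
  have Fi: "integrable lborel (Fu \<zeta>)" "integrable lborel (Fg \<zeta>)" if "0 < \<zeta>" for \<zeta>
    using L1loc_punct_integrable[OF L(1) that] L1loc_punct_integrable[OF L(2) that] by (auto simp: Fu_def Fg_def)
  define v where "v k x = (\<integral>y. Fu (\<epsilon> k) y * bump (\<epsilon> k) (x - y) \<partial>lborel)" for k x
  define h where "h k x = (\<integral>y. Fu (\<epsilon> k) y *\<^sub>R dbump (\<epsilon> k) (x - y) \<partial>lborel)" for k x
  have der: "(v k has_derivative (\<lambda>d. h k x \<bullet> d)) (at x)" for k x
    unfolding v_def h_def
    by (rule conv_has_derivative[OF Fi(1)[OF \<epsilon>] bump_has_derivative bump_eq_0[OF \<epsilon>] continuous_dbump dbump_eq_0[OF \<epsilon>]])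
  have cont: "continuous_on UNIV (h k)" for k
    unfolding h_def
    by (rule conv_D_continuous[OF Fi(1)[OF \<epsilon>] bump_has_derivative bump_eq_0[OF \<epsilon>] continuous_dbump dbump_eq_0[OF \<epsilon>]])
  \<comment> \<open>The value \<zeta> = \<eta>/(2 + \<eta>) gives both \<zeta> \<le> \<eta>/2 and
    1/\<zeta> = 2/\<eta> + 1, so a ball of radius at most \<zeta> around a point of the
    \<eta>-annulus lies in the \<zeta>-annulus.\<close>
  have near: "y \<in> annulus \<zeta>" "y \<in> annulus (\<epsilon> k)"
    if "0 < \<eta>" "\<zeta> = \<eta> / (2 + \<eta>)" "\<epsilon> k \<le> \<zeta>" "x \<in> annulus \<eta>" "norm (x - y) < \<epsilon> k" for \<eta> \<zeta> k x y
  proof -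
    have "\<zeta> \<le> \<eta> / 2" "\<zeta> \<le> 1" "0 < \<zeta>" "1 / \<zeta> = 2 / \<eta> + 1"
      using that(1) unfolding that(2) by (simp_all add: field_simps)
    moreover have "norm y \<ge> norm x - norm (x - y)" "norm y \<le> norm x + norm (x - y)"
      using norm_triangle_ineq2[of x "x - y"] norm_triangle_ineq4[of x "x - y"] by auto
    moreover have "2 / \<eta> \<ge> 1 / \<eta>" using that(1) by (simp add: field_simps)
    ultimately show "y \<in> annulus \<zeta>" using that(3-) by (auto simp: annulus_def)
    then show "y \<in> annulus (\<epsilon> k)" using annulus_mono[OF \<epsilon> that(3)] by auto
  qed
  \<comment> \<open>The cut-off in \<open>v k\<close> moves with \<open>k\<close>. Trading it for
    the fixed one at \<zeta> makes \<open>mollify_L1_tendsto\<close> applicable, which concerns a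
    single integrable function.\<close>
  have v_eq: "v k x = mollify (\<epsilon> k) (Fu \<zeta>) x"
    if "0 < \<eta>" "\<zeta> = \<eta> / (2 + \<eta>)" "\<epsilon> k \<le> \<zeta>" "x \<in> annulus \<eta>" for \<eta> \<zeta> k x
    unfolding v_def mollify_def
  proof (rule Bochner_Integration.integral_cong[OF refl])
    fix y show "Fu (\<epsilon> k) y * bump (\<epsilon> k) (x - y) = bump (\<epsilon> k) (x - y) *\<^sub>R Fu \<zeta> y"
      using near[OF that, of y] bump_eq_0[OF \<epsilon>[of k], of "x - y"]
      by (cases "norm (x - y) < \<epsilon> k") (auto simp: Fu_def)
  qed
  have h_eq: "h k x = mollify (\<epsilon> k) (Fg \<zeta>) x"
    if a: "0 < \<eta>" "\<zeta> = \<eta> / (2 + \<eta>)" "\<epsilon> k \<le> \<zeta>" "x \<in> annulus \<eta>" for \<eta> \<zeta> k x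
  proof (rule vec_eq_iff[THEN iffD2], rule allI)
    fix i
    have z: "0 < \<zeta>" "\<zeta> < \<eta>" using a(1) unfolding a(2) by (simp_all add: field_simps add_pos_pos)
    have x: "\<epsilon> k < norm x" using z a by (auto simp: annulus_def)
    define \<phi> where "\<phi> y = bump (\<epsilon> k) (x - y)" for y
    have tf: "test_fun \<phi>"
      unfolding \<phi>_def bump_def by (rule test_fun_bump0[OF \<epsilon> x])
    have "((\<lambda>y. bump (\<epsilon> k) (x - y)) has_derivative (\<lambda>d. dbump (\<epsilon> k) (x - y) \<bullet> (- d))) (at y)" for y
      by (rule has_derivative_compose[OF _ bump_has_derivative, of "\<lambda>y. x - y"])
         (auto intro!: derivative_eq_intros)
    then have "frechet_derivative \<phi> (at y) = (\<lambda>d. dbump (\<epsilon> k) (x - y) \<bullet> (- d))" for y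
      unfolding \<phi>_def by (metis frechet_derivative_at)
    then have fd: "frechet_derivative \<phi> (at y) (axis i 1) = - (dbump (\<epsilon> k) (x - y) $ i)" for y
      by (simp add: inner_axis)
    have "(\<integral>y. u y * frechet_derivative \<phi> (at y) (axis i 1) \<partial>lborel) = - (\<integral>y. g y $ i * \<phi> y \<partial>lborel)"
      using wg tf by (auto simp: weak_grad_def)
    \<comment> \<open>The minus sign from differentiating in \<open>y\<close> through
      \<open>x - y\<close> cancels the one in the definition of the weak gradient.\<close>
    then have weak: "(\<integral>y. u y * dbump (\<epsilon> k) (x - y) $ i \<partial>lborel) = (\<integral>y. g y $ i * \<phi> y \<partial>lborel)"
      by (simp add: fd)
    have hi: "integrable lborel (\<lambda>y. Fu (\<epsilon> k) y *\<^sub>R dbump (\<epsilon> k) (x - y))"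
      by (rule conv_D_integrable[OF Fi(1)[OF \<epsilon>] bump_has_derivative bump_eq_0[OF \<epsilon>] continuous_dbump dbump_eq_0[OF \<epsilon>]])
    have "h k x $ i = h k x \<bullet> axis i 1" by (simp add: inner_axis)
    also have "\<dots> = (\<integral>y. (Fu (\<epsilon> k) y *\<^sub>R dbump (\<epsilon> k) (x - y)) \<bullet> axis i 1 \<partial>lborel)"
      unfolding h_def using hi by (rule integral_inner_left[symmetric])
    also have "\<dots> = (\<integral>y. u y * dbump (\<epsilon> k) (x - y) $ i \<partial>lborel)"
    proof (rule Bochner_Integration.integral_cong[OF refl])
      fix y show "(Fu (\<epsilon> k) y *\<^sub>R dbump (\<epsilon> k) (x - y)) \<bullet> axis i 1 = u y * dbump (\<epsilon> k) (x - y) $ i"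
        using near[OF a, of y] dbump_eq_0[OF \<epsilon>[of k], of "x - y"]
        by (cases "norm (x - y) < \<epsilon> k") (auto simp: Fu_def inner_axis)
    qed
    also have "\<dots> = (\<integral>y. g y $ i * \<phi> y \<partial>lborel)" by (rule weak)
    also have "\<dots> = (\<integral>y. (bump (\<epsilon> k) (x - y) *\<^sub>R Fg \<zeta> y) \<bullet> axis i 1 \<partial>lborel)"
    proof (rule Bochner_Integration.integral_cong[OF refl])
      fix y show "g y $ i * \<phi> y = (bump (\<epsilon> k) (x - y) *\<^sub>R Fg \<zeta> y) \<bullet> axis i 1"
        using near[OF a, of y] bump_eq_0[OF \<epsilon>[of k], of "x - y"]
        by (cases "norm (x - y) < \<epsilon> k") (auto simp: Fg_def inner_axis \<phi>_def)
    qed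
    also have "\<dots> = mollify (\<epsilon> k) (Fg \<zeta>) x \<bullet> axis i 1"
      unfolding mollify_def using mollify_integrand_integrable[OF \<epsilon> Fi(2)[OF z(1)]]
      by (intro integral_inner_left) auto
    finally show "h k x $ i = mollify (\<epsilon> k) (Fg \<zeta>) x $ i" by (simp add: inner_axis)
  qed
  have conv: "(\<lambda>k. L1_gap \<eta> (v k) (h k) u g) \<longlonglongrightarrow> 0"
    if \<eta>: "0 < \<eta>" for \<eta>
  proof (rule ennreal_tendsto_0I)
    fix e :: real assume "0 < e"
    then have e: "e / 2 > 0" by simp
    define \<zeta> where "\<zeta> = \<eta> / (2 + \<eta>)"
    have z: "0 < \<zeta>" "\<zeta> \<le> \<eta>" using \<eta> by (auto simp: \<zeta>_def field_simps)
    obtain \<delta>1 where d1: "\<delta>1 > 0" "\<And>\<epsilon>. 0 < \<epsilon> \<Longrightarrow> \<epsilon> < \<delta>1 \<Longrightarrow> (\<integral>\<^sup>+x. norm (mollify \<epsilon> (Fu \<zeta>) x - Fu \<zeta> x) \<partial>lborel) \<le> ennreal (e/2)"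
      using mollify_L1_tendsto[OF Fi(1)[OF z(1)] e] by blast
    obtain \<delta>2 where d2: "\<delta>2 > 0" "\<And>\<epsilon>. 0 < \<epsilon> \<Longrightarrow> \<epsilon> < \<delta>2 \<Longrightarrow> (\<integral>\<^sup>+x. norm (mollify \<epsilon> (Fg \<zeta>) x - Fg \<zeta> x) \<partial>lborel) \<le> ennreal (e/2)"
      using mollify_L1_tendsto[OF Fi(2)[OF z(1)] e] by blast
    have "\<epsilon> \<longlonglongrightarrow> 0" unfolding \<epsilon>_def by real_asymp
    then have "eventually (\<lambda>k. \<epsilon> k < min \<zeta> (min \<delta>1 \<delta>2)) sequentially"
      by (rule order_tendstoD(2)) (use z d1 d2 in auto)
    then show "eventually (\<lambda>k. (L1_gap \<eta> (v k) (h k) u g) \<le> ennreal e) sequentially"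
    proof eventually_elim
      case (elim k)
      have [measurable]: "Fu \<zeta> \<in> borel_measurable borel" "Fg \<zeta> \<in> borel_measurable borel"
        by (auto simp: Fu_def Fg_def)
      have "(L1_gap \<eta> (v k) (h k) u g)
        \<le> (\<integral>\<^sup>+x. ennreal (norm (mollify (\<epsilon> k) (Fu \<zeta>) x - Fu \<zeta> x)) + ennreal (norm (mollify (\<epsilon> k) (Fg \<zeta>) x - Fg \<zeta> x)) \<partial>lborel)"
      proof (rule nn_integral_mono)
        fix x show "ennreal (norm (v k x - u x) + norm (h k x - g x)) * indicator (annulus \<eta>) x \<le>
          ennreal (norm (mollify (\<epsilon> k) (Fu \<zeta>) x - Fu \<zeta> x)) + ennreal (norm (mollify (\<epsilon> k) (Fg \<zeta>) x - Fg \<zeta> x))"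
        proof (cases "x \<in> annulus \<eta>")
          case True
          then have "x \<in> annulus \<zeta>" using annulus_mono[OF z] by auto
          then show ?thesis
            using v_eq[OF \<eta> \<zeta>_def _ True, of k] h_eq[OF \<eta> \<zeta>_def _ True, of k] elim True
            by (simp add: Fu_def Fg_def)
        qed simp
      qed
      also have "\<dots> = (\<integral>\<^sup>+x. norm (mollify (\<epsilon> k) (Fu \<zeta>) x - Fu \<zeta> x) \<partial>lborel) + (\<integral>\<^sup>+x. norm (mollify (\<epsilon> k) (Fg \<zeta>) x - Fg \<zeta> x) \<partial>lborel)"
        by (rule nn_integral_add) measurable
      also have "\<dots> \<le> ennreal (e/2) + ennreal (e/2)"
        using elim \<epsilon> by (intro add_mono d1 d2) auto
      also have "\<dots> = ennreal e" using \<open>0 < e\<close> by (simp add: ennreal_plus[symmetric] del: ennreal_plus)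
      finally show ?case .
    qed
  qed
  have fin: "(\<integral>\<^sup>+x. ennreal (norm (u x) + norm (g x)) * indicator (annulus \<eta>) x \<partial>lborel) < \<infinity>" if "0 < \<eta>" for \<eta>
  proof -
    have "(\<integral>\<^sup>+x. ennreal (norm (u x) + norm (g x)) * indicator (annulus \<eta>) x \<partial>lborel) =
      (\<integral>\<^sup>+x. ennreal (norm (Fu \<eta> x)) + ennreal (norm (Fg \<eta> x)) \<partial>lborel)"
      by (intro nn_integral_cong) (auto simp: Fu_def Fg_def indicator_def)
    also have "\<dots> = (\<integral>\<^sup>+x. ennreal (norm (Fu \<eta> x)) \<partial>lborel) + (\<integral>\<^sup>+x. ennreal (norm (Fg \<eta> x)) \<partial>lborel)"
      by (rule nn_integral_add) (auto simp: Fu_def Fg_def)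
    also have "\<dots> < \<infinity>" using Fi[OF that] by (simp add: integrable_iff_bounded)
    finally show ?thesis .
  qed
  show ?thesis
    unfolding C1_limit_def
    using der cont conv fin by (auto intro!: exI[of _ v] exI[of _ h] intro: continuous_on_subset)
qed

lemma C1_limitE:
  assumes "C1_limit u g"
  obtains v h where
    "u \<in> borel_measurable borel" "g \<in> borel_measurable borel"
    "\<And>k. v k \<in> borel_measurable borel" "\<And>k. h k \<in> borel_measurable borel"
    "\<And>k x. x \<noteq> 0 \<Longrightarrow> (v k has_derivative (\<lambda>d. h k x \<bullet> d)) (at x)"
    "\<And>k. continuous_on (- {0}) (v k)"
    "\<And>k. continuous_on (- {0}) (h k)"
    "\<And>\<eta>. 0 < \<eta> \<Longrightarrow> (\<lambda>k. L1_gap \<eta> (v k) (h k) u g) \<longlonglongrightarrow> 0"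
proof -
  from assms obtain v h where
    *: "\<And>k x. x \<noteq> 0 \<Longrightarrow> (v k has_derivative (\<lambda>d. h k x \<bullet> d)) (at x)"
    "\<And>k. continuous_on (- {0}) (h k)"
    "\<And>\<eta>. 0 < \<eta> \<Longrightarrow> (\<lambda>k. L1_gap \<eta> (v k) (h k) u g) \<longlonglongrightarrow> 0"
    unfolding C1_limit_def by blast
  have c: "continuous_on (- {0}) (v k)" for k
    using *(1)[of _ k] by (intro continuous_at_imp_continuous_on) (auto intro: has_derivative_continuous)
  have m: "v k \<in> borel_measurable borel" "h k \<in> borel_measurable borel" for k
    using borel_measurable_continuous_countable_exceptions[OF _ c[of k]]
      borel_measurable_continuous_countable_exceptions[OF _ *(2)[of k]] by auto
  show ?thesis
    using that[of v h] assms * c m unfolding C1_limit_def by blast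
qed

text \<open>Local integrability of the limit comes from a single approximant: it is continuous on
  the compact annulus, and its gap to the limit there is below 1.\<close>

lemma C1_limitI:
  fixes u :: "'a::euclidean_space \<Rightarrow> real"
  assumes [measurable]: "u \<in> borel_measurable borel" "g \<in> borel_measurable borel"
    and der: "\<And>k x. x \<noteq> 0 \<Longrightarrow> (v k has_derivative (\<lambda>d. h k x \<bullet> d)) (at x)"
    and c: "\<And>k. continuous_on (- {0}) (h k)"
    and conv: "\<And>\<eta>. 0 < \<eta> \<Longrightarrow> (\<lambda>k. L1_gap \<eta> (v k) (h k) u g) \<longlonglongrightarrow> 0"
  shows "C1_limit u g"
proof -
  have cv: "continuous_on (- {0}) (v k)" for k
    using der[of _ k] by (intro continuous_at_imp_continuous_on) (auto intro: has_derivative_continuous)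
  have [measurable]: "v k \<in> borel_measurable borel" "h k \<in> borel_measurable borel" for k
    using borel_measurable_continuous_countable_exceptions[OF _ cv[of k]]
      borel_measurable_continuous_countable_exceptions[OF _ c[of k]] by auto
  have "(\<integral>\<^sup>+x. ennreal (norm (u x) + norm (g x)) * indicator (annulus \<eta>) x \<partial>lborel) < \<infinity>" if \<eta>: "0 < \<eta>" for \<eta>
  proof -
    let ?D = "\<lambda>k. L1_gap \<eta> (v k) (h k) u g"
    have "eventually (\<lambda>k. ?D k < 1) sequentially"
      by (rule order_tendstoD(2)[OF conv[OF \<eta>]]) simp
    then obtain k where k: "?D k < 1" by (auto simp: eventually_sequentially)
    have "integrable lborel (\<lambda>x. indicator (annulus \<eta>) x *\<^sub>R (norm (v k x) + norm (h k x)))"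
      using annulus_nz[OF \<eta>] by (intro borel_integrable_compact compact_annulus continuous_intros)
        (auto intro: continuous_on_subset[OF cv] continuous_on_subset[OF c])
    then have "(\<integral>\<^sup>+x. norm (indicator (annulus \<eta>) x *\<^sub>R (norm (v k x) + norm (h k x))) \<partial>lborel) < \<infinity>"
      by (simp add: integrable_iff_bounded)
    also have "(\<integral>\<^sup>+x. norm (indicator (annulus \<eta>) x *\<^sub>R (norm (v k x) + norm (h k x))) \<partial>lborel) =
      (\<integral>\<^sup>+x. ennreal (norm (v k x) + norm (h k x)) * indicator (annulus \<eta>) x \<partial>lborel)"
      by (intro nn_integral_cong) (simp add: indicator_def)
    finally have fin: "(\<integral>\<^sup>+x. ennreal (norm (v k x) + norm (h k x)) * indicator (annulus \<eta>) x \<partial>lborel) < \<infinity>" .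
    have "(\<integral>\<^sup>+x. ennreal (norm (u x) + norm (g x)) * indicator (annulus \<eta>) x \<partial>lborel) \<le>
      (\<integral>\<^sup>+x. ennreal (norm (v k x - u x) + norm (h k x - g x)) * indicator (annulus \<eta>) x
        + ennreal (norm (v k x) + norm (h k x)) * indicator (annulus \<eta>) x \<partial>lborel)"
    proof (rule nn_integral_mono)
      fix x
      have "norm (u x) + norm (g x) \<le> (norm (v k x - u x) + norm (h k x - g x)) + (norm (v k x) + norm (h k x))"
        using norm_triangle_ineq2[of "u x" "v k x"] norm_triangle_ineq2[of "g x" "h k x"]
        by (simp add: norm_minus_commute)
      then show "ennreal (norm (u x) + norm (g x)) * indicator (annulus \<eta>) x \<le>
         ennreal (norm (v k x - u x) + norm (h k x - g x)) * indicator (annulus \<eta>) x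
        + ennreal (norm (v k x) + norm (h k x)) * indicator (annulus \<eta>) x"
        unfolding distrib_right[symmetric]
        by (intro mult_right_mono) (simp_all add: ennreal_plus[symmetric] ennreal_leI del: ennreal_plus)
    qed
    also have "\<dots> = ?D k + (\<integral>\<^sup>+x. ennreal (norm (v k x) + norm (h k x)) * indicator (annulus \<eta>) x \<partial>lborel)"
      by (rule nn_integral_add) measurable
    also have "\<dots> < \<infinity>"
      using fin order_less_trans[OF k, of \<infinity>] by simp
    finally show ?thesis .
  qed
  then show ?thesis
    unfolding C1_limit_def using assms by blast
qed

section \<open>Chain rule and power weights for local limits\<close>

lemma tail_integral_tendsto_0:
  fixes f :: "'a \<Rightarrow> real"
  assumes [measurable]: "f \<in> borel_measurable M" and nn: "\<And>x. 0 \<le> f x" and fin: "(\<integral>\<^sup>+x. ennreal (f x) \<partial>M) < \<infinity>"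
  shows "(\<lambda>m. \<integral>\<^sup>+x. ennreal (f x) * indicator {x. real m < f x} x \<partial>M) \<longlonglongrightarrow> 0"
proof -
  have "(\<lambda>m. \<integral>\<^sup>+x. ennreal (f x) * indicator {x. real m < f x} x \<partial>M) \<longlonglongrightarrow> (\<integral>\<^sup>+x. 0 \<partial>M)"
  proof (rule nn_integral_dominated_convergence[where w="\<lambda>x. ennreal (f x)"])
    show "(\<lambda>x. ennreal (f x) * indicator {x. real m < f x} x) \<in> borel_measurable M" for m
      by measurable
    show "AE x in M. (\<lambda>m. ennreal (f x) * indicator {x. real m < f x} x) \<longlonglongrightarrow> 0"
    proof (rule AE_I2)
      fix x
      obtain n where "f x \<le> real n" by (meson real_arch_simple)
      then have "eventually (\<lambda>m. ennreal (f x) * indicator {x. real m < f x} x = 0) sequentially"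
        by (intro eventually_sequentiallyI[of n]) (auto simp: indicator_def)
      then show "(\<lambda>m. ennreal (f x) * indicator {x. real m < f x} x) \<longlonglongrightarrow> 0"
        by (rule tendsto_eventually)
    qed
  qed (use fin in \<open>auto simp: indicator_def\<close>)
  then show ?thesis by simp
qed

text \<open>The delicate term is (\<phi>'(v_k) - \<phi>'(u)) g, since v_k tends to u only in L^1 and
  g may be unbounded. Where |g| \<le> m, an affine modulus of continuity of \<phi>' reduces it to
  |v_k - u|; where |g| > m, the bound 2B meets a small tail of the integral of |g|.\<close>

lemma C1_limit_chain:
  fixes \<phi> \<phi>' :: "real \<Rightarrow> real"
  assumes ug: "C1_limit u g"
    and \<phi>: "\<And>t. (\<phi> has_real_derivative \<phi>' t) (at t)"
    and B: "\<And>t. \<bar>\<phi>' t\<bar> \<le> B" and uc: "uniformly_continuous_on UNIV \<phi>'"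
  shows "C1_limit (\<lambda>x. \<phi> (u x)) (\<lambda>x. \<phi>' (u x) *\<^sub>R g x)"
proof -
  obtain v h where [measurable]: "u \<in> borel_measurable borel" "g \<in> borel_measurable borel"
      "\<And>k. v k \<in> borel_measurable borel" "\<And>k. h k \<in> borel_measurable borel"
    and der: "\<And>k x. x \<noteq> 0 \<Longrightarrow> (v k has_derivative (\<lambda>d. h k x \<bullet> d)) (at x)"
    and cv: "\<And>k. continuous_on (- {0}) (v k)" and c: "\<And>k. continuous_on (- {0}) (h k)"
    and conv: "\<And>\<eta>. 0 < \<eta> \<Longrightarrow> (\<lambda>k. L1_gap \<eta> (v k) (h k) u g) \<longlonglongrightarrow> 0"
    by (rule C1_limitE[OF ug]) (rule that; assumption)
  have c\<phi>': "continuous_on UNIV \<phi>'" using uc by (rule uniformly_continuous_imp_continuous)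
  have c\<phi>: "continuous_on UNIV \<phi>"
    using \<phi> by (intro continuous_at_imp_continuous_on) (auto intro: DERIV_isCont)
  have [measurable]: "\<phi> \<in> borel_measurable borel" "\<phi>' \<in> borel_measurable borel"
    using c\<phi> c\<phi>' by (auto intro: borel_measurable_continuous_onI)
  have B0: "0 \<le> B" using B[of 0] by linarith
  have lip: "\<bar>\<phi> s - \<phi> t\<bar> \<le> B * \<bar>s - t\<bar>" for s t
  proof -
    have "norm (\<phi> s - \<phi> t) \<le> B * norm (s - t)"
      by (rule field_differentiable_bound[of UNIV \<phi> \<phi>' B]) (use \<phi> B in auto)
    then show ?thesis by simp
  qed
  \<comment> \<open>Uniform continuity settles |s - t| < d; beyond that the slope 2B/d outgrows the
    oscillation of the bounded \<phi>'. The linear form is what L^1 convergence can absorb.\<close>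
  have osc: "\<exists>L\<ge>0. \<forall>s t. \<bar>\<phi>' s - \<phi>' t\<bar> \<le> \<delta> + L * \<bar>s - t\<bar>" if "\<delta> > 0" for \<delta>
  proof -
    obtain d where d: "d > 0" "\<And>s t. dist t s < d \<Longrightarrow> dist (\<phi>' t) (\<phi>' s) < \<delta>"
      using uc \<open>\<delta> > 0\<close> unfolding uniformly_continuous_on_def by auto
    have "\<bar>\<phi>' s - \<phi>' t\<bar> \<le> \<delta> + (2 * B / d) * \<bar>s - t\<bar>" for s t
    proof (cases "\<bar>s - t\<bar> < d")
      case True
      then have "\<bar>\<phi>' s - \<phi>' t\<bar> < \<delta>" using d(2)[of s t] by (simp add: dist_real_def)
      moreover have "0 \<le> (2 * B / d) * \<bar>s - t\<bar>" using B0 d by simp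
      ultimately show ?thesis by linarith
    next
      case False
      have "2 * B = (2 * B / d) * d" using d by simp
      also have "\<dots> \<le> (2 * B / d) * \<bar>s - t\<bar>" using False B0 d by (intro mult_left_mono) auto
      finally show ?thesis using B[of s] B[of t] that by linarith
    qed
    then show ?thesis using B0 d by (intro exI[of _ "2 * B / d"]) auto
  qed
  show ?thesis
  proof (rule C1_limitI[where v="\<lambda>k x. \<phi> (v k x)" and h="\<lambda>k x. \<phi>' (v k x) *\<^sub>R h k x"])
    let ?d = "\<lambda>k x. norm (\<phi> (v k x) - \<phi> (u x)) + norm (\<phi>' (v k x) *\<^sub>R h k x - \<phi>' (u x) *\<^sub>R g x)"
    show "((\<lambda>x. \<phi> (v k x)) has_derivative (\<lambda>d. \<phi>' (v k x) *\<^sub>R h k x \<bullet> d)) (at x)" if "x \<noteq> 0" for k x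
      using has_derivative_compose[OF der[OF that] \<phi>[unfolded has_field_derivative_def], of k] by simp
    show "continuous_on (- {0}) (\<lambda>x. \<phi>' (v k x) *\<^sub>R h k x)" for k
      by (intro continuous_intros c continuous_on_compose2[OF c\<phi>' cv]) auto
    fix \<eta> :: real assume \<eta>: "0 < \<eta>"
    define A where "A = (annulus \<eta> :: 'a set)"
    have [measurable]: "A \<in> sets borel" by (simp add: A_def)
    define D where "D k = (\<integral>\<^sup>+x. ennreal (norm (v k x - u x) + norm (h k x - g x)) * indicator A x \<partial>lborel)" for k
    have D: "D \<longlonglongrightarrow> 0" using conv[OF \<eta>] by (simp add: D_def[abs_def] A_def)
    define f where "f x = norm (g x) * indicator A x" for x
    have [measurable]: "f \<in> borel_measurable borel" by (simp add: f_def[abs_def])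
    have "(\<integral>\<^sup>+x. ennreal (f x) \<partial>lborel) \<le> (\<integral>\<^sup>+x. ennreal (norm (u x) + norm (g x)) * indicator A x \<partial>lborel)"
      by (intro nn_integral_mono) (auto simp: f_def indicator_def intro!: ennreal_leI)
    then have ffin: "(\<integral>\<^sup>+x. ennreal (f x) \<partial>lborel) < \<infinity>"
      using ug \<eta> unfolding C1_limit_def A_def by (blast intro: le_less_trans)
    then obtain I where I: "(\<integral>\<^sup>+x. ennreal (f x) \<partial>lborel) = ennreal I" "0 \<le> I"
      by (cases "\<integral>\<^sup>+x. ennreal (f x) \<partial>lborel") auto
    define T where "T m = (\<integral>\<^sup>+x. ennreal (f x) * indicator {x. real m < f x} x \<partial>lborel)" for m :: nat
    have T: "T \<longlonglongrightarrow> 0" unfolding T_def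
      by (rule tail_integral_tendsto_0) (use ffin in \<open>auto simp: f_def\<close>)
    show "(\<lambda>k. \<integral>\<^sup>+x. ennreal (?d k x)
        * indicator (annulus \<eta>) x \<partial>lborel) \<longlonglongrightarrow> 0"
    proof (rule ennreal_tendsto_0I)
      fix e :: real assume e: "0 < e"
      \<comment> \<open>Each of the three error terms receives e/3. The order of choices matters:
        the slope L depends on \<delta>, the factor Q on L and the level m, and the index k comes
        last.\<close>
      have "eventually (\<lambda>m. T m < ennreal (e / (3 * (2 * B + 1)))) sequentially"
        by (rule order_tendstoD(2)[OF T]) (use e B0 in auto)
      then obtain m where m: "T m < ennreal (e / (3 * (2 * B + 1)))" by (auto simp: eventually_sequentially)
      define \<delta> where "\<delta> = e / (3 * (I + 1))"
      have \<delta>: "\<delta> > 0" "\<delta> * I \<le> e / 3" using e I(2) by (auto simp: \<delta>_def field_simps)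
      obtain L where L: "L \<ge> 0" "\<And>s t. \<bar>\<phi>' s - \<phi>' t\<bar> \<le> \<delta> + L * \<bar>s - t\<bar>" using osc[OF \<delta>(1)] by blast
      define Q where "Q = B + L * m"
      have Q: "Q \<ge> 0" using B0 L by (simp add: Q_def)
      have "eventually (\<lambda>k. D k < ennreal (e / (3 * (Q + 1)))) sequentially"
        by (rule order_tendstoD(2)[OF D]) (use e Q in auto)
      then show "eventually (\<lambda>k. (\<integral>\<^sup>+x. ennreal (?d k x) * indicator (annulus \<eta>) x \<partial>lborel) \<le> ennreal e) sequentially"
      proof eventually_elim
        case (elim k)
        have pt: "ennreal (?d k x) * indicator A x
          \<le> ennreal Q * (ennreal (norm (v k x - u x) + norm (h k x - g x)) * indicator A x)
            + (ennreal \<delta> * ennreal (f x) + ennreal (2 * B) * (ennreal (f x) * indicator {x. real m < f x} x))" for x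
        proof (cases "x \<in> A")
          case True
          then have fx: "f x = norm (g x)" by (simp add: f_def)
          define i :: real where "i = (if real m < f x then 1 else 0)"
          have 1: "\<bar>\<phi>' (v k x) - \<phi>' (u x)\<bar> * norm (g x) \<le> L * m * \<bar>v k x - u x\<bar> + \<delta> * f x + 2 * B * (f x * i)"
          proof (cases "real m < f x")
            case True
            have "\<bar>\<phi>' (v k x) - \<phi>' (u x)\<bar> \<le> 2 * B" using B[of "v k x"] B[of "u x"] by linarith
            then have "\<bar>\<phi>' (v k x) - \<phi>' (u x)\<bar> * norm (g x) \<le> 2 * B * norm (g x)"
              by (intro mult_right_mono) auto
            moreover have "0 \<le> L * m * \<bar>v k x - u x\<bar>" "0 \<le> \<delta> * f x" using L \<delta> by (auto simp: f_def)
            ultimately show ?thesis using True fx by (simp add: i_def)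
          next
            case False
            have "\<bar>\<phi>' (v k x) - \<phi>' (u x)\<bar> * norm (g x) \<le> (\<delta> + L * \<bar>v k x - u x\<bar>) * norm (g x)"
              by (intro mult_right_mono L) auto
            also have "\<dots> = \<delta> * f x + (L * \<bar>v k x - u x\<bar>) * norm (g x)" by (simp add: fx algebra_simps)
            also have "\<dots> \<le> \<delta> * f x + (L * \<bar>v k x - u x\<bar>) * m"
              using False fx L by (intro add_left_mono mult_left_mono) auto
            finally show ?thesis using False by (simp add: i_def mult_ac)
          qed
          have 2: "norm (\<phi>' (v k x) *\<^sub>R h k x - \<phi>' (u x) *\<^sub>R g x) \<le> B * norm (h k x - g x) + \<bar>\<phi>' (v k x) - \<phi>' (u x)\<bar> * norm (g x)"
          proof -
            have "\<phi>' (v k x) *\<^sub>R h k x - \<phi>' (u x) *\<^sub>R g x = \<phi>' (v k x) *\<^sub>R (h k x - g x) + (\<phi>' (v k x) - \<phi>' (u x)) *\<^sub>R g x"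
              by (simp add: algebra_simps)
            then have "norm (\<phi>' (v k x) *\<^sub>R h k x - \<phi>' (u x) *\<^sub>R g x) \<le> \<bar>\<phi>' (v k x)\<bar> * norm (h k x - g x) + \<bar>\<phi>' (v k x) - \<phi>' (u x)\<bar> * norm (g x)"
              by (metis norm_scaleR norm_triangle_ineq)
            then show ?thesis using mult_right_mono[OF B[of "v k x"], of "norm (h k x - g x)"] by simp
          qed
          have 3: "0 \<le> L * m * norm (h k x - g x)" using L by simp
          have "?d k x \<le>
            Q * (norm (v k x - u x) + norm (h k x - g x)) + (\<delta> * f x + 2 * B * (f x * i))"
            using lip[of "v k x" "u x"] 1 2 3 by (simp add: Q_def algebra_simps)
          then have "ennreal (?d k x) \<le>
            ennreal (Q * (norm (v k x - u x) + norm (h k x - g x)) + (\<delta> * f x + 2 * B * (f x * i)))"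
            by (rule ennreal_leI)
          also have "\<dots> = ennreal Q * ennreal (norm (v k x - u x) + norm (h k x - g x)) + (ennreal \<delta> * ennreal (f x) + ennreal (2 * B) * (ennreal (f x) * ennreal i))"
            using Q \<delta> B0 by (simp add: ennreal_mult[symmetric] ennreal_plus[symmetric] i_def f_def del: ennreal_plus)
          finally show ?thesis using True by (cases "real m < f x") (simp_all add: i_def)
        qed simp
        have "(\<integral>\<^sup>+x. ennreal (?d k x) * indicator A x \<partial>lborel)
          \<le> (\<integral>\<^sup>+x. ennreal Q * (ennreal (norm (v k x - u x) + norm (h k x - g x)) * indicator A x)
            + (ennreal \<delta> * ennreal (f x) + ennreal (2 * B) * (ennreal (f x) * indicator {x. real m < f x} x)) \<partial>lborel)"
          by (intro nn_integral_mono pt)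
        also have "\<dots> = ennreal Q * D k + (ennreal \<delta> * ennreal I + ennreal (2 * B) * T m)"
          by (simp add: nn_integral_add nn_integral_cmult D_def T_def I(1))
        also have "\<dots> \<le> ennreal Q * ennreal (e / (3 * (Q + 1))) + (ennreal \<delta> * ennreal I + ennreal (2 * B) * ennreal (e / (3 * (2 * B + 1))))"
          using elim m by (intro add_mono mult_left_mono) auto
        also have "\<dots> = ennreal (Q * (e / (3 * (Q + 1))) + (\<delta> * I + 2 * B * (e / (3 * (2 * B + 1)))))"
          using e Q \<delta> I B0 by (simp add: ennreal_mult[symmetric] ennreal_plus[symmetric] del: ennreal_plus)
        also have "\<dots> \<le> ennreal e"
        proof (rule ennreal_leI)
          have *: "z * (e / (3 * (z + 1))) \<le> e / 3" if "z \<ge> 0" for z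
            using that e by (simp add: field_simps)
          have "Q * (e / (3 * (Q + 1))) \<le> e / 3" "2 * B * (e / (3 * (2 * B + 1))) \<le> e / 3"
            using *[of Q] *[of "2 * B"] Q B0 by simp_all
          then show "Q * (e / (3 * (Q + 1))) + (\<delta> * I + 2 * B * (e / (3 * (2 * B + 1)))) \<le> e"
            using \<delta>(2) by linarith
        qed
        finally show ?case by (simp add: A_def)
      qed
    qed
  qed measurable
qed

lemma norm_powr_has_derivative:
  fixes x :: "'a::euclidean_space"
  assumes "x \<noteq> 0"
  shows "((\<lambda>x. norm x powr \<beta>) has_derivative (\<lambda>d. ((\<beta> * norm x powr (\<beta> - 2)) *\<^sub>R x) \<bullet> d)) (at x)"
proof -
  have "((\<lambda>t. t powr \<beta>) has_derivative (\<lambda>t. (\<beta> * norm x powr (\<beta> - 1)) * t)) (at (norm x))"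
    using has_real_derivative_powr[of "norm x" \<beta>] assms by (simp add: has_field_derivative_def)
  from has_derivative_compose[OF has_derivative_norm[OF assms] this]
  have "((\<lambda>x. norm x powr \<beta>) has_derivative (\<lambda>d. (\<beta> * norm x powr (\<beta> - 1)) * (d \<bullet> sgn x))) (at x)"
    by (simp add: inner_commute)
  moreover have "(\<beta> * norm x powr (\<beta> - 1)) * (d \<bullet> sgn x) = ((\<beta> * norm x powr (\<beta> - 2)) *\<^sub>R x) \<bullet> d" for d
  proof -
    have "norm x powr (\<beta> - 1) = norm x powr (\<beta> - 2) * norm x"
      using powr_add[of "norm x" "\<beta> - 2" 1] assms by simp
    then show ?thesis using assms by (simp add: sgn_div_norm inner_commute)
  qed
  ultimately show ?thesis by simp
qed

lemma norm_powr_bounded_annulus: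
  assumes "0 < \<eta>"
  obtains C where "0 \<le> C" "\<And>x::'a::euclidean_space. x \<in> annulus \<eta> \<Longrightarrow> norm x powr \<beta> \<le> C"
proof -
  have "continuous_on (annulus \<eta> :: 'a set) (\<lambda>x. norm x powr \<beta>)"
    using annulus_nz[OF assms] by (intro continuous_intros) auto
  then have "bounded ((\<lambda>x::'a. norm x powr \<beta>) ` annulus \<eta>)"
    by (intro compact_imp_bounded compact_continuous_image compact_annulus)
  then obtain C where "\<forall>x::'a\<in>annulus \<eta>. norm (norm x powr \<beta>) \<le> C"
    unfolding bounded_iff by blast
  then show ?thesis using that[of "max C 0"] by fastforce
qed

text \<open>Product rule: powers of the norm are smooth off the origin and bounded on each annulus,
  so the gap there grows at most by a factor that does not depend on the index k.\<close>

lemma C1_limit_weight: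
  assumes ug: "C1_limit u g"
  shows "C1_limit (\<lambda>x. norm x powr \<beta> * u x)
    (\<lambda>x. norm x powr \<beta> *\<^sub>R g x + (\<beta> * norm x powr (\<beta> - 2) * u x) *\<^sub>R x)"
proof -
  obtain v h where [measurable]: "u \<in> borel_measurable borel" "g \<in> borel_measurable borel"
      "\<And>k. v k \<in> borel_measurable borel" "\<And>k. h k \<in> borel_measurable borel"
    and der: "\<And>k x. x \<noteq> 0 \<Longrightarrow> (v k has_derivative (\<lambda>d. h k x \<bullet> d)) (at x)"
    and cv: "\<And>k. continuous_on (- {0}) (v k)" and c: "\<And>k. continuous_on (- {0}) (h k)"
    and conv: "\<And>\<eta>. 0 < \<eta> \<Longrightarrow> (\<lambda>k. L1_gap \<eta> (v k) (h k) u g) \<longlonglongrightarrow> 0"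
    by (rule C1_limitE[OF ug]) (rule that; assumption)
  show ?thesis
  proof (rule C1_limitI[where v="\<lambda>k x. norm x powr \<beta> * v k x" and
      h="\<lambda>k x. norm x powr \<beta> *\<^sub>R h k x + (\<beta> * norm x powr (\<beta> - 2) * v k x) *\<^sub>R x"])
    let ?d = "\<lambda>k x. norm (norm x powr \<beta> * v k x - norm x powr \<beta> * u x) +
      norm (norm x powr \<beta> *\<^sub>R h k x + (\<beta> * norm x powr (\<beta> - 2) * v k x) *\<^sub>R x -
        (norm x powr \<beta> *\<^sub>R g x + (\<beta> * norm x powr (\<beta> - 2) * u x) *\<^sub>R x))"
    show "((\<lambda>x. norm x powr \<beta> * v k x) has_derivative
      (\<lambda>d. (norm x powr \<beta> *\<^sub>R h k x + (\<beta> * norm x powr (\<beta> - 2) * v k x) *\<^sub>R x) \<bullet> d)) (at x)" if "x \<noteq> 0" for k x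
      by (rule has_derivative_eq_rhs[OF has_derivative_mult[OF norm_powr_has_derivative[OF that] der[OF that]]])
         (simp add: fun_eq_iff inner_add_left mult_ac)
    show "continuous_on (- {0}) (\<lambda>x. norm x powr \<beta> *\<^sub>R h k x + (\<beta> * norm x powr (\<beta> - 2) * v k x) *\<^sub>R x)" for k
      by (intro continuous_intros c cv) auto
    fix \<eta> :: real assume \<eta>: "0 < \<eta>"
    obtain C1 where C1: "0 \<le> C1" "\<And>x::'a. x \<in> annulus \<eta> \<Longrightarrow> norm x powr \<beta> \<le> C1"
      using norm_powr_bounded_annulus[OF \<eta>] by blast
    obtain C2 where C2: "0 \<le> C2" "\<And>x::'a. x \<in> annulus \<eta> \<Longrightarrow> norm x powr (\<beta> - 2) \<le> C2"
      using norm_powr_bounded_annulus[OF \<eta>] by blast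
    define C where "C = C1 + \<bar>\<beta>\<bar> * C2 * (1 / \<eta>)"
    have C0: "0 \<le> C" using C1 C2 \<eta> by (simp add: C_def)
    define D where "D k = (L1_gap \<eta> (v k) (h k) u g)" for k
    have pt: "?d k x
        \<le> C * (norm (v k x - u x) + norm (h k x - g x))" if x: "x \<in> annulus \<eta>" for k x
    proof -
      have e1: "norm x powr \<beta> * v k x - norm x powr \<beta> * u x = norm x powr \<beta> * (v k x - u x)"
        by (simp add: algebra_simps)
      have e2: "norm x powr \<beta> *\<^sub>R h k x + (\<beta> * norm x powr (\<beta> - 2) * v k x) *\<^sub>R x -
          (norm x powr \<beta> *\<^sub>R g x + (\<beta> * norm x powr (\<beta> - 2) * u x) *\<^sub>R x)
         = norm x powr \<beta> *\<^sub>R (h k x - g x) + (\<beta> * norm x powr (\<beta> - 2) * (v k x - u x)) *\<^sub>R x"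
        by (simp add: algebra_simps)
      have 1: "norm x powr \<beta> * a \<le> C1 * a" if "a \<ge> 0" for a
        using C1(2)[OF x] that by (rule mult_right_mono)
      have nx: "norm x \<le> 1 / \<eta>" using x by (simp add: annulus_def)
      have "norm ((\<beta> * norm x powr (\<beta> - 2) * (v k x - u x)) *\<^sub>R x)
        = (\<bar>\<beta>\<bar> * norm x powr (\<beta> - 2) * norm x) * \<bar>v k x - u x\<bar>"
        by (simp add: abs_mult mult_ac)
      also have "\<dots> \<le> (\<bar>\<beta>\<bar> * C2 * (1 / \<eta>)) * \<bar>v k x - u x\<bar>"
        using C2 x nx by (intro mult_right_mono mult_mono mult_left_mono) auto
      finally have 2: "norm ((\<beta> * norm x powr (\<beta> - 2) * (v k x - u x)) *\<^sub>R x) \<le> (\<bar>\<beta>\<bar> * C2 * (1 / \<eta>)) * \<bar>v k x - u x\<bar>" .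
      have "norm (norm x powr \<beta> *\<^sub>R (h k x - g x) + (\<beta> * norm x powr (\<beta> - 2) * (v k x - u x)) *\<^sub>R x)
        \<le> C1 * norm (h k x - g x) + (\<bar>\<beta>\<bar> * C2 * (1 / \<eta>)) * \<bar>v k x - u x\<bar>"
        using 1[of "norm (h k x - g x)"] 2 by (intro order_trans[OF norm_triangle_ineq] add_mono) auto
      moreover have "norm (norm x powr \<beta> * (v k x - u x)) \<le> C1 * \<bar>v k x - u x\<bar>"
        using 1[of "\<bar>v k x - u x\<bar>"] by (simp add: abs_mult)
      moreover have "0 \<le> (\<bar>\<beta>\<bar> * C2 * (1 / \<eta>)) * norm (h k x - g x)" using C2 \<eta> by simp
      ultimately show ?thesis unfolding e1 e2 C_def by (simp add: distrib_left distrib_right)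
    qed
    have "(\<lambda>k. ennreal C * D k) \<longlonglongrightarrow> ennreal C * 0"
      using conv[OF \<eta>] unfolding D_def by (intro ennreal_tendsto_cmult) auto
    then have lim: "(\<lambda>k. ennreal C * D k) \<longlonglongrightarrow> 0" by simp
    show "(\<lambda>k. \<integral>\<^sup>+x. ennreal (?d k x) * indicator (annulus \<eta>) x \<partial>lborel) \<longlonglongrightarrow> 0"
    proof (rule tendsto_sandwich[OF _ _ tendsto_const lim]; intro always_eventually allI)
      fix k
      have "(\<integral>\<^sup>+x. ennreal (?d k x) * indicator (annulus \<eta>) x \<partial>lborel)
        \<le> (\<integral>\<^sup>+x. ennreal C * (ennreal (norm (v k x - u x) + norm (h k x - g x)) * indicator (annulus \<eta>) x) \<partial>lborel)"
      proof (rule nn_integral_mono)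
        fix x :: 'a
        show "ennreal (?d k x) * indicator (annulus \<eta>) x
          \<le> ennreal C * (ennreal (norm (v k x - u x) + norm (h k x - g x)) * indicator (annulus \<eta>) x)"
        proof (cases "x \<in> annulus \<eta>")
          case True
          then show ?thesis
            using ennreal_leI[OF pt[OF True, of k]] C0
            by (simp only: ennreal_mult indicator_simps mult_1_right add_nonneg_nonneg norm_ge_zero)
        qed simp
      qed
      also have "\<dots> = ennreal C * D k"
        unfolding D_def by (rule nn_integral_cmult) measurable
      finally show "(\<integral>\<^sup>+x. ennreal (?d k x) * indicator (annulus \<eta>) x \<partial>lborel)
        \<le> ennreal C * D k" .
    qed simp
  qed measurable
qed

text \<open>\<open>x + t *\<^sub>R (c *\<^sub>R x + e)\<close> covers translations (\<open>c = 0\<close>) and dilations (\<open>e = 0\<close>) at once.\<close>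
lemma nn_integral_affine_le:
  fixes f :: "'a::euclidean_space \<Rightarrow> ennreal"
  assumes [measurable]: "f \<in> borel_measurable borel" and \<mu>: "0 < \<mu>" "\<mu> \<le> 1 + t * c"
  shows "(\<integral>\<^sup>+x. f (x + t *\<^sub>R (c *\<^sub>R x + e)) \<partial>lborel) \<le> ennreal (1 / \<mu> ^ DIM('a)) * (\<integral>\<^sup>+x. f x \<partial>lborel)"
proof -
  have eq: "x + t *\<^sub>R (c *\<^sub>R x + e) = t *\<^sub>R e + (1 + t * c) *\<^sub>R x" for x
    by (simp add: algebra_simps)
  let ?X = "\<integral>\<^sup>+x. f (t *\<^sub>R e + (1 + t * c) *\<^sub>R x) \<partial>lborel"
  have "(\<integral>\<^sup>+x. f x \<partial>lborel) = ennreal (\<bar>1 + t * c\<bar> ^ DIM('a)) * ?X"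
    by (rule nn_integral_lborel_scale) (use \<mu> in auto)
  also have "\<dots> \<ge> ennreal (\<mu> ^ DIM('a)) * ?X"
    using \<mu> by (intro mult_right_mono ennreal_leI power_mono) auto
  finally have "ennreal (1 / \<mu> ^ DIM('a)) * (ennreal (\<mu> ^ DIM('a)) * ?X) \<le> ennreal (1 / \<mu> ^ DIM('a)) * (\<integral>\<^sup>+x. f x \<partial>lborel)"
    by (rule mult_left_mono) simp
  then show ?thesis using \<mu> by (simp add: eq mult.assoc[symmetric] ennreal_mult[symmetric])
qed

section \<open>The fundamental theorem of calculus on segments\<close>

lemma C1_segment_le:
  fixes v :: "'a::euclidean_space \<Rightarrow> real"
  assumes der: "\<And>x. x \<noteq> 0 \<Longrightarrow> (v has_derivative (\<lambda>d. h x \<bullet> d)) (at x)"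
    and c: "continuous_on (- {0}) h" and T: "0 \<le> T"
    and nz: "\<And>t. t \<in> {0..T} \<Longrightarrow> x + t *\<^sub>R y \<noteq> 0"
  shows "ennreal \<bar>v x - v (x + T *\<^sub>R y)\<bar> \<le> (\<integral>\<^sup>+t. ennreal (norm (h (x + t *\<^sub>R y)) * norm y) * indicator {0..T} t \<partial>lborel)"
proof -
  have vd: "((\<lambda>t. v (x + t *\<^sub>R y)) has_vector_derivative (h (x + t *\<^sub>R y) \<bullet> y)) (at t within {0..T})" if "t \<in> {0..T}" for t
  proof -
    have "((\<lambda>t. x + t *\<^sub>R y) has_derivative (\<lambda>s. s *\<^sub>R y)) (at t within {0..T})"
      by (auto intro!: derivative_eq_intros)
    from has_derivative_compose[OF this der[OF nz[OF that]]]
    show ?thesis by (simp add: has_vector_derivative_def)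
  qed
  have co: "continuous_on {0..T} (\<lambda>t. h (x + t *\<^sub>R y) \<bullet> y)"
    using nz by (intro continuous_intros continuous_on_compose2[OF c]) auto
  have bi: "has_bochner_integral lborel (\<lambda>t. indicator {0..T} t *\<^sub>R (h (x + t *\<^sub>R y) \<bullet> y)) (v (x + T *\<^sub>R y) - v (x + 0 *\<^sub>R y))"
    by (rule has_bochner_integral_FTC_Icc[OF T vd co]) auto
  then have "\<bar>v x - v (x + T *\<^sub>R y)\<bar> = norm (\<integral>t. indicator {0..T} t *\<^sub>R (h (x + t *\<^sub>R y) \<bullet> y) \<partial>lborel)"
    by (simp add: has_bochner_integral_iff abs_minus_commute)
  also have "ennreal \<dots> \<le> (\<integral>\<^sup>+t. norm (indicator {0..T} t *\<^sub>R (h (x + t *\<^sub>R y) \<bullet> y)) \<partial>lborel)"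
    using bi by (intro integral_norm_bound_ennreal) (simp add: has_bochner_integral_iff)
  also have "\<dots> \<le> (\<integral>\<^sup>+t. ennreal (norm (h (x + t *\<^sub>R y)) * norm y) * indicator {0..T} t \<partial>lborel)"
    by (intro nn_integral_mono) (auto simp: indicator_def Cauchy_Schwarz_ineq2 intro!: ennreal_leI)
  finally show ?thesis .
qed

text \<open>L^1 convergence says nothing about an individual segment. Integrated over the starting
  point, however, the errors at both ends and along the segment are controlled by the gap, through
  Fubini and the lower bound \<mu> on the dilation factor; so the inequality for the approximants
  survives for almost every starting point.\<close>

lemma C1_limit_segment:
  fixes w :: "'a::euclidean_space \<Rightarrow> real"
  assumes wk: "C1_limit w k" and \<eta>: "0 < \<eta>" and T: "0 \<le> T" and [measurable]: "S \<in> sets borel"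
    and seg: "\<And>x t. x \<in> S \<Longrightarrow> t \<in> {0..T} \<Longrightarrow> x + t *\<^sub>R (c *\<^sub>R x + e) \<in> annulus \<eta>"
    and \<mu>: "0 < \<mu>" "\<And>t. t \<in> {0..T} \<Longrightarrow> \<mu> \<le> 1 + t * c"
  shows "AE x in lborel. x \<in> S \<longrightarrow> ennreal \<bar>w x - w (x + T *\<^sub>R (c *\<^sub>R x + e))\<bar> \<le>
    (\<integral>\<^sup>+t. ennreal (norm (k (x + t *\<^sub>R (c *\<^sub>R x + e))) * norm (c *\<^sub>R x + e)) * indicator {0..T} t \<partial>lborel)"
proof -
  obtain v h where [measurable]: "w \<in> borel_measurable borel" "k \<in> borel_measurable borel"
      "\<And>n. v n \<in> borel_measurable borel" "\<And>n. h n \<in> borel_measurable borel"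
    and der: "\<And>n x. x \<noteq> 0 \<Longrightarrow> (v n has_derivative (\<lambda>d. h n x \<bullet> d)) (at x)"
    and cv: "\<And>n. continuous_on (- {0}) (v n)" and c: "\<And>n. continuous_on (- {0}) (h n)"
    and conv: "\<And>\<eta>. 0 < \<eta> \<Longrightarrow> (\<lambda>n. L1_gap \<eta> (v n) (h n) w k) \<longlonglongrightarrow> 0"
    by (rule C1_limitE[OF wk]) (rule that; assumption)
  define y where "y x = c *\<^sub>R x + e" for x
  have [measurable]: "y \<in> borel_measurable borel" by (simp add: y_def[abs_def])
  define B where "B = \<bar>c\<bar> * (1 / \<eta>) + norm e"
  have B0: "0 \<le> B" using \<eta> by (simp add: B_def)
  have B: "norm (y x) \<le> B" if "x \<in> S" for x
  proof -
    have "norm x \<le> 1 / \<eta>" using seg[OF that, of 0] T by (simp add: annulus_def)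
    then have "norm (c *\<^sub>R x) \<le> \<bar>c\<bar> * (1 / \<eta>)" using mult_left_mono[of "norm x" "1 / \<eta>" "\<bar>c\<bar>"] by simp
    then show ?thesis unfolding B_def y_def by (intro order_trans[OF norm_triangle_ineq]) simp
  qed
  define f where "f n x = ennreal (norm (v n x - w x) + norm (h n x - k x)) * indicator (annulus \<eta>) x" for n x
  have [measurable]: "f n \<in> borel_measurable borel" for n by (simp add: f_def[abs_def])
  define D where "D n = (\<integral>\<^sup>+x. f n x \<partial>lborel)" for n
  have D: "D \<longlonglongrightarrow> 0" using conv[OF \<eta>] unfolding D_def f_def .
  define J where "J g x = (\<integral>\<^sup>+t. ennreal (norm (g (x + t *\<^sub>R y x)) * norm (y x)) * indicator {0..T} t \<partial>lborel)" for g :: "'a \<Rightarrow> 'a" and x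
  have [measurable]: "J g \<in> borel_measurable borel" if [measurable]: "g \<in> borel_measurable borel" for g
    unfolding J_def by measurable
  define a where "a x = ennreal \<bar>w x - w (x + T *\<^sub>R y x)\<bar>" for x
  define d where "d n x = f n x + f n (x + T *\<^sub>R y x) + (\<integral>\<^sup>+t. ennreal B * f n (x + t *\<^sub>R y x) * indicator {0..T} t \<partial>lborel)" for n x
  have [measurable]: "d n \<in> borel_measurable borel" "a \<in> borel_measurable borel" for n
    unfolding d_def[abs_def] a_def[abs_def] by measurable
  have pt: "a x \<le> J k x + d n x" if x: "x \<in> S" for n x
  proof -
    have an: "x + t *\<^sub>R y x \<in> annulus \<eta>" if "t \<in> {0..T}" for t
      using seg[OF x that] by (simp add: y_def)
    have nz: "x + t *\<^sub>R y x \<noteq> 0" if "t \<in> {0..T}" for t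
      using an[OF that] annulus_nz[OF \<eta>] by auto
    have a0: "x \<in> annulus \<eta>" "x + T *\<^sub>R y x \<in> annulus \<eta>" using an[of 0] an[of T] T by auto
    have e1: "ennreal \<bar>v n z - w z\<bar> \<le> f n z" if "z \<in> annulus \<eta>" for z
      using that by (auto simp: f_def intro!: ennreal_leI)
    have e2: "ennreal (norm (h n z - k z)) \<le> f n z" if "z \<in> annulus \<eta>" for z
      using that by (auto simp: f_def intro!: ennreal_leI)
    have "J (h n) x \<le> (\<integral>\<^sup>+t. ennreal (norm (k (x + t *\<^sub>R y x)) * norm (y x)) * indicator {0..T} t +
       ennreal B * f n (x + t *\<^sub>R y x) * indicator {0..T} t \<partial>lborel)"
      unfolding J_def
    proof (rule nn_integral_mono)
      fix t :: real
      show "ennreal (norm (h n (x + t *\<^sub>R y x)) * norm (y x)) * indicator {0..T} t \<le>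
        ennreal (norm (k (x + t *\<^sub>R y x)) * norm (y x)) * indicator {0..T} t +
        ennreal B * f n (x + t *\<^sub>R y x) * indicator {0..T} t"
      proof (cases "t \<in> {0..T}")
        case True
        let ?z = "x + t *\<^sub>R y x"
        have "norm (h n ?z) * norm (y x) \<le> (norm (k ?z) + norm (h n ?z - k ?z)) * norm (y x)"
          by (intro mult_right_mono norm_triangle_sub) auto
        also have "\<dots> \<le> norm (k ?z) * norm (y x) + B * norm (h n ?z - k ?z)"
          using mult_right_mono[OF B[OF x], of "norm (h n ?z - k ?z)"] by (simp add: algebra_simps)
        finally have "ennreal (norm (h n ?z) * norm (y x)) \<le> ennreal (norm (k ?z) * norm (y x)) + ennreal B * ennreal (norm (h n ?z - k ?z))"
          using B0 by (simp add: ennreal_plus[symmetric] ennreal_mult[symmetric] ennreal_leI del: ennreal_plus)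
        also have "\<dots> \<le> ennreal (norm (k ?z) * norm (y x)) + ennreal B * f n ?z"
          by (intro add_left_mono mult_left_mono e2 an[OF True]) auto
        finally show ?thesis using True by simp
      qed simp
    qed
    also have "\<dots> = J k x + (\<integral>\<^sup>+t. ennreal B * f n (x + t *\<^sub>R y x) * indicator {0..T} t \<partial>lborel)"
      unfolding J_def by (rule nn_integral_add) measurable
    finally have 3: "J (h n) x \<le> J k x + (\<integral>\<^sup>+t. ennreal B * f n (x + t *\<^sub>R y x) * indicator {0..T} t \<partial>lborel)" .
    have 4: "ennreal \<bar>v n x - v n (x + T *\<^sub>R y x)\<bar> \<le> J (h n) x"
      unfolding J_def by (rule C1_segment_le[OF der c T nz])
    have "a x \<le> ennreal \<bar>v n x - w x\<bar> + ennreal \<bar>v n (x + T *\<^sub>R y x) - w (x + T *\<^sub>R y x)\<bar> + ennreal \<bar>v n x - v n (x + T *\<^sub>R y x)\<bar>"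
      unfolding a_def by (simp add: ennreal_plus[symmetric] ennreal_leI del: ennreal_plus)
    also have "\<dots> \<le> f n x + f n (x + T *\<^sub>R y x) + (J k x + (\<integral>\<^sup>+t. ennreal B * f n (x + t *\<^sub>R y x) * indicator {0..T} t \<partial>lborel))"
      by (intro add_mono e1 a0 order_trans[OF 4 3])
    finally show ?thesis by (simp add: d_def add_ac)
  qed
  define q where "q = 1 / \<mu> ^ DIM('a)"
  have q: "0 \<le> q" using \<mu> by (simp add: q_def)
  \<comment> \<open>The summands account for the starting point, the end point and the segment:
    \<open>q\<close> bounds the inverse Jacobians, \<open>B\<close> the length of the direction
    vector, and \<open>T\<close> is the length of the parameter interval.\<close>
  define Q where "Q = 1 + q + B * q * T"
  have af: "(\<integral>\<^sup>+x. f n (x + t *\<^sub>R y x) \<partial>lborel) \<le> ennreal q * D n" if "t \<in> {0..T}" for t n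
    unfolding y_def q_def D_def by (rule nn_integral_affine_le) (use \<mu> that in auto)
  have db: "(\<integral>\<^sup>+x. d n x \<partial>lborel) \<le> ennreal Q * D n" for n
  proof -
    have "(\<integral>\<^sup>+x. (\<integral>\<^sup>+t. ennreal B * f n (x + t *\<^sub>R y x) * indicator {0..T} t \<partial>lborel) \<partial>lborel) =
      (\<integral>\<^sup>+t. (\<integral>\<^sup>+x. ennreal B * f n (x + t *\<^sub>R y x) * indicator {0..T} t \<partial>lborel) \<partial>lborel)"
      by (rule lborel_pair.Fubini') measurable
    also have "\<dots> = (\<integral>\<^sup>+t. ennreal B * (\<integral>\<^sup>+x. f n (x + t *\<^sub>R y x) \<partial>lborel) * indicator {0..T} t \<partial>lborel)"
      by (intro nn_integral_cong) (simp add: nn_integral_cmult nn_integral_multc)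
    also have "\<dots> \<le> (\<integral>\<^sup>+t. ennreal B * (ennreal q * D n) * indicator {0..T} t \<partial>lborel)"
      using af by (intro nn_integral_mono) (auto simp: indicator_def intro!: mult_left_mono)
    also have "\<dots> = ennreal B * (ennreal q * D n) * ennreal T"
      using T by (simp add: nn_integral_cmult_indicator)
    finally have 1: "(\<integral>\<^sup>+x. (\<integral>\<^sup>+t. ennreal B * f n (x + t *\<^sub>R y x) * indicator {0..T} t \<partial>lborel) \<partial>lborel) \<le>
       ennreal B * (ennreal q * D n) * ennreal T" .
    have "(\<integral>\<^sup>+x. d n x \<partial>lborel) = D n + (\<integral>\<^sup>+x. f n (x + T *\<^sub>R y x) \<partial>lborel) +
      (\<integral>\<^sup>+x. (\<integral>\<^sup>+t. ennreal B * f n (x + t *\<^sub>R y x) * indicator {0..T} t \<partial>lborel) \<partial>lborel)"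
      unfolding d_def D_def by (simp add: nn_integral_add)
    also have "\<dots> \<le> D n + ennreal q * D n + ennreal B * (ennreal q * D n) * ennreal T"
      using T by (intro add_mono 1 af) auto
    also have "\<dots> = (1 + ennreal q + ennreal B * ennreal q * ennreal T) * D n"
      by (simp add: algebra_simps)
    also have "1 + ennreal q + ennreal B * ennreal q * ennreal T = ennreal Q"
      using q B0 T by (simp add: Q_def ennreal_mult ennreal_plus)
    finally show ?thesis .
  qed
  have ql: "(\<lambda>n. ennreal Q * D n) \<longlonglongrightarrow> 0"
    using ennreal_tendsto_cmult[OF _ D, of "ennreal Q"] by simp
  have dl: "(\<lambda>n. \<integral>\<^sup>+x. d n x \<partial>lborel) \<longlonglongrightarrow> 0"
    by (rule tendsto_sandwich[OF always_eventually always_eventually tendsto_const ql]) (use db in simp_all)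
  have "(\<integral>\<^sup>+x. (a x - J k x) * indicator S x \<partial>lborel) \<le> (\<integral>\<^sup>+x. d n x \<partial>lborel)" for n
  \<comment> \<open>Subtraction in \<open>ennreal\<close> is truncated at 0, so this integral
    measures the failure of the claim on \<open>S\<close>; it lies below the error integral of every
    approximant.\<close>
  proof (rule nn_integral_mono)
    fix x show "(a x - J k x) * indicator S x \<le> d n x"
      using pt[of x n] by (auto simp: indicator_def a_def ennreal_minus_le_iff)
  qed
  then have "(\<integral>\<^sup>+x. (a x - J k x) * indicator S x \<partial>lborel) \<le> 0"
    by (intro LIMSEQ_le_const[OF dl]) auto
  then have "AE x in lborel. (a x - J k x) * indicator S x = 0"
    by (subst (asm) le_zero_eq, subst (asm) nn_integral_0_iff_AE) auto
  then show ?thesis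
  proof eventually_elim
    case (elim x)
    then show ?case unfolding J_def y_def a_def
      by (auto simp: indicator_def diff_eq_0_iff_ennreal)
  qed
qed

subsection \<open>Hardy's inequality\<close>

definition dilation_measure :: "'a::euclidean_space measure" where
  "dilation_measure = density lborel (\<lambda>x. ennreal (norm x powr (- real DIM('a))))"

lemma sets_dilation_measure [simp, measurable_cong]: "sets dilation_measure = sets borel"
  by (simp add: dilation_measure_def)

lemma space_dilation_measure [simp]: "space dilation_measure = UNIV"
  by (simp add: dilation_measure_def)

lemma borel_measurable_dilation_measure [simp]: "borel_measurable dilation_measure = borel_measurable borel"
  by (rule measurable_cong_sets) simp_all

lemma nn_integral_dilation_measure:
  fixes f :: "'a::euclidean_space \<Rightarrow> ennreal"
  assumes "f \<in> borel_measurable borel"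
  shows "(\<integral>\<^sup>+x. f x \<partial>dilation_measure) = (\<integral>\<^sup>+x. ennreal (norm x powr (- real DIM('a))) * f x \<partial>lborel)"
  unfolding dilation_measure_def using assms by (subst nn_integral_density) auto

lemma AE_dilation_measure: "AE x in lborel. P x \<Longrightarrow> AE x in dilation_measure. P x"
  unfolding dilation_measure_def by (subst AE_density) auto

lemma AE_dilation_measure_nz: "AE x in dilation_measure. x \<noteq> 0"
  by (rule AE_dilation_measure) (rule AE_lborel_singleton)

lemma nn_integral_dilate:
  fixes f :: "'a::euclidean_space \<Rightarrow> ennreal"
  assumes [measurable]: "f \<in> borel_measurable borel" and c: "0 < c"
  shows "(\<integral>\<^sup>+x. f (c *\<^sub>R x) \<partial>dilation_measure) = (\<integral>\<^sup>+x. f x \<partial>dilation_measure)"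
proof -
  have "(\<integral>\<^sup>+x. f x \<partial>dilation_measure) =
    ennreal (\<bar>c\<bar> ^ DIM('a)) * (\<integral>\<^sup>+x. ennreal (norm (0 + c *\<^sub>R x) powr (- real DIM('a))) * f (0 + c *\<^sub>R x) \<partial>lborel)"
    by (subst nn_integral_dilation_measure, measurable, rule nn_integral_lborel_scale) (use c in auto)
  also have "\<dots> = (\<integral>\<^sup>+x. ennreal (\<bar>c\<bar> ^ DIM('a)) * (ennreal (norm (0 + c *\<^sub>R x) powr (- real DIM('a))) * f (0 + c *\<^sub>R x)) \<partial>lborel)"
    by (rule nn_integral_cmult[symmetric]) measurable
  also have "\<dots> = (\<integral>\<^sup>+x. ennreal (norm x powr (- real DIM('a))) * f (c *\<^sub>R x) \<partial>lborel)"
  proof (rule nn_integral_cong)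
    fix x :: 'a
    have "\<bar>c\<bar> ^ DIM('a) * norm (c *\<^sub>R x) powr (- real DIM('a)) = norm x powr (- real DIM('a))"
      using c by (simp add: powr_mult powr_minus powr_realpow)
    then show "ennreal (\<bar>c\<bar> ^ DIM('a)) * (ennreal (norm (0 + c *\<^sub>R x) powr (- real DIM('a))) * f (0 + c *\<^sub>R x)) =
      ennreal (norm x powr (- real DIM('a))) * f (c *\<^sub>R x)"
      using c by (simp add: mult.assoc[symmetric] ennreal_mult[symmetric])
  qed
  finally show ?thesis by (simp add: nn_integral_dilation_measure)
qed

lemma emeasure_dilation_annulus:
  assumes "0 < \<eta>" shows "emeasure dilation_measure (annulus \<eta> :: 'a::euclidean_space set) < \<infinity>"
proof -
  obtain C where C: "0 \<le> C" "\<And>x::'a. x \<in> annulus \<eta> \<Longrightarrow> norm x powr (- real DIM('a)) \<le> C"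
    using norm_powr_bounded_annulus[OF assms] by blast
  have "emeasure dilation_measure (annulus \<eta> :: 'a set) = (\<integral>\<^sup>+x. indicator (annulus \<eta>) x \<partial>(dilation_measure :: 'a measure))"
    by (simp add: nn_integral_indicator)
  also have "\<dots> = (\<integral>\<^sup>+x. ennreal (norm x powr (- real DIM('a))) * indicator (annulus \<eta>) (x :: 'a) \<partial>lborel)"
    by (rule nn_integral_dilation_measure) measurable
  also have "\<dots> \<le> (\<integral>\<^sup>+x. ennreal C * indicator (annulus \<eta>) (x::'a) \<partial>lborel)"
    using C by (intro nn_integral_mono) (auto simp: indicator_def intro!: ennreal_leI)
  also have "\<dots> = ennreal C * emeasure lborel (annulus \<eta> :: 'a set)"
    by (rule nn_integral_cmult_indicator) simp
  also have "\<dots> < \<infinity>"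
    using emeasure_compact_finite[OF compact_annulus[of \<eta>, where 'a='a]]
    by (simp add: ennreal_mult_less_top)
  finally show ?thesis .
qed

text \<open>The part of the ray on which \<tau> powr (-\<kappa> - 1) is integrable. The interval is
  open at 0 so that all dilation factors are positive.\<close>

definition ray_set :: "real \<Rightarrow> real set" where
  "ray_set \<kappa> = (if \<kappa> > 0 then {1..} else {0<..1})"

lemma ray_set_sets [measurable]: "ray_set \<kappa> \<in> sets borel"
  by (simp add: ray_set_def)

text \<open>On either side the integral has the value 1/|\<kappa>|, the classical constant in
  Hardy's inequality; what the sequel uses is its finiteness.\<close>

lemma ray_weight_finite:
  assumes "\<kappa> \<noteq> 0"
  shows "(\<integral>\<^sup>+\<tau>. ennreal (\<tau> powr (- \<kappa> - 1)) * indicator (ray_set \<kappa>) \<tau> \<partial>lborel) < \<infinity>"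
proof (cases "\<kappa> > 0")
  case True
  have "((\<lambda>\<tau>. \<tau> powr (- \<kappa> - 1)) has_integral -(1 powr ((- \<kappa> - 1) + 1)) / ((- \<kappa> - 1) + 1)) {1..}"
    by (rule has_integral_powr_to_inf) (use True in auto)
  from nn_integral_has_integral_lebesgue'[OF _ this] show ?thesis
    using True by (simp add: ray_set_def)
next
  case False
  have "((\<lambda>\<tau>. \<tau> powr (- \<kappa> - 1)) has_integral 1 powr ((- \<kappa> - 1) + 1) / ((- \<kappa> - 1) + 1)) {0..1}"
    by (rule has_integral_powr_from_0) (use False assms in auto)
  from nn_integral_has_integral_lebesgue'[OF _ this]
  have "(\<integral>\<^sup>+\<tau>. ennreal (\<tau> powr (- \<kappa> - 1)) * indicator {0..1} \<tau> \<partial>lborel) < \<infinity>" by simp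
  moreover have "(\<integral>\<^sup>+\<tau>. ennreal (\<tau> powr (- \<kappa> - 1)) * indicator (ray_set \<kappa>) \<tau> \<partial>lborel) \<le>
     (\<integral>\<^sup>+\<tau>. ennreal (\<tau> powr (- \<kappa> - 1)) * indicator {0..1} \<tau> \<partial>lborel)"
    using False by (intro nn_integral_mono) (auto simp: ray_set_def indicator_def)
  ultimately show ?thesis by (rule le_less_trans[rotated])
qed

text \<open>Finiteness of the weighted \<open>L\<^sup>q\<close> norm makes \<open>u\<close> vanish, on average over dilations, at the end of the
  ray selected by the sign of \<open>\<kappa>\<close>; integrating \<open>g\<close> along the ray then bounds \<open>u\<close>.\<close>
lemma C1_limit_ray_bound:
  fixes u :: "'a::euclidean_space \<Rightarrow> real"
  assumes ug: "C1_limit u g" and q: "1 \<le> q" and \<kappa>: "\<kappa> \<noteq> 0"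
    and fin: "(\<integral>\<^sup>+x. ennreal ((norm x powr \<kappa> * \<bar>u x\<bar>) powr q) \<partial>dilation_measure) < \<infinity>"
  shows "AE x in lborel. x \<noteq> 0 \<longrightarrow>
    ennreal \<bar>u x\<bar> \<le> (\<integral>\<^sup>+\<tau>. ennreal (norm (g (\<tau> *\<^sub>R x)) * norm x) * indicator (ray_set \<kappa>) \<tau> \<partial>lborel)"
proof -
  have [measurable]: "u \<in> borel_measurable borel" "g \<in> borel_measurable borel"
    using ug by (auto simp: C1_limit_def)
  define H where "H x = (\<integral>\<^sup>+\<tau>. ennreal (norm (g (\<tau> *\<^sub>R x)) * norm x) * indicator (ray_set \<kappa>) \<tau> \<partial>lborel)" for x
  have [measurable]: "H \<in> borel_measurable borel" unfolding H_def by measurable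
  \<comment> \<open>Dilation factors that move to the far end of the ray, to infinity or to 0 with
    the sign of \<kappa>; in both cases \<open>l n powr (- \<kappa>)\<close> tends to 0.\<close>
  define l where "l n = (if \<kappa> > 0 then real (n + 1) else 1 / real (n + 1))" for n :: nat
  have l: "l n > 0" for n by (simp add: l_def)
  have lk: "l n powr (- \<kappa>) = real (n + 1) powr (- \<bar>\<kappa>\<bar>)" for n
    using \<kappa> by (auto simp: l_def powr_divide powr_minus field_simps)
  have sub: "{min 1 (l n)..max 1 (l n)} \<subseteq> ray_set \<kappa>" for n
  proof (cases "\<kappa> > 0")
    case True
    then have "1 \<le> l n" by (simp add: l_def)
    then show ?thesis using True by (auto simp: ray_set_def)
  next
    case False
    then have "l n \<le> 1" by (simp add: l_def)
    then have "{min 1 (l n)..max 1 (l n)} = {l n..1}" by (simp add: min_def max_def)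
    then show ?thesis using False l[of n] by (auto simp: ray_set_def)
  qed
  have main: "AE x in lborel. x \<in> annulus \<zeta> \<longrightarrow> ennreal \<bar>u x\<bar> \<le> H x" if \<zeta>: "0 < \<zeta>" for \<zeta>
  proof -
    define S where "S = (annulus \<zeta> :: 'a set)"
    have [measurable]: "S \<in> sets borel" by (simp add: S_def)
    have ineq: "AE x in lborel. x \<in> S \<longrightarrow> ennreal \<bar>u x\<bar> \<le> ennreal \<bar>u (l n *\<^sub>R x)\<bar> + H x" for n
    proof -
      let ?c = "l n - 1"
      \<comment> \<open>The smaller of \<open>l n\<close> and its reciprocal: m and 1/m enclose all
        factors \<open>1 + t * ?c\<close>, which keeps the segment in a compact annulus and bounds
        the Jacobian from below.\<close>
      define m where "m = (if 1 \<le> l n then 1 / l n else l n)"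
      have m: "0 < m" "m \<le> 1" "m \<le> l n" "l n \<le> 1 / m" "1 \<le> 1 / m"
      proof -
        have "1 \<le> l n * l n" if "1 \<le> l n" using mult_mono[OF that that] l[of n] by simp
        moreover have "l n * l n \<le> 1" if "l n \<le> 1" using mult_mono[OF that that] l[of n] by simp
        ultimately show "0 < m" "m \<le> 1" "m \<le> l n" "l n \<le> 1 / m" "1 \<le> 1 / m"
          using l[of n] by (auto simp: m_def field_simps)
      qed
      have tc: "m \<le> 1 + t * ?c \<and> 1 + t * ?c \<le> 1 / m \<and> min 1 (l n) \<le> 1 + t * ?c \<and> 1 + t * ?c \<le> max 1 (l n)"
        if "t \<in> {0..1}" for t
      proof -
        have e: "1 + t * ?c = (1 - t) * 1 + t * l n" by (simp add: algebra_simps)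
        have "(1 - t) * min 1 (l n) + t * min 1 (l n) \<le> (1 - t) * 1 + t * l n"
          using that by (intro add_mono mult_left_mono) auto
        moreover have "(1 - t) * 1 + t * l n \<le> (1 - t) * max 1 (l n) + t * max 1 (l n)"
          using that by (intro add_mono mult_left_mono) auto
        ultimately have "min 1 (l n) \<le> 1 + t * ?c" "1 + t * ?c \<le> max 1 (l n)"
          unfolding e by (simp_all add: algebra_simps)
        moreover have "m \<le> min 1 (l n)" using m by simp
        moreover have "max 1 (l n) \<le> 1 / m" by (rule max.boundedI[OF m(5) m(4)])
        ultimately show ?thesis by linarith
      qed
      have eq: "x + t *\<^sub>R (?c *\<^sub>R x + 0) = (1 + t * ?c) *\<^sub>R x" for x :: 'a and t
        by (simp add: algebra_simps)
      have seg: "x + t *\<^sub>R (?c *\<^sub>R x + 0) \<in> annulus (m * \<zeta>)" if "x \<in> S" "t \<in> {0..1}" for x t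
      proof -
        have x: "\<zeta> \<le> norm x" "norm x \<le> 1 / \<zeta>" using that(1) by (auto simp: S_def annulus_def)
        have p: "0 \<le> 1 + t * ?c" using tc[OF that(2)] m by linarith
        have "m * \<zeta> \<le> (1 + t * ?c) * norm x" "(1 + t * ?c) * norm x \<le> (1 / m) * (1 / \<zeta>)"
          using tc[OF that(2)] x p m \<zeta> by (intro mult_mono; simp)+
        then show ?thesis unfolding eq annulus_def using p by simp
      qed
      have m\<zeta>: "0 < m * \<zeta>" using m(1) \<zeta> by simp
      have mt: "m \<le> 1 + t * ?c" if "t \<in> {0..1}" for t using tc[OF that] by blast
      let ?I = "\<lambda>x. \<integral>\<^sup>+t. ennreal (norm (g (x + t *\<^sub>R (?c *\<^sub>R x + 0))) * norm (?c *\<^sub>R x + 0)) * indicator {0..1} t \<partial>lborel"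
      let ?J = "\<lambda>x. \<integral>\<^sup>+t. ennreal (norm (g ((1 + t * ?c) *\<^sub>R x)) * norm x) * indicator {0..1} t \<partial>lborel"
      have segm: "AE x in lborel. x \<in> S \<longrightarrow> ennreal \<bar>u x - u (x + 1 *\<^sub>R (?c *\<^sub>R x + 0))\<bar> \<le> ?I x"
        by (rule C1_limit_segment[OF ug m\<zeta> zero_le_one \<open>S \<in> sets borel\<close> seg m(1) mt]; assumption)
      show ?thesis
      proof (rule AE_mp[OF segm], rule AE_I2, rule impI)
        fix x
        assume elim: "x \<in> S \<longrightarrow> ennreal \<bar>u x - u (x + 1 *\<^sub>R (?c *\<^sub>R x + 0))\<bar> \<le>
          ?I x"
        show "x \<in> S \<longrightarrow> ennreal \<bar>u x\<bar> \<le> ennreal \<bar>u (l n *\<^sub>R x)\<bar> + H x"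
        proof
          assume x: "x \<in> S"
          have "?I x
            = (\<integral>\<^sup>+t. ennreal \<bar>?c\<bar> * (ennreal (norm (g ((1 + t * ?c) *\<^sub>R x)) * norm x) * indicator {0..1} t) \<partial>lborel)"
            unfolding eq by (intro nn_integral_cong) (auto simp: indicator_def ennreal_mult[symmetric] mult_ac)
          also have "\<dots> = ennreal \<bar>?c\<bar> * ?J x"
            by (rule nn_integral_cmult) measurable
          also have "\<dots> \<le> H x"
          proof (cases "?c = 0")
            case False
            \<comment> \<open>The substitution \<tau> = 1 + ?c * t turns the segment from x to
              \<open>l n *\<^sub>R x\<close> into a piece of the ray. The excluded case
              \<open>?c = 0\<close> is n = 0.\<close>
            have "ennreal \<bar>?c\<bar> * ?J x
              \<le> ennreal \<bar>?c\<bar> * (\<integral>\<^sup>+t. ennreal (norm (g ((1 + ?c * t) *\<^sub>R x)) * norm x) * indicator (ray_set \<kappa>) (1 + ?c * t) \<partial>lborel)"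
            proof (intro mult_left_mono nn_integral_mono)
              fix t :: real
              have "1 + ?c * t \<in> ray_set \<kappa>" if "t \<in> {0..1}"
                using tc[OF that] sub[of n] by (auto simp: mult.commute)
              then show "ennreal (norm (g ((1 + t * ?c) *\<^sub>R x)) * norm x) * indicator {0..1} t \<le>
                ennreal (norm (g ((1 + ?c * t) *\<^sub>R x)) * norm x) * indicator (ray_set \<kappa>) (1 + ?c * t)"
                by (auto simp: indicator_def mult.commute)
            qed simp
            also have "\<dots> = H x"
              unfolding H_def by (rule nn_integral_real_affine[symmetric]) (use False in auto)
            finally show ?thesis .
          qed simp
          finally have "ennreal \<bar>u x - u (l n *\<^sub>R x)\<bar> \<le> H x"
            using elim x order_trans by (fastforce simp: algebra_simps)
          then have "ennreal \<bar>u (l n *\<^sub>R x)\<bar> + ennreal \<bar>u x - u (l n *\<^sub>R x)\<bar> \<le> ennreal \<bar>u (l n *\<^sub>R x)\<bar> + H x"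
            by (rule add_left_mono)
          moreover have "ennreal \<bar>u x\<bar> \<le> ennreal \<bar>u (l n *\<^sub>R x)\<bar> + ennreal \<bar>u x - u (l n *\<^sub>R x)\<bar>"
            by (simp add: ennreal_plus[symmetric] ennreal_leI del: ennreal_plus)
          ultimately show "ennreal \<bar>u x\<bar> \<le> ennreal \<bar>u (l n *\<^sub>R x)\<bar> + H x" by (rule order_trans[rotated])
        qed
      qed
    qed
    obtain C1 where C1: "0 \<le> C1" "\<And>x::'a. x \<in> annulus \<zeta> \<Longrightarrow> norm x powr (- \<kappa>) \<le> C1"
      using norm_powr_bounded_annulus[OF \<zeta>] by blast
    obtain C2 where C2: "0 \<le> C2" "\<And>x::'a. x \<in> annulus \<zeta> \<Longrightarrow> norm x powr (real DIM('a)) \<le> C2"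
      using norm_powr_bounded_annulus[OF \<zeta>] by blast
    define U where "U x = norm x powr \<kappa> * \<bar>u x\<bar>" for x
    have [measurable]: "U \<in> borel_measurable borel" by (simp add: U_def[abs_def])
    define Z where "Z = emeasure dilation_measure S + (\<integral>\<^sup>+x. ennreal (U x powr q) \<partial>dilation_measure)"
    have "Z < \<infinity>" using fin emeasure_dilation_annulus[OF \<zeta>, where 'a='a] by (simp add: Z_def U_def S_def)
    define K where "K n = ennreal (C1 * C2) * Z * ennreal (real (n + 1) powr (- \<bar>\<kappa>\<bar>))" for n
    have Kl: "K \<longlonglongrightarrow> 0"
    proof -
      have "(\<lambda>n. real (n + 1) powr (- \<bar>\<kappa>\<bar>)) \<longlonglongrightarrow> 0" using \<kappa> by real_asymp
      then have "(\<lambda>n. ennreal (real (n + 1) powr (- \<bar>\<kappa>\<bar>))) \<longlonglongrightarrow> ennreal 0" by (rule tendsto_ennrealI)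
      then have "K \<longlonglongrightarrow> ennreal (C1 * C2) * Z * ennreal 0"
        unfolding K_def using \<open>Z < \<infinity>\<close> by (intro ennreal_tendsto_cmult) (auto simp: ennreal_mult_less_top)
      then show ?thesis by simp
    qed
    \<comment> \<open>Pointwise |u(y)| = |y|^-\<kappa> U(y) and U \<le> 1 + U^q. By dilation
      invariance the integral of the dilated U^q does not depend on n, while the weight at y = l_n x
      contributes the vanishing factor.\<close>
    have small: "(\<integral>\<^sup>+x. ennreal \<bar>u (l n *\<^sub>R x)\<bar> * indicator S x \<partial>lborel) \<le> K n" for n
    proof -
      have "(\<integral>\<^sup>+x. ennreal \<bar>u (l n *\<^sub>R x)\<bar> * indicator S x \<partial>lborel) \<le>
        (\<integral>\<^sup>+x. ennreal (l n powr (- \<kappa>) * C1 * C2) *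
          (ennreal (norm x powr (- real DIM('a))) * (indicator S x + ennreal (U (l n *\<^sub>R x) powr q))) \<partial>lborel)"
      proof (rule nn_integral_mono)
        fix x :: 'a
        show "ennreal \<bar>u (l n *\<^sub>R x)\<bar> * indicator S x \<le> ennreal (l n powr (- \<kappa>) * C1 * C2) *
          (ennreal (norm x powr (- real DIM('a))) * (indicator S x + ennreal (U (l n *\<^sub>R x) powr q)))"
        proof (cases "x \<in> S")
          case True
          then have nx: "norm x > 0" "x \<in> annulus \<zeta>" using \<zeta> by (auto simp: S_def annulus_def)
          let ?y = "l n *\<^sub>R x"
          have "\<bar>u ?y\<bar> = norm ?y powr (- \<kappa>) * U ?y"
            using nx l[of n] by (simp add: U_def mult.assoc[symmetric] powr_add[symmetric])
          also have "norm ?y powr (- \<kappa>) = l n powr (- \<kappa>) * norm x powr (- \<kappa>)"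
            using l[of n] by (simp add: powr_mult)
          also have "l n powr (- \<kappa>) * norm x powr (- \<kappa>) * U ?y \<le> l n powr (- \<kappa>) * C1 * (1 + U ?y powr q)"
          proof (intro mult_mono C1 nx mult_left_mono)
            have U0: "0 \<le> U ?y" by (simp add: U_def)
            show "U ?y \<le> 1 + U ?y powr q"
            proof (cases "U ?y \<le> 1")
              case True then show ?thesis by (simp add: add_increasing2)
            next
              case False
              then have "U ?y powr 1 \<le> U ?y powr q" using q by (intro powr_mono) auto
              then show ?thesis using False by simp
            qed
          qed (use C1 in \<open>auto simp: U_def\<close>)
          also have "\<dots> \<le> l n powr (- \<kappa>) * C1 * ((C2 * norm x powr (- real DIM('a))) * (1 + U ?y powr q))"
          proof (intro mult_left_mono)
            have "1 = norm x powr real DIM('a) * norm x powr (- real DIM('a))"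
              using nx by (simp add: powr_add[symmetric])
            also have "\<dots> \<le> C2 * norm x powr (- real DIM('a))"
              by (intro mult_right_mono C2 nx) auto
            finally have "1 * (1 + U ?y powr q) \<le> (C2 * norm x powr (- real DIM('a))) * (1 + U ?y powr q)"
              by (rule mult_right_mono) simp
            then show "1 + U ?y powr q \<le> (C2 * norm x powr (- real DIM('a))) * (1 + U ?y powr q)" by simp
          qed (use C1 in auto)
          finally have "\<bar>u ?y\<bar> \<le> (l n powr (- \<kappa>) * C1 * C2) * (norm x powr (- real DIM('a)) * (1 + U ?y powr q))"
            by (simp add: mult_ac)
          then have "ennreal \<bar>u ?y\<bar> \<le> ennreal ((l n powr (- \<kappa>) * C1 * C2) * (norm x powr (- real DIM('a)) * (1 + U ?y powr q)))"
            by (rule ennreal_leI)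
          also have "\<dots> = ennreal (l n powr (- \<kappa>) * C1 * C2) * (ennreal (norm x powr (- real DIM('a))) * (1 + ennreal (U ?y powr q)))"
            using C1 C2 by (simp add: ennreal_mult)
          finally show ?thesis using True by simp
        qed simp
      qed
      also have "\<dots> = ennreal (l n powr (- \<kappa>) * C1 * C2) *
        (\<integral>\<^sup>+x. (indicator S x + ennreal (U (l n *\<^sub>R x) powr q)) \<partial>dilation_measure)"
        by (subst nn_integral_dilation_measure, measurable, rule nn_integral_cmult) measurable
      also have "(\<integral>\<^sup>+x. (indicator S x + ennreal (U (l n *\<^sub>R x) powr q)) \<partial>dilation_measure) =
         emeasure dilation_measure S + (\<integral>\<^sup>+x. ennreal (U (l n *\<^sub>R x) powr q) \<partial>dilation_measure)"
        by (subst nn_integral_add) auto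
      also have "(\<integral>\<^sup>+x. ennreal (U (l n *\<^sub>R x) powr q) \<partial>dilation_measure) = (\<integral>\<^sup>+x. ennreal (U x powr q) \<partial>dilation_measure)"
        by (rule nn_integral_dilate[of "\<lambda>x. ennreal (U x powr q)"]) (auto simp: l)
      finally show ?thesis
        using C1 C2 by (simp add: K_def Z_def lk ennreal_mult mult_ac)
    qed
    have "(\<integral>\<^sup>+x. (ennreal \<bar>u x\<bar> - H x) * indicator S x \<partial>lborel) \<le> K n" for n
    proof -
      have "(\<integral>\<^sup>+x. (ennreal \<bar>u x\<bar> - H x) * indicator S x \<partial>lborel) \<le> (\<integral>\<^sup>+x. ennreal \<bar>u (l n *\<^sub>R x)\<bar> * indicator S x \<partial>lborel)"
      proof (rule nn_integral_mono_AE)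
        show "AE x in lborel. (ennreal \<bar>u x\<bar> - H x) * indicator S x \<le> ennreal \<bar>u (l n *\<^sub>R x)\<bar> * indicator S x"
          using ineq[of n]
        proof eventually_elim
          case (elim x)
          then show ?case by (auto simp: indicator_def ennreal_minus_le_iff add.commute)
        qed
      qed
      then show ?thesis using small order_trans by blast
    qed
    then have "(\<integral>\<^sup>+x. (ennreal \<bar>u x\<bar> - H x) * indicator S x \<partial>lborel) \<le> 0"
      by (intro LIMSEQ_le_const[OF Kl]) auto
    then have "AE x in lborel. (ennreal \<bar>u x\<bar> - H x) * indicator S x = 0"
      by (subst (asm) le_zero_eq, subst (asm) nn_integral_0_iff_AE) auto
    then show ?thesis
      by eventually_elim (auto simp: indicator_def diff_eq_0_iff_ennreal S_def)
  qed
  have "AE x in lborel. \<forall>n. x \<in> annulus (1 / real (Suc n)) \<longrightarrow> ennreal \<bar>u x\<bar> \<le> H x"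
    unfolding AE_all_countable using main by simp
  then show ?thesis
  proof eventually_elim
    case (elim x)
    then show ?case using annulus_exhausts[of x] unfolding H_def eventually_sequentially by blast
  qed
qed

text \<open>Hoelder with respect to the weight \<omega>, of total mass W, gives U^p \<le> W^(p-1)
  \<integral> \<omega>(\<tau>) V(\<tau>x)^p d\<tau>. After Fubini every dilate of V has the same
  integral, so the integral of \<omega> supplies the last factor W.\<close>

lemma Hardy_dilation:
  fixes V :: "'a::euclidean_space \<Rightarrow> real"
  assumes [measurable]: "U \<in> borel_measurable borel" "V \<in> borel_measurable borel"
    and nn: "\<And>x. 0 \<le> U x" "\<And>x. 0 \<le> V x" and p: "1 \<le> p"
    and UV: "AE x in dilation_measure. ennreal (U x) \<le>
      (\<integral>\<^sup>+\<tau>. ennreal (\<tau> powr (- \<kappa> - 1)) * indicator (ray_set \<kappa>) \<tau> * ennreal (V (\<tau> *\<^sub>R x)) \<partial>lborel)"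
  defines "W \<equiv> (\<integral>\<^sup>+\<tau>. ennreal (\<tau> powr (- \<kappa> - 1)) * indicator (ray_set \<kappa>) \<tau> \<partial>lborel)"
  shows "(\<integral>\<^sup>+x. ennreal (U x powr p) \<partial>dilation_measure) \<le>
    epow W p * (\<integral>\<^sup>+x. ennreal (V x powr p) \<partial>dilation_measure)"
proof -
  define \<omega> where "\<omega> \<tau> = ennreal (\<tau> powr (- \<kappa> - 1)) * indicator (ray_set \<kappa>) \<tau>" for \<tau> :: real
  have [measurable]: "\<omega> \<in> borel_measurable borel" by (simp add: \<omega>_def[abs_def])
  define E where "E = (\<integral>\<^sup>+x. ennreal (V x powr p) \<partial>dilation_measure)"
  have pt: "(\<integral>\<^sup>+\<tau>. \<omega> \<tau> * ennreal (V (\<tau> *\<^sub>R x)) \<partial>lborel) \<le>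
      epow (\<integral>\<^sup>+\<tau>. \<omega> \<tau> * ennreal (V (\<tau> *\<^sub>R x) powr p) \<partial>lborel) (1/p) * epow W (1 - 1/p)" for x
  proof -
    have e: "\<omega> \<tau> * ennreal (V y) = epow (\<omega> \<tau> * ennreal (V y powr p)) (1/p) * epow (\<omega> \<tau>) (1 - 1/p)" for \<tau> y
    proof -
      have "epow (\<omega> \<tau>) (1/p) * epow (\<omega> \<tau>) (1 - 1/p) = \<omega> \<tau>"
        using p epow_add[of "1/p" "1 - 1/p" "\<omega> \<tau>"] by simp
      moreover have "epow (ennreal (V y powr p)) (1/p) = ennreal (V y)"
        using p nn(2)[of y] by (simp add: epow_ennreal powr_powr)
      ultimately show ?thesis using p by (simp add: epow_mult mult_ac)
    qed
    show ?thesis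
      unfolding e W_def \<omega>_def[symmetric]
      by (rule nn_integral_Holder) (use p in auto)
  qed
  have "(\<integral>\<^sup>+x. ennreal (U x powr p) \<partial>dilation_measure) \<le>
    (\<integral>\<^sup>+x. (\<integral>\<^sup>+\<tau>. \<omega> \<tau> * ennreal (V (\<tau> *\<^sub>R x) powr p) \<partial>lborel) * epow W (p - 1) \<partial>dilation_measure)"
  proof (rule nn_integral_mono_AE)
    show "AE x in dilation_measure. ennreal (U x powr p) \<le>
      (\<integral>\<^sup>+\<tau>. \<omega> \<tau> * ennreal (V (\<tau> *\<^sub>R x) powr p) \<partial>lborel) * epow W (p - 1)"
      using UV
    proof eventually_elim
      case (elim x)
      let ?A = "\<integral>\<^sup>+\<tau>. \<omega> \<tau> * ennreal (V (\<tau> *\<^sub>R x) powr p) \<partial>lborel"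
      have "ennreal (U x) \<le> epow ?A (1/p) * epow W (1 - 1/p)"
        using elim pt[of x] unfolding \<omega>_def[symmetric] by (rule order_trans)
      then have "epow (ennreal (U x)) p \<le> epow (epow ?A (1/p) * epow W (1 - 1/p)) p"
        using p by (intro epow_mono) auto
      also have "\<dots> = ?A * epow W (p - 1)"
      proof -
        have "(1 - 1/p) * p = p - 1" using p by (simp add: field_simps)
        then show ?thesis using p by (simp add: epow_mult epow_epow)
      qed
      finally show ?case using p nn(1)[of x] by (simp add: epow_ennreal)
    qed
  qed
  also have "\<dots> = (\<integral>\<^sup>+x. (\<integral>\<^sup>+\<tau>. \<omega> \<tau> * ennreal (V (\<tau> *\<^sub>R x) powr p) \<partial>lborel) \<partial>dilation_measure) * epow W (p - 1)"
    by (rule nn_integral_multc) simp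
  also have "(\<integral>\<^sup>+x. (\<integral>\<^sup>+\<tau>. \<omega> \<tau> * ennreal (V (\<tau> *\<^sub>R x) powr p) \<partial>lborel) \<partial>dilation_measure)
    = (\<integral>\<^sup>+x. (\<integral>\<^sup>+\<tau>. ennreal (norm x powr (- real DIM('a))) * (\<omega> \<tau> * ennreal (V (\<tau> *\<^sub>R x) powr p)) \<partial>lborel) \<partial>lborel)"
    by (subst nn_integral_dilation_measure) (simp_all add: nn_integral_cmult)
  also have "\<dots> = (\<integral>\<^sup>+\<tau>. (\<integral>\<^sup>+x. ennreal (norm x powr (- real DIM('a))) * (\<omega> \<tau> * ennreal (V (\<tau> *\<^sub>R x) powr p)) \<partial>lborel) \<partial>lborel)"
    by (rule lborel_pair.Fubini') measurable
  also have "\<dots> = (\<integral>\<^sup>+\<tau>. \<omega> \<tau> * E \<partial>lborel)"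
  proof (rule nn_integral_cong)
    fix \<tau> :: real
    have "(\<integral>\<^sup>+x. ennreal (norm x powr (- real DIM('a))) * (\<omega> \<tau> * ennreal (V (\<tau> *\<^sub>R x) powr p)) \<partial>lborel)
      = \<omega> \<tau> * (\<integral>\<^sup>+x. ennreal (V (\<tau> *\<^sub>R x) powr p) \<partial>dilation_measure)"
      by (subst nn_integral_dilation_measure, measurable, subst nn_integral_cmult[symmetric]) (simp_all add: mult_ac)
    also have "\<dots> = \<omega> \<tau> * E"
    proof (cases "\<tau> > 0")
      case True
      then show ?thesis using nn_integral_dilate[of "\<lambda>x. ennreal (V x powr p)" \<tau>] by (simp add: E_def)
    next
      case False
      then show ?thesis by (auto simp: \<omega>_def ray_set_def indicator_def)
    qed
    finally show "(\<integral>\<^sup>+x. ennreal (norm x powr (- real DIM('a))) * (\<omega> \<tau> * ennreal (V (\<tau> *\<^sub>R x) powr p)) \<partial>lborel) = \<omega> \<tau> * E" .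
  qed
  also have "\<dots> = W * E" by (simp add: nn_integral_multc W_def \<omega>_def[symmetric])
  also have "W * E * epow W (p - 1) = epow W p * E"
    using epow_add[of 1 "p - 1" W] p by (simp add: mult_ac)
  finally show ?thesis by (simp add: E_def)
qed

text \<open>Multiplying the ray bound by |x|^\<kappa> and writing |x| = |\<tau>x|/\<tau> turns its
  integrand into \<tau>^(-\<kappa>-1) V(\<tau>x), the form in which dilation invariance
  applies.\<close>

lemma C1_limit_Hardy:
  fixes u :: "'a::euclidean_space \<Rightarrow> real"
  assumes ug: "C1_limit u g" and q: "1 \<le> q" and p: "1 \<le> p" and \<kappa>: "\<kappa> \<noteq> 0"
    and fin: "(\<integral>\<^sup>+x. ennreal ((norm x powr \<kappa> * \<bar>u x\<bar>) powr q) \<partial>dilation_measure) < \<infinity>"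
  defines "W \<equiv> (\<integral>\<^sup>+\<tau>. ennreal (\<tau> powr (- \<kappa> - 1)) * indicator (ray_set \<kappa>) \<tau> \<partial>lborel)"
  shows "(\<integral>\<^sup>+x. ennreal ((norm x powr \<kappa> * \<bar>u x\<bar>) powr p) \<partial>dilation_measure) \<le>
    epow W p * (\<integral>\<^sup>+x. ennreal ((norm x powr (\<kappa> + 1) * norm (g x)) powr p) \<partial>dilation_measure)"
  unfolding W_def
proof (rule Hardy_dilation)
  show [measurable]: "(\<lambda>x. norm x powr \<kappa> * \<bar>u x\<bar>) \<in> borel_measurable borel"
    "(\<lambda>x. norm x powr (\<kappa> + 1) * norm (g x)) \<in> borel_measurable borel"
    using ug by (auto simp: C1_limit_def)
  have [measurable]: "g \<in> borel_measurable borel" using ug by (auto simp: C1_limit_def)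
  show "AE x in dilation_measure. ennreal (norm x powr \<kappa> * \<bar>u x\<bar>) \<le>
      (\<integral>\<^sup>+\<tau>. ennreal (\<tau> powr (- \<kappa> - 1)) * indicator (ray_set \<kappa>) \<tau> *
        ennreal (norm (\<tau> *\<^sub>R x) powr (\<kappa> + 1) * norm (g (\<tau> *\<^sub>R x))) \<partial>lborel)"
    using AE_dilation_measure[OF C1_limit_ray_bound[OF ug q \<kappa> fin]] AE_dilation_measure_nz
  proof eventually_elim
    case (elim x)
    have "ennreal (norm x powr \<kappa> * \<bar>u x\<bar>) = ennreal (norm x powr \<kappa>) * ennreal \<bar>u x\<bar>"
      by (simp add: ennreal_mult)
    also have "\<dots> \<le> ennreal (norm x powr \<kappa>) * (\<integral>\<^sup>+\<tau>. ennreal (norm (g (\<tau> *\<^sub>R x)) * norm x) * indicator (ray_set \<kappa>) \<tau> \<partial>lborel)"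
      using elim by (intro mult_left_mono) auto
    also have "\<dots> = (\<integral>\<^sup>+\<tau>. ennreal (norm x powr \<kappa>) * (ennreal (norm (g (\<tau> *\<^sub>R x)) * norm x) * indicator (ray_set \<kappa>) \<tau>) \<partial>lborel)"
      by (rule nn_integral_cmult[symmetric]) measurable
    also have "\<dots> = (\<integral>\<^sup>+\<tau>. ennreal (\<tau> powr (- \<kappa> - 1)) * indicator (ray_set \<kappa>) \<tau> *
        ennreal (norm (\<tau> *\<^sub>R x) powr (\<kappa> + 1) * norm (g (\<tau> *\<^sub>R x))) \<partial>lborel)"
    proof (rule nn_integral_cong)
      fix \<tau> :: real
      show "ennreal (norm x powr \<kappa>) * (ennreal (norm (g (\<tau> *\<^sub>R x)) * norm x) * indicator (ray_set \<kappa>) \<tau>) =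
        ennreal (\<tau> powr (- \<kappa> - 1)) * indicator (ray_set \<kappa>) \<tau> *
        ennreal (norm (\<tau> *\<^sub>R x) powr (\<kappa> + 1) * norm (g (\<tau> *\<^sub>R x)))"
      proof (cases "\<tau> \<in> ray_set \<kappa>")
        case True
        then have \<tau>: "\<tau> > 0" by (auto simp: ray_set_def split: if_splits)
        have "\<tau> powr (- \<kappa> - 1) * norm (\<tau> *\<^sub>R x) powr (\<kappa> + 1) = (\<tau> powr (- \<kappa> - 1) * \<tau> powr (\<kappa> + 1)) * norm x powr (\<kappa> + 1)"
          using \<tau> by (simp add: powr_mult)
        also have "\<dots> = norm x powr \<kappa> * norm x"
          using \<tau> elim powr_add[of "norm x" \<kappa> 1] by (simp add: powr_add[symmetric])
        finally have "\<tau> powr (- \<kappa> - 1) * (norm (\<tau> *\<^sub>R x) powr (\<kappa> + 1) * norm (g (\<tau> *\<^sub>R x))) =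
          norm x powr \<kappa> * (norm (g (\<tau> *\<^sub>R x)) * norm x)"
          by (simp add: mult_ac)
        from this[symmetric] show ?thesis
          using True by (simp add: ennreal_mult[symmetric] del: norm_scaleR mult_cancel_left mult_cancel_right)
      qed simp
    qed
    finally show ?case .
  qed
qed (use p in auto)

subsection \<open>Powers along lines\<close>

lemma continuous_real_antiderivative:
  fixes f :: "real \<Rightarrow> real"
  assumes "continuous_on UNIV f"
  obtains F where "F 0 = 0" "\<And>t. (F has_real_derivative f t) (at t)"
proof -
  define F where "F t = (LBINT y=ereal 0..t. f y)" for t :: real
  have "(F has_real_derivative f t) (at t)" for t
  proof -
    define K where "K = \<bar>t\<bar> + 1"
    have "(F has_vector_derivative f t) (at t within {-K..K})"
      unfolding F_def
      using interval_integral_FTC2[of "-K" 0 K f t] continuous_on_subset[OF assms, of "{-K..K}"]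
      by (auto simp: K_def zero_ereal_def)
    moreover have "at t within {-K..K} = at t"
      by (rule at_within_interior) (auto simp: K_def)
    ultimately show ?thesis by (simp add: has_real_derivative_iff_has_vector_derivative)
  qed
  moreover have "F 0 = 0" by (simp add: F_def)
  ultimately show ?thesis using that by blast
qed

text \<open>The odd power \<open>sgn t * \<bar>t\<bar> powr s\<close> is continued linearly beyond \<open>M\<close>, so that its derivative
  is bounded, as the chain rule \<open>C1_limit_chain\<close> needs.\<close>
lemma truncated_power_exists:
  assumes s: "1 \<le> s" and M: "0 < M"
  obtains \<phi> \<phi>' B where "\<And>t. (\<phi> has_real_derivative \<phi>' t) (at t)" "\<And>t. \<bar>\<phi>' t\<bar> \<le> B"
    "uniformly_continuous_on UNIV \<phi>'" "\<And>t. \<bar>\<phi> t\<bar> \<le> \<bar>t\<bar> powr s"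
    "\<And>t. \<bar>\<phi>' t\<bar> \<le> s * rpow \<bar>t\<bar> (s - 1)" "\<And>t. \<bar>t\<bar> \<le> M \<Longrightarrow> \<bar>\<phi> t\<bar> = \<bar>t\<bar> powr s"
proof (cases "s = 1")
  \<comment> \<open>Treated apart because \<open>0 powr 0 = 0\<close> would make the derivative
    \<open>f\<close> below jump at 0 for s = 1.\<close>
  case True
  show ?thesis
  proof (rule that[of "\<lambda>t. t" "\<lambda>t. 1" 1])
    show "uniformly_continuous_on UNIV (\<lambda>t::real. 1::real)" by (rule uniformly_continuous_on_const)
  qed (use True in \<open>auto simp: rpow_def\<close>)
next
  case False
  then have s: "s > 1" using s by simp
  define f where "f t = s * min \<bar>t\<bar> M powr (s - 1)" for t
  have cf: "continuous_on UNIV f"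
    unfolding f_def using s M by (intro continuous_intros continuous_on_powr') auto
  obtain \<phi> where \<phi>: "\<phi> 0 = 0" "\<And>t. (\<phi> has_real_derivative f t) (at t)"
    using continuous_real_antiderivative[OF cf] by blast
  have f0: "0 \<le> f t" for t using s by (simp add: f_def)
  have fB: "f t \<le> s * M powr (s - 1)" for t
    unfolding f_def using s M by (intro mult_left_mono powr_mono2) auto
  have uc: "uniformly_continuous_on UNIV f"
    unfolding uniformly_continuous_on_def
  proof (intro allI impI)
    fix e :: real assume e: "0 < e"
    have "uniformly_continuous_on {0..M} f"
      by (rule compact_uniformly_continuous[OF continuous_on_subset[OF cf]]) auto
    then obtain d where d: "d > 0" "\<And>x y. x \<in> {0..M} \<Longrightarrow> y \<in> {0..M} \<Longrightarrow> dist y x < d \<Longrightarrow> dist (f y) (f x) < e"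
      using e unfolding uniformly_continuous_on_def by metis
    have eq: "f t = f (min \<bar>t\<bar> M)" for t using M by (simp add: f_def)
    have "dist (f y) (f x) < e" if "dist y x < d" for x y
    proof -
      have "dist (min \<bar>y\<bar> M) (min \<bar>x\<bar> M) \<le> dist y x" by (simp add: dist_real_def)
      then show ?thesis using d(2)[of "min \<bar>x\<bar> M" "min \<bar>y\<bar> M"] that M eq[of x] eq[of y] by simp
    qed
    then show "\<exists>d>0. \<forall>x\<in>UNIV. \<forall>x'\<in>UNIV. dist x' x < d \<longrightarrow> dist (f x') (f x) < e" using d(1) by auto
  qed
  have cont: "continuous_on S \<phi>" for S
    using \<phi>(2) by (intro continuous_at_imp_continuous_on) (auto intro: DERIV_isCont)
  have dpow: "((\<lambda>t. t powr s) has_real_derivative s * t powr (s - 1)) (at t)" if "t > 0" for t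
    using that by (auto intro!: derivative_eq_intros)
  have cpow: "continuous_on {0..t} (\<lambda>t::real. t powr s)" for t
    using s by (intro continuous_on_powr' continuous_intros) auto
  have pos: "0 \<le> \<phi> t \<and> \<phi> t \<le> t powr s \<and> (t \<le> M \<longrightarrow> \<phi> t = t powr s)" if t: "0 \<le> t" for t
  proof (intro conjI impI)
    show "0 \<le> \<phi> t"
      using DERIV_nonneg_imp_nondecreasing[of 0 t \<phi>] t \<phi> f0 by force
    have "0 powr s - \<phi> 0 \<le> t powr s - \<phi> t"
    proof (rule DERIV_nonneg_imp_increasing_open[of 0 t "\<lambda>t. t powr s - \<phi> t"])
      fix x assume x: "0 < x" "x < t"
      have "f x \<le> s * x powr (s - 1)" unfolding f_def using s x M by (intro mult_left_mono powr_mono2) auto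
      moreover have "((\<lambda>t. t powr s - \<phi> t) has_real_derivative s * x powr (s - 1) - f x) (at x)"
        by (intro DERIV_diff dpow x \<phi>)
      ultimately show "\<exists>y. ((\<lambda>t. t powr s - \<phi> t) has_real_derivative y) (at x) \<and> 0 \<le> y" by force
    qed (use t in \<open>auto intro!: continuous_intros cpow cont\<close>)
    then show le: "\<phi> t \<le> t powr s" using \<phi>(1) s by simp
    assume tM: "t \<le> M"
    have "\<phi> 0 - 0 powr s \<le> \<phi> t - t powr s"
    proof (rule DERIV_nonneg_imp_increasing_open[of 0 t "\<lambda>t. \<phi> t - t powr s"])
      fix x assume x: "0 < x" "x < t"
      have "f x = s * x powr (s - 1)" unfolding f_def using x tM by simp
      moreover have "((\<lambda>t. \<phi> t - t powr s) has_real_derivative f x - s * x powr (s - 1)) (at x)"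
        by (intro DERIV_diff dpow x \<phi>)
      ultimately show "\<exists>y. ((\<lambda>t. \<phi> t - t powr s) has_real_derivative y) (at x) \<and> 0 \<le> y" by force
    qed (use t in \<open>auto intro!: continuous_intros cpow cont\<close>)
    then show "\<phi> t = t powr s" using le \<phi>(1) s by simp
  qed
  have odd: "\<phi> (- t) = - \<phi> t" for t
  proof -
    have "((\<lambda>t. \<phi> (- t)) has_real_derivative f (- t) * (- 1)) (at t)" for t
      by (rule DERIV_chain2[OF \<phi>(2)]) (auto intro!: derivative_eq_intros)
    then have "((\<lambda>t. \<phi> t + \<phi> (- t)) has_real_derivative f t + f (- t) * (- 1)) (at t)" for t
      by (intro DERIV_add \<phi>)
    then have "((\<lambda>t. \<phi> t + \<phi> (- t)) has_real_derivative 0) (at t)" for t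
      by (simp add: f_def)
    then have "\<phi> t + \<phi> (- t) = \<phi> 0 + \<phi> (- 0)"
      using DERIV_isconst_all[of "\<lambda>t. \<phi> t + \<phi> (- t)" t 0] by blast
    then show ?thesis using \<phi>(1) by simp
  qed
  have ab: "\<bar>\<phi> t\<bar> = \<phi> \<bar>t\<bar>" for t
    using pos[of "\<bar>t\<bar>"] odd[of t] by (cases "t \<ge> 0") auto
  show ?thesis
  proof (rule that[OF \<phi>(2) _ uc])
    show "\<bar>f t\<bar> \<le> s * M powr (s - 1)" for t using f0[of t] fB[of t] by simp
    show "\<bar>\<phi> t\<bar> \<le> \<bar>t\<bar> powr s" for t using pos[of "\<bar>t\<bar>"] ab by simp
    show "\<bar>f t\<bar> \<le> s * rpow \<bar>t\<bar> (s - 1)" for t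
      using f0[of t] s M by (auto simp: rpow_def f_def intro!: mult_left_mono powr_mono2)
    show "\<bar>\<phi> t\<bar> = \<bar>t\<bar> powr s" if "\<bar>t\<bar> \<le> M" for t using pos[of "\<bar>t\<bar>"] ab that by simp
  qed
qed

text \<open>Starting at \<open>x\<close> and moving away from the origin, average the fundamental theorem of calculus over
  end points at distance between \<open>norm x\<close> and \<open>2 * norm x\<close>; the end-point values are absorbed by the term
  \<open>3 * \<bar>w\<bar> / norm\<close>, so no decay of \<open>w\<close> is needed.\<close>
lemma C1_limit_half_line_bound:
  fixes w :: "'a::euclidean_space \<Rightarrow> real"
  assumes wk: "C1_limit w k" and e: "norm e = 1"
  shows "AE x in lborel. x \<noteq> 0 \<and> 0 \<le> x \<bullet> e \<longrightarrow> ennreal \<bar>w x\<bar> \<le>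
    (\<integral>\<^sup>+t. ennreal (norm (k (x + t *\<^sub>R e)) + 3 * \<bar>w (x + t *\<^sub>R e)\<bar> / norm (x + t *\<^sub>R e)) * indicator {0..} t \<partial>lborel)"
proof -
  have [measurable]: "w \<in> borel_measurable borel" "k \<in> borel_measurable borel"
    using wk by (auto simp: C1_limit_def)
  \<comment> \<open>The sign condition makes the norm nondecreasing in comparison with the start x,
    so the half-line from a nonzero x never meets the origin.\<close>
  have far: "norm x \<le> norm (x + t *\<^sub>R e)" "norm (x + t *\<^sub>R e) \<le> norm x + t" if "0 \<le> x \<bullet> e" "0 \<le> t" for x t
  proof -
    have "(norm (x + t *\<^sub>R e))\<^sup>2 = (norm x)\<^sup>2 + 2 * t * (x \<bullet> e) + t\<^sup>2"
      using e unfolding power2_norm_eq_inner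
      by (simp add: norm_eq_1 inner_add_left inner_add_right inner_commute algebra_simps power2_eq_square)
    then have "(norm x)\<^sup>2 \<le> (norm (x + t *\<^sub>R e))\<^sup>2" using that by simp
    then show "norm x \<le> norm (x + t *\<^sub>R e)" by (rule power2_le_imp_le) simp
    show "norm (x + t *\<^sub>R e) \<le> norm x + t"
      using norm_triangle_ineq[of x "t *\<^sub>R e"] e that by simp
  qed
  define R where "R x = (\<integral>\<^sup>+t. ennreal (norm (k (x + t *\<^sub>R e))) * indicator {0..} t \<partial>lborel)" for x
  have [measurable]: "R \<in> borel_measurable borel" unfolding R_def by measurable
  let ?P = "\<lambda>x T. x \<noteq> 0 \<and> 0 \<le> x \<bullet> e \<and> 0 \<le> T \<longrightarrow> ennreal \<bar>w x - w (x + T *\<^sub>R e)\<bar> \<le> R x"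
  have 1: "AE x in lborel. ?P x T" for T
  proof (cases "0 \<le> T")
    case T: True
    let ?Q = "\<lambda>x n. x \<in> annulus (1 / real (Suc n)) \<inter> {x. 0 \<le> x \<bullet> e} \<longrightarrow> ennreal \<bar>w x - w (x + T *\<^sub>R (0 *\<^sub>R x + e))\<bar> \<le>
      (\<integral>\<^sup>+t. ennreal (norm (k (x + t *\<^sub>R (0 *\<^sub>R x + e))) * norm (0 *\<^sub>R x + e)) * indicator {0..T} t \<partial>lborel)"
    have "AE x in lborel. ?Q x n" for n
    proof (rule C1_limit_segment[OF wk _ T])
      define \<eta> where "\<eta> = 1 / (real (Suc n) + T)"
      show "0 < \<eta>" using T by (simp add: \<eta>_def)
      have "\<eta> \<le> 1 / real (Suc n)" unfolding \<eta>_def using T by (intro divide_left_mono) auto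
      then show "x + t *\<^sub>R (0 *\<^sub>R x + e) \<in> annulus \<eta>"
        if "x \<in> annulus (1 / real (Suc n)) \<inter> {x. 0 \<le> x \<bullet> e}" "t \<in> {0..T}" for x t
        using that far[of x t] by (auto simp: annulus_def \<eta>_def)
      show "annulus (1 / real (Suc n)) \<inter> {x. 0 \<le> x \<bullet> e} \<in> sets borel" by measurable
      show "(0::real) < 1" by simp
      show "1 \<le> 1 + t * 0" for t :: real by simp
    qed
    then have "AE x in lborel. \<forall>n. ?Q x n"
      unfolding AE_all_countable by blast
    then show ?thesis
    proof (rule AE_mp, intro AE_I2 impI)
      fix x
      assume *: "\<forall>n. ?Q x n"
      assume x: "x \<noteq> 0 \<and> 0 \<le> x \<bullet> e \<and> 0 \<le> T"
      obtain n where "x \<in> annulus (1 / real (Suc n))"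
        using annulus_exhausts[of x] x unfolding eventually_sequentially by blast
      then have "ennreal \<bar>w x - w (x + T *\<^sub>R (0 *\<^sub>R x + e))\<bar> \<le>
        (\<integral>\<^sup>+t. ennreal (norm (k (x + t *\<^sub>R (0 *\<^sub>R x + e))) * norm (0 *\<^sub>R x + e)) * indicator {0..T} t \<partial>lborel)"
        using * x by blast
      also have "\<dots> \<le> R x"
        unfolding R_def using e by (intro nn_integral_mono) (auto simp: indicator_def)
      finally show "ennreal \<bar>w x - w (x + T *\<^sub>R e)\<bar> \<le> R x" by simp
    qed
  qed simp
  \<comment> \<open>The end point is to be averaged for fixed x, whereas the segment bound excludes
    a null set of x that depends on T. Fubini exchanges the two.\<close>
  have 2: "AE x in lborel. AE T in lborel. ?P x T"
  proof (subst lborel_pair.AE_commute)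
    show "{p \<in> space (lborel \<Otimes>\<^sub>M lborel). fst p \<noteq> 0 \<and> 0 \<le> fst p \<bullet> e \<and> 0 \<le> (snd p :: real) \<longrightarrow>
      ennreal \<bar>w (fst p) - w (fst p + snd p *\<^sub>R e)\<bar> \<le> R (fst p)} \<in> sets (lborel \<Otimes>\<^sub>M lborel)"
      by measurable
    show "AE T in lborel. AE x in lborel. ?P x T"
      by (rule AE_I2, rule 1)
  qed
  show ?thesis
  proof (rule AE_mp[OF 2], intro AE_I2 impI)
    fix x assume aeT: "AE T in lborel. ?P x T"
    assume x: "x \<noteq> 0 \<and> 0 \<le> x \<bullet> e"
    then have nx: "norm x > 0" by simp
    define I where "I = {norm x..2 * norm x}"
    have em: "ennreal (1 / norm x) * emeasure lborel I = 1"
      using nx by (simp add: I_def ennreal_mult[symmetric])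
    have "ennreal \<bar>w x\<bar> = (\<integral>\<^sup>+T. ennreal (1 / norm x) * ennreal \<bar>w x\<bar> * indicator I T \<partial>lborel)"
    proof -
      have "(\<integral>\<^sup>+T. ennreal (1 / norm x) * ennreal \<bar>w x\<bar> * indicator I T \<partial>lborel) = ennreal (1 / norm x) * ennreal \<bar>w x\<bar> * emeasure lborel I"
        by (rule nn_integral_cmult_indicator) (simp add: I_def)
      also have "\<dots> = (ennreal (1 / norm x) * emeasure lborel I) * ennreal \<bar>w x\<bar>"
        by (simp only: mult_ac)
      finally show ?thesis by (simp only: em mult_1)
    qed
    also have "\<dots> \<le> (\<integral>\<^sup>+T. ennreal (3 * \<bar>w (x + T *\<^sub>R e)\<bar> / norm (x + T *\<^sub>R e)) * indicator {0..} T
        + ennreal (1 / norm x) * R x * indicator I T \<partial>lborel)"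
    proof (rule nn_integral_mono_AE, rule AE_mp[OF aeT], intro AE_I2 impI)
      fix T assume T: "?P x T"
      show "ennreal (1 / norm x) * ennreal \<bar>w x\<bar> * indicator I T \<le>
        ennreal (3 * \<bar>w (x + T *\<^sub>R e)\<bar> / norm (x + T *\<^sub>R e)) * indicator {0..} T
        + ennreal (1 / norm x) * R x * indicator I T"
      proof (cases "T \<in> I")
        case True
        then have T0: "0 \<le> T" "T \<le> 2 * norm x" using nx by (auto simp: I_def)
        let ?y = "x + T *\<^sub>R e"
        \<comment> \<open>Here T \<le> 2|x| gives |y| \<le> 3|x|, the origin of the factor
          3.\<close>
        have y: "norm ?y > 0" "norm ?y \<le> 3 * norm x" using far[of x T] x T0 nx by auto
        have "ennreal (1 / norm x) * ennreal \<bar>w x\<bar> \<le> ennreal (1 / norm x) * (ennreal \<bar>w ?y\<bar> + ennreal \<bar>w x - w ?y\<bar>)"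
          by (intro mult_left_mono) (simp_all add: ennreal_plus[symmetric] ennreal_leI del: ennreal_plus)
        also have "\<dots> = ennreal (1 / norm x) * ennreal \<bar>w ?y\<bar> + ennreal (1 / norm x) * ennreal \<bar>w x - w ?y\<bar>"
          by (rule distrib_left)
        also have "\<dots> \<le> ennreal (3 * \<bar>w ?y\<bar> / norm ?y) + ennreal (1 / norm x) * R x"
        proof (intro add_mono mult_left_mono)
          have "1 / norm x \<le> 3 / norm ?y" using y nx by (simp add: field_simps)
          from mult_right_mono[OF this, of "\<bar>w ?y\<bar>"]
          show "ennreal (1 / norm x) * ennreal \<bar>w ?y\<bar> \<le> ennreal (3 * \<bar>w ?y\<bar> / norm ?y)"
            by (simp add: ennreal_mult[symmetric] ennreal_leI)
          show "ennreal \<bar>w x - w ?y\<bar> \<le> R x" using T T0 x by blast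
        qed simp
        finally show ?thesis using True T0 by simp
      qed simp
    qed
    also have "\<dots> = (\<integral>\<^sup>+T. ennreal (3 * \<bar>w (x + T *\<^sub>R e)\<bar> / norm (x + T *\<^sub>R e)) * indicator {0..} T \<partial>lborel)
      + (\<integral>\<^sup>+T. ennreal (1 / norm x) * R x * indicator I T \<partial>lborel)"
      by (rule nn_integral_add) (simp_all add: I_def)
    also have "(\<integral>\<^sup>+T. ennreal (1 / norm x) * R x * indicator I T \<partial>lborel) = ennreal (1 / norm x) * R x * emeasure lborel I"
      by (rule nn_integral_cmult_indicator) (simp add: I_def)
    also have "\<dots> = (ennreal (1 / norm x) * emeasure lborel I) * R x" by (simp only: mult_ac)
    also have "\<dots> = R x" by (simp only: em mult_1)
    also have "(\<integral>\<^sup>+T. ennreal (3 * \<bar>w (x + T *\<^sub>R e)\<bar> / norm (x + T *\<^sub>R e)) * indicator {0..} T \<partial>lborel) + R x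
      = (\<integral>\<^sup>+t. ennreal (norm (k (x + t *\<^sub>R e)) + 3 * \<bar>w (x + t *\<^sub>R e)\<bar> / norm (x + t *\<^sub>R e)) * indicator {0..} t \<partial>lborel)"
      unfolding R_def by (subst nn_integral_add[symmetric]) (auto intro!: nn_integral_cong simp: indicator_def add.commute)
    finally show "ennreal \<bar>w x\<bar> \<le>
      (\<integral>\<^sup>+t. ennreal (norm (k (x + t *\<^sub>R e)) + 3 * \<bar>w (x + t *\<^sub>R e)\<bar> / norm (x + t *\<^sub>R e)) * indicator {0..} t \<partial>lborel)" .
  qed
qed

text \<open>At each nonzero x one of the directions b and -b recedes from the origin, and its
  half-line is part of the full line. Choosing that direction avoids integrating the derivative past
  the singularity.\<close>

lemma C1_limit_line_bound:
  fixes w :: "'a::euclidean_space \<Rightarrow> real"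
  assumes wk: "C1_limit w k"
  shows "AE x in lborel. \<forall>b\<in>Basis. ennreal \<bar>w x\<bar> \<le> line_int b (\<lambda>z. ennreal (norm (k z) + 3 * \<bar>w z\<bar> / norm z)) x"
proof -
  have [measurable]: "w \<in> borel_measurable borel" "k \<in> borel_measurable borel"
    using wk by (auto simp: C1_limit_def)
  define G where "G z = ennreal (norm (k z) + 3 * \<bar>w z\<bar> / norm z)" for z
  have [measurable]: "G \<in> borel_measurable borel" by (simp add: G_def[abs_def])
  have "AE x in lborel. ennreal \<bar>w x\<bar> \<le> line_int b G x" if b: "b \<in> Basis" for b
  proof -
    have n: "norm b = 1" "norm (- b) = 1" using b by auto
    have up: "(\<integral>\<^sup>+t. G (x + t *\<^sub>R b) * indicator {0..} t \<partial>lborel) \<le> line_int b G x" for x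
      unfolding line_int_def by (intro nn_integral_mono) (auto simp: indicator_def)
    have "(\<integral>\<^sup>+t. G (x + t *\<^sub>R (- b)) * indicator {0..} t \<partial>lborel) \<le> (\<integral>\<^sup>+t. G (x + (- t) *\<^sub>R b) \<partial>lborel)" for x
      by (intro nn_integral_mono) (auto simp: indicator_def)
    also have "(\<integral>\<^sup>+t. G (x + (- t) *\<^sub>R b) \<partial>lborel) = line_int b G x" for x
      unfolding line_int_def
      by (subst (2) nn_integral_real_affine[where c="-1" and t=0]) auto
    finally have dn: "(\<integral>\<^sup>+t. G (x + t *\<^sub>R (- b)) * indicator {0..} t \<partial>lborel) \<le> line_int b G x" for x .
    have "AE x::'a in lborel. x \<noteq> 0" by (rule AE_lborel_singleton)
    then show ?thesis
      using C1_limit_half_line_bound[OF wk n(1)] C1_limit_half_line_bound[OF wk n(2)]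
    proof (rule AE_mp[OF _ AE_mp[OF _ AE_mp]], intro AE_I2 impI)
      fix x :: 'a
      assume a: "x \<noteq> 0"
        "x \<noteq> 0 \<and> 0 \<le> x \<bullet> b \<longrightarrow> ennreal \<bar>w x\<bar> \<le>
          (\<integral>\<^sup>+t. ennreal (norm (k (x + t *\<^sub>R b)) + 3 * \<bar>w (x + t *\<^sub>R b)\<bar> / norm (x + t *\<^sub>R b)) * indicator {0..} t \<partial>lborel)"
        "x \<noteq> 0 \<and> 0 \<le> x \<bullet> (- b) \<longrightarrow> ennreal \<bar>w x\<bar> \<le>
          (\<integral>\<^sup>+t. ennreal (norm (k (x + t *\<^sub>R (- b))) + 3 * \<bar>w (x + t *\<^sub>R (- b))\<bar> / norm (x + t *\<^sub>R (- b))) * indicator {0..} t \<partial>lborel)"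
      show "ennreal \<bar>w x\<bar> \<le> line_int b G x"
      proof (cases "0 \<le> x \<bullet> b")
        case True
        then have "ennreal \<bar>w x\<bar> \<le> (\<integral>\<^sup>+t. G (x + t *\<^sub>R b) * indicator {0..} t \<partial>lborel)"
          using a(1,2) unfolding G_def by blast
        then show ?thesis using up by (rule order_trans)
      next
        case False
        then have "0 \<le> x \<bullet> (- b)" by simp
        then have "ennreal \<bar>w x\<bar> \<le> (\<integral>\<^sup>+t. G (x + t *\<^sub>R (- b)) * indicator {0..} t \<partial>lborel)"
          using a(1,3) unfolding G_def by blast
        then show ?thesis using dn by (rule order_trans)
      qed
    qed
  qed
  then have "AE x in lborel. \<forall>b\<in>Basis. ennreal \<bar>w x\<bar> \<le> line_int b G x"
    by (intro AE_finite_allI) auto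
  then show ?thesis unfolding G_def .
qed

text \<open>The chain rule asks for a bounded derivative, so the power is truncated at level n + 1.
  The resulting bound does not involve the level, and every value of u lies below some
  level.\<close>

lemma C1_limit_power_line_bound:
  fixes u :: "'a::euclidean_space \<Rightarrow> real"
  assumes ug: "C1_limit u g" and s: "1 \<le> s"
  shows "AE x in lborel. \<forall>b\<in>Basis. ennreal (norm x powr \<beta> * \<bar>u x\<bar> powr s) \<le>
    line_int b (\<lambda>z. ennreal (s * (norm z powr \<beta> * rpow \<bar>u z\<bar> (s - 1) * norm (g z)) +
      (\<bar>\<beta>\<bar> + 3) * (norm z powr (\<beta> - 1) * \<bar>u z\<bar> powr s))) x"
proof -
  define G where "G z = s * (norm z powr \<beta> * rpow \<bar>u z\<bar> (s - 1) * norm (g z)) +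
      (\<bar>\<beta>\<bar> + 3) * (norm z powr (\<beta> - 1) * \<bar>u z\<bar> powr s)" for z
  have "AE x in lborel. \<forall>b\<in>Basis. \<bar>u x\<bar> \<le> real (Suc n) \<longrightarrow>
     ennreal (norm x powr \<beta> * \<bar>u x\<bar> powr s) \<le> line_int b (\<lambda>z. ennreal (G z)) x" for n
  proof -
    obtain \<phi> \<phi>' B where \<phi>: "\<And>t. (\<phi> has_real_derivative \<phi>' t) (at t)" "\<And>t. \<bar>\<phi>' t\<bar> \<le> B"
      "uniformly_continuous_on UNIV \<phi>'" "\<And>t. \<bar>\<phi> t\<bar> \<le> \<bar>t\<bar> powr s"
      "\<And>t. \<bar>\<phi>' t\<bar> \<le> s * rpow \<bar>t\<bar> (s - 1)" "\<And>t. \<bar>t\<bar> \<le> real (Suc n) \<Longrightarrow> \<bar>\<phi> t\<bar> = \<bar>t\<bar> powr s"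
      by (rule truncated_power_exists[OF s of_nat_0_less_iff[THEN iffD2, OF zero_less_Suc[of n]]]) (rule that; assumption)
    define w where "w x = norm x powr \<beta> * \<phi> (u x)" for x
    define k where "k x = norm x powr \<beta> *\<^sub>R (\<phi>' (u x) *\<^sub>R g x) + (\<beta> * norm x powr (\<beta> - 2) * \<phi> (u x)) *\<^sub>R x" for x
    have wk: "C1_limit w k"
      unfolding w_def k_def by (rule C1_limit_weight[OF C1_limit_chain[OF ug \<phi>(1,2,3)]])
    \<comment> \<open>The factor |\<beta>| comes from differentiating the weight, the 3 from the
      averaged end point; both multiply the same term.\<close>
    have le: "norm (k z) + 3 * \<bar>w z\<bar> / norm z \<le> G z" for z
    proof (cases "z = 0")
      case True
      then show ?thesis using s by (simp add: k_def w_def G_def rpow_def)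
    next
      case False
      then have nz: "norm z > 0" by simp
      have p1: "norm z powr (\<beta> - 2) * norm z = norm z powr (\<beta> - 1)"
        using powr_add[of "norm z" "\<beta> - 2" 1] nz by simp
      have p2: "norm z powr \<beta> / norm z = norm z powr (\<beta> - 1)"
        using nz by (simp add: powr_diff)
      have "norm (k z) \<le> norm z powr \<beta> * \<bar>\<phi>' (u z)\<bar> * norm (g z) + \<bar>\<beta>\<bar> * (norm z powr (\<beta> - 2) * norm z) * \<bar>\<phi> (u z)\<bar>"
        unfolding k_def by (rule order_trans[OF norm_triangle_ineq]) (simp add: abs_mult mult_ac)
      also have "\<dots> \<le> norm z powr \<beta> * (s * rpow \<bar>u z\<bar> (s - 1)) * norm (g z) + \<bar>\<beta>\<bar> * norm z powr (\<beta> - 1) * \<bar>u z\<bar> powr s"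
        unfolding p1 by (intro add_mono mult_right_mono mult_left_mono \<phi>) auto
      finally have k: "norm (k z) \<le> norm z powr \<beta> * (s * rpow \<bar>u z\<bar> (s - 1)) * norm (g z) + \<bar>\<beta>\<bar> * norm z powr (\<beta> - 1) * \<bar>u z\<bar> powr s" .
      have "3 * \<bar>w z\<bar> / norm z = 3 * (norm z powr \<beta> / norm z) * \<bar>\<phi> (u z)\<bar>"
        by (simp add: w_def abs_mult)
      also have "\<dots> \<le> 3 * norm z powr (\<beta> - 1) * \<bar>u z\<bar> powr s"
        unfolding p2 by (intro mult_left_mono \<phi>) auto
      finally show ?thesis using k unfolding G_def by (simp add: algebra_simps)
    qed
    show ?thesis
      using C1_limit_line_bound[OF wk]
    proof (rule AE_mp, intro AE_I2 impI ballI)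
      fix x b :: 'a
      assume *: "\<forall>b\<in>Basis. ennreal \<bar>w x\<bar> \<le> line_int b (\<lambda>z. ennreal (norm (k z) + 3 * \<bar>w z\<bar> / norm z)) x"
      assume b: "b \<in> Basis" and ux: "\<bar>u x\<bar> \<le> real (Suc n)"
      have "ennreal (norm x powr \<beta> * \<bar>u x\<bar> powr s) = ennreal \<bar>w x\<bar>"
        using \<phi>(6)[OF ux] by (simp add: w_def abs_mult)
      also have "\<dots> \<le> line_int b (\<lambda>z. ennreal (norm (k z) + 3 * \<bar>w z\<bar> / norm z)) x"
        using * b by blast
      also have "\<dots> \<le> line_int b (\<lambda>z. ennreal (G z)) x"
        by (intro line_int_mono ennreal_leI le)
      finally show "ennreal (norm x powr \<beta> * \<bar>u x\<bar> powr s) \<le> line_int b (\<lambda>z. ennreal (G z)) x" .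
    qed
  qed
  then have "AE x in lborel. \<forall>n. \<forall>b\<in>Basis. \<bar>u x\<bar> \<le> real (Suc n) \<longrightarrow>
     ennreal (norm x powr \<beta> * \<bar>u x\<bar> powr s) \<le> line_int b (\<lambda>z. ennreal (G z)) x"
    unfolding AE_all_countable by blast
  then have "AE x in lborel. \<forall>b\<in>Basis. ennreal (norm x powr \<beta> * \<bar>u x\<bar> powr s) \<le> line_int b (\<lambda>z. ennreal (G z)) x"
  proof (rule AE_mp, intro AE_I2 impI ballI)
    fix x b :: 'a
    assume *: "\<forall>n. \<forall>b\<in>Basis. \<bar>u x\<bar> \<le> real (Suc n) \<longrightarrow>
     ennreal (norm x powr \<beta> * \<bar>u x\<bar> powr s) \<le> line_int b (\<lambda>z. ennreal (G z)) x" and b: "b \<in> Basis"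
    obtain n where "\<bar>u x\<bar> \<le> real n" by (meson real_arch_simple)
    then have "\<bar>u x\<bar> \<le> real (Suc n)" by simp
    then show "ennreal (norm x powr \<beta> * \<bar>u x\<bar> powr s) \<le> line_int b (\<lambda>z. ennreal (G z)) x"
      using * b by blast
  qed
  then show ?thesis unfolding G_def .
qed

subsection \<open>Propagation of exponents\<close>

lemma powr_tendsto_exponent:
  fixes z :: real
  assumes "0 \<le> z" "(f \<longlongrightarrow> a) F"
  shows "((\<lambda>n. z powr f n) \<longlongrightarrow> z powr a) F"
  using assms by (cases "z = 0") (auto intro!: tendsto_powr tendsto_const)

context
  fixes M :: "'a measure" and U :: "'a \<Rightarrow> real"
  assumes U [measurable]: "U \<in> borel_measurable M" and U0: "\<And>x. 0 \<le> U x"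
begin

lemma nn_integral_powr_interpolate:
  assumes "0 < r" "0 < s" "0 \<le> \<theta>" "\<theta> \<le> 1"
  shows "(\<integral>\<^sup>+x. ennreal (U x powr (\<theta> * r + (1 - \<theta>) * s)) \<partial>M) \<le>
    epow (\<integral>\<^sup>+x. ennreal (U x powr r) \<partial>M) \<theta> * epow (\<integral>\<^sup>+x. ennreal (U x powr s) \<partial>M) (1 - \<theta>)"
proof -
  have "ennreal (U x powr (\<theta> * r + (1 - \<theta>) * s)) \<le> epow (ennreal (U x powr r)) \<theta> * epow (ennreal (U x powr s)) (1 - \<theta>)" for x
  proof (cases "U x = 0")
    case False
    then have "U x > 0" using U0[of x] by simp
    then show ?thesis
      by (simp add: epow_ennreal powr_powr powr_add ennreal_mult[symmetric] mult.commute)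
  qed simp
  then have "(\<integral>\<^sup>+x. ennreal (U x powr (\<theta> * r + (1 - \<theta>) * s)) \<partial>M) \<le>
    (\<integral>\<^sup>+x. epow (ennreal (U x powr r)) \<theta> * epow (ennreal (U x powr s)) (1 - \<theta>) \<partial>M)"
    by (rule nn_integral_mono)
  also have "\<dots> \<le> epow (\<integral>\<^sup>+x. ennreal (U x powr r) \<partial>M) \<theta> * epow (\<integral>\<^sup>+x. ennreal (U x powr s) \<partial>M) (1 - \<theta>)"
    using assms by (intro nn_integral_Holder) auto
  finally show ?thesis .
qed

text \<open>Bounds Z^r with one and the same Z are stable under interpolation: Z^(\<theta>r) * Z^((1
  - \<theta>)s) is Z to the interpolated exponent.\<close>

lemma nn_integral_powr_bound_interpolate:
  assumes "0 < r" "r \<le> x" "x \<le> s"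
    and "(\<integral>\<^sup>+x. ennreal (U x powr r) \<partial>M) \<le> epow Z r" "(\<integral>\<^sup>+x. ennreal (U x powr s) \<partial>M) \<le> epow Z s"
  shows "(\<integral>\<^sup>+y. ennreal (U y powr x) \<partial>M) \<le> epow Z x"
proof (cases "r = s")
  case True
  then show ?thesis using assms by simp
next
  case False
  define \<theta> where "\<theta> = (s - x) / (s - r)"
  have \<theta>: "0 \<le> \<theta>" "\<theta> \<le> 1" using assms False by (auto simp: \<theta>_def field_simps)
  have "\<theta> * (s - r) = s - x" using False by (simp add: \<theta>_def)
  then have x: "x = \<theta> * r + (1 - \<theta>) * s" by (simp add: algebra_simps)
  have "(\<integral>\<^sup>+y. ennreal (U y powr x) \<partial>M) \<le> epow (\<integral>\<^sup>+x. ennreal (U x powr r) \<partial>M) \<theta> * epow (\<integral>\<^sup>+x. ennreal (U x powr s) \<partial>M) (1 - \<theta>)"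
    unfolding x using assms \<theta> by (intro nn_integral_powr_interpolate) auto
  also have "\<dots> \<le> epow (epow Z r) \<theta> * epow (epow Z s) (1 - \<theta>)"
    using assms \<theta> by (intro mult_mono epow_mono) auto
  also have "\<dots> = epow Z (r * \<theta> + s * (1 - \<theta>))"
    using assms \<theta> by (simp add: epow_epow epow_add)
  finally show ?thesis by (simp add: x mult.commute)
qed

text \<open>Fatou along the exponents \<open>f n\<close>. The base Z is fixed and finite, so the
  right-hand sides converge to the value at the limit exponent.\<close>

lemma nn_integral_powr_bound_limit:
  assumes f: "f \<longlonglongrightarrow> x" "\<And>n. 0 < f n" "0 < x" and Z: "Z < \<infinity>"
    and bd: "\<And>n. (\<integral>\<^sup>+y. ennreal (U y powr f n) \<partial>M) \<le> epow Z (f n)"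
  shows "(\<integral>\<^sup>+y. ennreal (U y powr x) \<partial>M) \<le> epow Z x"
proof -
  obtain z where z: "Z = ennreal z" "0 \<le> z" using Z by (cases Z) auto
  have Zf: "epow Z t = ennreal (z powr t)" if "0 < t" for t
    using that z by (simp add: epow_ennreal)
  have "(\<lambda>n. ennreal (z powr f n)) \<longlonglongrightarrow> ennreal (z powr x)"
    by (intro tendsto_ennrealI powr_tendsto_exponent z f)
  then have lim: "liminf (\<lambda>n. epow Z (f n)) = epow Z x"
    using f(2,3) by (simp add: Zf lim_imp_Liminf)
  have "liminf (\<lambda>n. ennreal (U y powr f n)) = ennreal (U y powr x)" for y
    by (intro lim_imp_Liminf tendsto_ennrealI powr_tendsto_exponent U0 f) simp
  then have "(\<integral>\<^sup>+y. ennreal (U y powr x) \<partial>M) = (\<integral>\<^sup>+y. liminf (\<lambda>n. ennreal (U y powr f n)) \<partial>M)"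
    by simp
  also have "\<dots> \<le> liminf (\<lambda>n. \<integral>\<^sup>+y. ennreal (U y powr f n) \<partial>M)"
    by (rule nn_integral_liminf) simp
  also have "\<dots> \<le> liminf (\<lambda>n. epow Z (f n))"
    by (intro Liminf_mono always_eventually allI bd)
  finally show ?thesis by (simp add: lim)
qed

text \<open>The exponent s is chosen such that U^(s-1) = (U^r)^(1-1/p); Hoelder against V or U in
  L^p then leaves the same power of \<integral> U^r in both terms. \<open>rpow\<close> keeps U^(s-1)
  = 1 for p = 1 also where U vanishes.\<close>

lemma nn_integral_powr_step:
  fixes V :: "'a \<Rightarrow> real"
  assumes V [measurable]: "V \<in> borel_measurable M" and V0: "\<And>x. 0 \<le> V x"
    and p: "1 \<le> p" and r: "0 < r" and ab: "0 \<le> a" "0 \<le> b"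
  defines "s \<equiv> 1 + r * (1 - 1/p)"
  shows "(\<integral>\<^sup>+x. ennreal (a * (rpow (U x) (s - 1) * V x) + b * U x powr s) \<partial>M) \<le>
    (ennreal a * epow (\<integral>\<^sup>+x. ennreal (V x powr p) \<partial>M) (1/p) + ennreal b * epow (\<integral>\<^sup>+x. ennreal (U x powr p) \<partial>M) (1/p))
     * epow (\<integral>\<^sup>+x. ennreal (U x powr r) \<partial>M) (1 - 1/p)"
proof -
  have [measurable]: "(\<lambda>x. rpow (U x) t) \<in> borel_measurable M" for t
    unfolding rpow_def by (cases "t = 0") simp_all
  have rp: "ennreal (rpow (U x) (s - 1)) = epow (ennreal (U x powr r)) (1 - 1/p)" for x
  proof (cases "p = 1")
    case True
    then show ?thesis by (simp add: s_def rpow_def)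
  next
    case False
    then have "1 - 1/p \<noteq> 0" using p by simp
    then show ?thesis using r by (simp add: s_def rpow_def epow_ennreal powr_powr)
  qed
  have Us: "U x powr s = rpow (U x) (s - 1) * U x" for x
    using U0[of x] powr_add[of "U x" "s - 1" 1] by (cases "U x = 0") (auto simp: rpow_def)
  have H: "(\<integral>\<^sup>+x. ennreal (rpow (U x) (s - 1) * Y x) \<partial>M) \<le>
      epow (\<integral>\<^sup>+x. ennreal (Y x powr p) \<partial>M) (1/p) * epow (\<integral>\<^sup>+x. ennreal (U x powr r) \<partial>M) (1 - 1/p)"
    if [measurable]: "Y \<in> borel_measurable M" and Y: "\<And>x. 0 \<le> Y x" for Y :: "'a \<Rightarrow> real"
  proof -
    have "ennreal (rpow (U x) (s - 1) * Y x) = epow (ennreal (Y x powr p)) (1/p) * epow (ennreal (U x powr r)) (1 - 1/p)" for x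
    proof -
      have "epow (ennreal (Y x powr p)) (1/p) = ennreal (Y x)"
        using p Y[of x] by (simp add: epow_ennreal powr_powr)
      then show ?thesis using Y[of x] by (simp add: rp[symmetric] ennreal_mult' mult.commute)
    qed
    then show ?thesis using p by (simp only:) (intro nn_integral_Holder, auto)
  qed
  have "(\<integral>\<^sup>+x. ennreal (a * (rpow (U x) (s - 1) * V x) + b * U x powr s) \<partial>M) =
    (\<integral>\<^sup>+x. ennreal a * ennreal (rpow (U x) (s - 1) * V x) + ennreal b * ennreal (rpow (U x) (s - 1) * U x) \<partial>M)"
  proof (rule nn_integral_cong)
    fix x
    have "0 \<le> rpow (U x) (s - 1)" by (simp add: rpow_def)
    then show "ennreal (a * (rpow (U x) (s - 1) * V x) + b * U x powr s) =
      ennreal a * ennreal (rpow (U x) (s - 1) * V x) + ennreal b * ennreal (rpow (U x) (s - 1) * U x)"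
      unfolding Us using ab V0[of x] U0[of x]
      by (simp add: ennreal_mult[symmetric] ennreal_plus[symmetric] del: ennreal_plus)
  qed
  also have "\<dots> = ennreal a * (\<integral>\<^sup>+x. ennreal (rpow (U x) (s - 1) * V x) \<partial>M) + ennreal b * (\<integral>\<^sup>+x. ennreal (rpow (U x) (s - 1) * U x) \<partial>M)"
    by (simp add: nn_integral_add nn_integral_cmult)
  also have "\<dots> \<le> ennreal a * (epow (\<integral>\<^sup>+x. ennreal (V x powr p) \<partial>M) (1/p) * epow (\<integral>\<^sup>+x. ennreal (U x powr r) \<partial>M) (1 - 1/p))
    + ennreal b * (epow (\<integral>\<^sup>+x. ennreal (U x powr p) \<partial>M) (1/p) * epow (\<integral>\<^sup>+x. ennreal (U x powr r) \<partial>M) (1 - 1/p))"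
    by (intro add_mono mult_left_mono H V V0 U U0) auto
  finally show ?thesis by (simp add: distrib_right mult.assoc)
qed

end

text \<open>Continuity method: the supremum of the admissible points up to r is admissible by
  closedness. If it were below r, a step would lead beyond it, and interpolation brings back a step
  that overshoots r.\<close>

lemma real_interval_continuation:
  fixes P :: "real \<Rightarrow> bool"
  assumes pr: "p \<le> r" "P p"
    and closed: "\<And>f x. (\<And>n. p \<le> f n) \<Longrightarrow> (\<And>n. P (f n)) \<Longrightarrow> f \<longlonglongrightarrow> x \<Longrightarrow> P x"
    and step: "\<And>x. p \<le> x \<Longrightarrow> x < r \<Longrightarrow> P x \<Longrightarrow> \<exists>y>x. P y"
    and interp: "\<And>x y z. p \<le> x \<Longrightarrow> x \<le> z \<Longrightarrow> z \<le> y \<Longrightarrow> P x \<Longrightarrow> P y \<Longrightarrow> P z"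
  shows "P r"
proof -
  define S where "S = {x \<in> {p..r}. P x}"
  have S: "p \<in> S" "bdd_above S" using pr by (auto simp: S_def bdd_above_def)
  have "closed S"
    unfolding closed_sequential_limits
  proof (intro allI impI, elim conjE)
    fix f l assume f: "\<forall>n. f n \<in> S" "f \<longlonglongrightarrow> l"
    then have "l \<in> {p..r}"
      by (intro closed_sequentially[OF closed_atLeastAtMost[of p r] _ f(2)]) (auto simp: S_def)
    moreover have "p \<le> f n" "P (f n)" for n using f(1) by (auto simp: S_def)
    then have "P l" using f(2) by (rule closed)
    ultimately show "l \<in> S" by (simp add: S_def)
  qed
  then have Sup: "Sup S \<in> S" using S by (intro closed_contains_Sup) auto
  show ?thesis
  proof (cases "Sup S < r")
    case True
    then obtain y where y: "y > Sup S" "P y" using step[of "Sup S"] Sup by (auto simp: S_def)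
    define z where "z = min y r"
    have "P z" using Sup y True interp[of "Sup S" z y] by (auto simp: S_def z_def)
    moreover have "z \<in> {p..r}" "z > Sup S" using Sup y True by (auto simp: S_def z_def)
    ultimately have "z \<in> S" by (simp add: S_def)
    then have "z \<le> Sup S" using S(2) by (rule cSup_upper)
    then show ?thesis using \<open>z > Sup S\<close> by simp
  next
    case False
    then have "Sup S = r" using Sup by (auto simp: S_def)
    then show ?thesis using Sup by (simp add: S_def)
  qed
qed

section \<open>The line bound in dilation invariant form\<close>

lemma line_int_dim_1:
  fixes G :: "'a::euclidean_space \<Rightarrow> ennreal"
  assumes "DIM('a) = 1" "b \<in> Basis" "G \<in> borel_measurable borel"
  shows "line_int b G x = (\<integral>\<^sup>+y. G y \<partial>lborel)"
proof -
  obtain c where c: "(Basis :: 'a set) = {c}" using assms(1) by (rule card_1_singletonE)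
  have "b = c" using assms(2) unfolding c by simp
  then have "(Basis :: 'a set) = {b}" using c by simp
  then show ?thesis using lines_int_Basis[OF assms(3), of "[b]" x] by simp
qed

context
  fixes u :: "'a::euclidean_space \<Rightarrow> real" and g :: "'a \<Rightarrow> 'a" and \<kappa> s \<beta> :: real
    and U V :: "'a \<Rightarrow> real" and I :: ennreal
  assumes ug: "C1_limit u g" and s: "1 \<le> s"
  defines "\<beta> \<equiv> s * \<kappa> - (real DIM('a) - 1)"
    and "U \<equiv> \<lambda>x. norm x powr \<kappa> * \<bar>u x\<bar>"
    and "V \<equiv> \<lambda>x. norm x powr (\<kappa> + 1) * norm (g x)"
    and "I \<equiv> \<integral>\<^sup>+x. ennreal (s * (rpow (norm x powr \<kappa> * \<bar>u x\<bar>) (s - 1) * (norm x powr (\<kappa> + 1) * norm (g x)))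
      + (\<bar>s * \<kappa> - (real DIM('a) - 1)\<bar> + 3) * (norm x powr \<kappa> * \<bar>u x\<bar>) powr s) \<partial>dilation_measure"
begin

text \<open>Homogeneity dictates \<beta>: since -N + \<kappa>(s - 1) + (\<kappa> + 1) = \<beta> and
  -N + \<kappa>s = \<beta> - 1, both terms of the line integrand are |z|^-N times expressions in U
  and V.\<close>

lemma weighted_line_integrand:
  "(\<integral>\<^sup>+z. ennreal (s * (norm z powr \<beta> * rpow \<bar>u z\<bar> (s - 1) * norm (g z)) +
      (\<bar>\<beta>\<bar> + 3) * (norm z powr (\<beta> - 1) * \<bar>u z\<bar> powr s)) \<partial>lborel) = I"
proof -
  have [measurable]: "u \<in> borel_measurable borel" "g \<in> borel_measurable borel"
    using ug by (auto simp: C1_limit_def)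
  have [measurable]: "(\<lambda>x. rpow (f x) t) \<in> borel_measurable borel" if [measurable]: "f \<in> borel_measurable borel" for f :: "'a \<Rightarrow> real" and t
    unfolding rpow_def by (cases "t = 0") simp_all
  have "I = (\<integral>\<^sup>+z. ennreal (norm z powr (- real DIM('a))) * ennreal (s * (rpow (U z) (s - 1) * V z) + (\<bar>\<beta>\<bar> + 3) * U z powr s) \<partial>lborel)"
    unfolding I_def U_def V_def \<beta>_def by (rule nn_integral_dilation_measure) measurable
  also have "\<dots> = (\<integral>\<^sup>+z. ennreal (s * (norm z powr \<beta> * rpow \<bar>u z\<bar> (s - 1) * norm (g z)) +
      (\<bar>\<beta>\<bar> + 3) * (norm z powr (\<beta> - 1) * \<bar>u z\<bar> powr s)) \<partial>lborel)"
  proof (rule nn_integral_cong_AE, rule AE_mp[OF AE_lborel_singleton[of 0]], intro AE_I2 impI)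
    fix z :: 'a assume "z \<noteq> 0"
    then have nz: "norm z > 0" by simp
    have b1: "- real DIM('a) + (\<kappa> * (s - 1) + (\<kappa> + 1)) = \<beta>" "- real DIM('a) + \<kappa> * s = \<beta> - 1"
      by (simp_all add: \<beta>_def algebra_simps)
    have "rpow (U z) (s - 1) = norm z powr (\<kappa> * (s - 1)) * rpow \<bar>u z\<bar> (s - 1)"
      using nz by (simp add: rpow_def U_def powr_mult powr_powr)
    then have "norm z powr (- real DIM('a)) * (rpow (U z) (s - 1) * V z) =
       (norm z powr (- real DIM('a)) * (norm z powr (\<kappa> * (s - 1)) * norm z powr (\<kappa> + 1))) * (rpow \<bar>u z\<bar> (s - 1) * norm (g z))"
      by (simp add: V_def mult_ac)
    also have "norm z powr (- real DIM('a)) * (norm z powr (\<kappa> * (s - 1)) * norm z powr (\<kappa> + 1)) = norm z powr \<beta>"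
      unfolding powr_add[symmetric] b1 ..
    finally have e1: "norm z powr (- real DIM('a)) * (rpow (U z) (s - 1) * V z) = norm z powr \<beta> * rpow \<bar>u z\<bar> (s - 1) * norm (g z)"
      by (simp add: mult_ac)
    have "norm z powr (- real DIM('a)) * U z powr s = norm z powr (- real DIM('a)) * norm z powr (\<kappa> * s) * \<bar>u z\<bar> powr s"
      by (simp add: U_def powr_mult powr_powr)
    also have "norm z powr (- real DIM('a)) * norm z powr (\<kappa> * s) = norm z powr (\<beta> - 1)"
      unfolding powr_add[symmetric] b1 ..
    finally have e2: "norm z powr (- real DIM('a)) * U z powr s = norm z powr (\<beta> - 1) * \<bar>u z\<bar> powr s" .
    have "norm z powr (- real DIM('a)) * (s * (rpow (U z) (s - 1) * V z) + (\<bar>\<beta>\<bar> + 3) * U z powr s)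
      = s * (norm z powr (- real DIM('a)) * (rpow (U z) (s - 1) * V z)) + (\<bar>\<beta>\<bar> + 3) * (norm z powr (- real DIM('a)) * U z powr s)"
      by (simp add: algebra_simps)
    also have "\<dots> = s * (norm z powr \<beta> * rpow \<bar>u z\<bar> (s - 1) * norm (g z)) + (\<bar>\<beta>\<bar> + 3) * (norm z powr (\<beta> - 1) * \<bar>u z\<bar> powr s)"
      unfolding e1 e2 ..
    finally show "ennreal (norm z powr (- real DIM('a))) * ennreal (s * (rpow (U z) (s - 1) * V z) + (\<bar>\<beta>\<bar> + 3) * U z powr s) =
      ennreal (s * (norm z powr \<beta> * rpow \<bar>u z\<bar> (s - 1) * norm (g z)) + (\<bar>\<beta>\<bar> + 3) * (norm z powr (\<beta> - 1) * \<bar>u z\<bar> powr s))"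
      by (simp only: ennreal_mult'[symmetric] powr_ge_zero)
  qed
  finally show ?thesis ..
qed

lemma weighted_integrand_measurable:
  "(\<lambda>z. ennreal (s * (norm z powr \<beta> * rpow \<bar>u z\<bar> (s - 1) * norm (g z)) +
      (\<bar>\<beta>\<bar> + 3) * (norm z powr (\<beta> - 1) * \<bar>u z\<bar> powr s))) \<in> borel_measurable borel"
proof -
  have [measurable]: "u \<in> borel_measurable borel" "g \<in> borel_measurable borel"
    using ug by (auto simp: C1_limit_def)
  have [measurable]: "(\<lambda>x. rpow \<bar>u x\<bar> t) \<in> borel_measurable borel" for t
    unfolding rpow_def by (cases "t = 0") simp_all
  show ?thesis by measurable
qed

text \<open>With \<nu> = N/(N - 1) the same \<beta> satisfies \<beta>\<nu> = -N + \<kappa>\<nu>s;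
  hence the power \<nu> of the left-hand side of the line bound is |x|^-N U^(\<nu>s).\<close>

lemma weighted_Gagliardo:
  assumes dim: "DIM('a) \<ge> 2"
  shows "(\<integral>\<^sup>+x. ennreal (U x powr (real DIM('a) / (real DIM('a) - 1) * s)) \<partial>dilation_measure) \<le>
    epow I (real DIM('a) / (real DIM('a) - 1))"
proof -
  have [measurable]: "u \<in> borel_measurable borel" "g \<in> borel_measurable borel"
    using ug by (auto simp: C1_limit_def)
  define \<nu> where "\<nu> = real DIM('a) / (real DIM('a) - 1)"
  have \<nu>: "\<nu> > 0" using dim by (simp add: \<nu>_def)
  have e: "\<beta> * \<nu> = - real DIM('a) + \<kappa> * (\<nu> * s)"
  proof -
    have "(real DIM('a) - 1) * \<nu> = real DIM('a)" using dim by (simp add: \<nu>_def)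
    then show ?thesis by (simp add: \<beta>_def algebra_simps)
  qed
  have "(\<integral>\<^sup>+x. ennreal (U x powr (\<nu> * s)) \<partial>dilation_measure) =
    (\<integral>\<^sup>+x. ennreal (norm x powr (- real DIM('a))) * ennreal (U x powr (\<nu> * s)) \<partial>lborel)"
    unfolding U_def by (rule nn_integral_dilation_measure) measurable
  also have "\<dots> = (\<integral>\<^sup>+x. epow (ennreal (norm x powr \<beta> * \<bar>u x\<bar> powr s)) \<nu> \<partial>lborel)"
  proof (rule nn_integral_cong)
    fix x :: 'a
    have "epow (ennreal (norm x powr \<beta> * \<bar>u x\<bar> powr s)) \<nu> = ennreal (norm x powr (\<beta> * \<nu>) * \<bar>u x\<bar> powr (\<nu> * s))"
      using \<nu> by (simp add: epow_ennreal powr_mult powr_powr mult.commute)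
    also have "\<dots> = ennreal (norm x powr (- real DIM('a)) * (norm x powr (\<kappa> * (\<nu> * s)) * \<bar>u x\<bar> powr (\<nu> * s)))"
      unfolding e powr_add by (simp add: mult.assoc)
    also have "\<dots> = ennreal (norm x powr (- real DIM('a))) * ennreal (U x powr (\<nu> * s))"
      by (simp add: U_def powr_mult powr_powr ennreal_mult)
    finally show "ennreal (norm x powr (- real DIM('a))) * ennreal (U x powr (\<nu> * s)) =
      epow (ennreal (norm x powr \<beta> * \<bar>u x\<bar> powr s)) \<nu>" ..
  qed
  also have "\<dots> \<le> epow I \<nu>"
    unfolding weighted_line_integrand[symmetric] \<nu>_def
    by (rule nn_integral_Gagliardo[OF weighted_integrand_measurable dim C1_limit_power_line_bound[OF ug s]])
  finally show ?thesis by (simp add: \<nu>_def)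
qed

text \<open>In dimension one a line is the whole space, so every line integral equals
  \<open>I\<close>, and \<beta> = s\<kappa> makes the left-hand side of the line bound U^s.\<close>

lemma weighted_sup_bound:
  assumes dim: "DIM('a) = 1"
  shows "AE x in dilation_measure. ennreal (U x powr s) \<le> I"
proof (rule AE_dilation_measure, rule AE_mp[OF C1_limit_power_line_bound[OF ug s, of \<beta>]], intro AE_I2 impI)
  fix x
  assume *: "\<forall>b\<in>Basis. ennreal (norm x powr \<beta> * \<bar>u x\<bar> powr s) \<le>
    line_int b (\<lambda>z. ennreal (s * (norm z powr \<beta> * rpow \<bar>u z\<bar> (s - 1) * norm (g z)) +
      (\<bar>\<beta>\<bar> + 3) * (norm z powr (\<beta> - 1) * \<bar>u z\<bar> powr s))) x"
  obtain b :: 'a where b: "b \<in> Basis" using nonempty_Basis by blast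
  have "U x powr s = norm x powr \<beta> * \<bar>u x\<bar> powr s"
    by (simp add: U_def \<beta>_def dim powr_mult powr_powr mult.commute)
  then show "ennreal (U x powr s) \<le> I"
    using *[rule_format, OF b] by (simp only: line_int_dim_1[OF dim b weighted_integrand_measurable] weighted_line_integrand)
qed

end

subsection \<open>Weighted Sobolev inequality\<close>

text \<open>The exponent r stands on both sides because bounds (C e)^t are propagated in t with C e
  fixed; roots are taken at the very end.\<close>

lemma weighted_Sobolev:
  fixes \<kappa> p q r :: real
  assumes p: "1 \<le> p" and q: "1 \<le> q" and \<kappa>: "\<kappa> \<noteq> 0" and pr: "p \<le> r"
    and crit: "p < real DIM('a::euclidean_space) \<Longrightarrow> r \<le> real DIM('a) * p / (real DIM('a) - p)"
  shows "\<exists>C>0. \<forall>(u :: 'a \<Rightarrow> real) g. C1_limit u g \<longrightarrow>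
    (\<integral>\<^sup>+x. ennreal ((norm x powr \<kappa> * \<bar>u x\<bar>) powr q) \<partial>dilation_measure) < \<infinity> \<longrightarrow>
    (\<integral>\<^sup>+x. ennreal ((norm x powr (\<kappa> + 1) * norm (g x)) powr p) \<partial>dilation_measure) < \<infinity> \<longrightarrow>
    (\<integral>\<^sup>+x. ennreal ((norm x powr \<kappa> * \<bar>u x\<bar>) powr r) \<partial>dilation_measure) \<le>
      epow (ennreal C * epow (\<integral>\<^sup>+x. ennreal ((norm x powr (\<kappa> + 1) * norm (g x)) powr p) \<partial>dilation_measure) (1/p)) r"
proof -
  define N where "N = real DIM('a)"
  have N: "N \<ge> 1" using DIM_positive[where 'a='a] by (simp add: N_def Suc_leI del: DIM_positive)
  define W where "W = (\<integral>\<^sup>+\<tau>. ennreal (\<tau> powr (- \<kappa> - 1)) * indicator (ray_set \<kappa>) \<tau> \<partial>lborel)"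
  obtain \<omega> where \<omega>: "W = ennreal \<omega>" "0 \<le> \<omega>"
    using ray_weight_finite[OF \<kappa>] unfolding W_def[symmetric] by (cases W) auto
  \<comment> \<open>Bounds s + (|s\<kappa> - (N - 1)| + 3)\<omega> for all s in [1, 1 + r]. The last
    summand ensures \<omega> \<le> C, so that Hardy's inequality provides the starting point t =
    p.\<close>
  define C where "C = (1 + r) + ((1 + r) * \<bar>\<kappa>\<bar> + N + 3) * \<omega> + \<omega>"
  have C: "0 < C" "\<omega> \<le> C" using \<omega> p pr N by (auto simp: C_def intro!: add_pos_nonneg)
  have Cs: "s + (\<bar>s * \<kappa> - (N - 1)\<bar> + 3) * \<omega> \<le> C" if s: "1 \<le> s" "s \<le> 1 + r" for s
  proof -
    have "\<bar>s * \<kappa> - (N - 1)\<bar> \<le> \<bar>s * \<kappa>\<bar> + \<bar>N - 1\<bar>" by (rule abs_triangle_ineq4)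
    also have "\<dots> \<le> (1 + r) * \<bar>\<kappa>\<bar> + N" using s N by (simp add: abs_mult add_mono mult_right_mono)
    finally have "(\<bar>s * \<kappa> - (N - 1)\<bar> + 3) * \<omega> \<le> ((1 + r) * \<bar>\<kappa>\<bar> + N + 3) * \<omega>"
      using \<omega> by (intro mult_right_mono) auto
    then show ?thesis using s \<omega> by (simp add: C_def)
  qed
  have main: "(\<integral>\<^sup>+x. ennreal ((norm x powr \<kappa> * \<bar>u x\<bar>) powr r) \<partial>dilation_measure) \<le>
      epow (ennreal C * epow (\<integral>\<^sup>+x. ennreal ((norm x powr (\<kappa> + 1) * norm (g x)) powr p) \<partial>dilation_measure) (1/p)) r"
    if ug: "C1_limit u g"
      and Jq: "(\<integral>\<^sup>+x. ennreal ((norm x powr \<kappa> * \<bar>u x\<bar>) powr q) \<partial>dilation_measure) < \<infinity>"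
      and Ef: "(\<integral>\<^sup>+x. ennreal ((norm x powr (\<kappa> + 1) * norm (g x)) powr p) \<partial>dilation_measure) < \<infinity>"
    for u :: "'a \<Rightarrow> real" and g
  proof -
    have [measurable]: "u \<in> borel_measurable borel" "g \<in> borel_measurable borel"
      using ug by (auto simp: C1_limit_def)
    define U where "U x = norm x powr \<kappa> * \<bar>u x\<bar>" for x
    define V where "V x = norm x powr (\<kappa> + 1) * norm (g x)" for x
    have Um: "U \<in> borel_measurable dilation_measure" and Vm: "V \<in> borel_measurable dilation_measure"
      by (auto simp: U_def[abs_def] V_def[abs_def])
    have U0: "0 \<le> U x" and V0: "0 \<le> V x" for x by (simp_all add: U_def V_def)
    define J where "J t = (\<integral>\<^sup>+x. ennreal (U x powr t) \<partial>dilation_measure)" for t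
    define E where "E = (\<integral>\<^sup>+x. ennreal (V x powr p) \<partial>dilation_measure)"
    define e where "e = epow E (1/p)"
    have "E < \<infinity>" using Ef by (simp add: E_def V_def)
    then have e: "e < \<infinity>" using p by (auto simp: e_def epow_def)
    define Z where "Z = ennreal C * e"
    have Z: "Z < \<infinity>" using e by (simp add: Z_def ennreal_mult_less_top)
    have ee: "epow e p = E" using p by (simp add: e_def epow_epow)
    have Jp: "J p \<le> epow (ennreal \<omega> * e) p"
      using C1_limit_Hardy[OF ug q p \<kappa> Jq] p
      unfolding W_def[symmetric] \<omega>(1) by (simp add: J_def U_def V_def E_def epow_mult ee[unfolded E_def V_def])
    have JpZ: "J p \<le> epow Z p"
      using Jp by (rule order_trans) (use p C \<omega> in \<open>auto simp: Z_def intro!: epow_mono mult_right_mono ennreal_leI\<close>)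
    have Jp': "epow (J p) (1/p) \<le> ennreal \<omega> * e"
      using epow_mono[OF Jp, of "1/p"] p by (simp add: epow_epow)
    define I where "I s = (\<integral>\<^sup>+x. ennreal (s * (rpow (U x) (s - 1) * V x) + (\<bar>s * \<kappa> - (N - 1)\<bar> + 3) * U x powr s) \<partial>dilation_measure)" for s
    have I: "I (1 + t * (1 - 1/p)) \<le> epow Z (1 + t * (1 - 1/p))" if t: "p \<le> t" "t \<le> r" "J t \<le> epow Z t" for t
    proof -
      define s where "s = 1 + t * (1 - 1/p)"
      have "0 \<le> t * (1 - 1/p)" "t * (1 - 1/p) \<le> t * 1" using t p by (intro mult_nonneg_nonneg mult_left_mono; simp)+
      \<comment> \<open>Since t \<le> r and 1 - 1/p \<le> 1, the exponent s stays in the range for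
        which \<open>C\<close> was chosen.\<close>
      then have s: "1 \<le> s" "s \<le> 1 + r" using t(2) by (auto simp: s_def)
      have "I s \<le> (ennreal s * e + ennreal (\<bar>s * \<kappa> - (N - 1)\<bar> + 3) * epow (J p) (1/p)) * epow (J t) (1 - 1/p)"
        unfolding I_def e_def E_def J_def s_def
        by (rule nn_integral_powr_step[OF Um U0 Vm V0 p]) (use t p s in \<open>auto simp: s_def\<close>)
      also have "\<dots> \<le> (ennreal s * e + ennreal (\<bar>s * \<kappa> - (N - 1)\<bar> + 3) * (ennreal \<omega> * e)) * epow (epow Z t) (1 - 1/p)"
        using p by (intro mult_mono add_left_mono mult_left_mono Jp' epow_mono t) auto
      also have "ennreal s * e + ennreal (\<bar>s * \<kappa> - (N - 1)\<bar> + 3) * (ennreal \<omega> * e) = ennreal (s + (\<bar>s * \<kappa> - (N - 1)\<bar> + 3) * \<omega>) * e"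
        using s \<omega> by (simp add: ennreal_plus ennreal_mult distrib_right mult.assoc del: ennreal_plus[symmetric])
      also have "\<dots> * epow (epow Z t) (1 - 1/p) \<le> Z * epow (epow Z t) (1 - 1/p)"
        unfolding Z_def by (intro mult_right_mono ennreal_leI Cs s) auto
      also have "\<dots> = epow Z s"
        using t p epow_add[of 1 "t * (1 - 1/p)" Z] by (simp add: s_def epow_epow)
      finally show ?thesis by (simp add: s_def)
    qed
    have "J r \<le> epow Z r"
    proof (cases "DIM('a) = 1")
      case True
      \<comment> \<open>From t = p the new exponent is p again, so Hardy's inequality already bounds
        \<open>I p\<close> and thus U by Z almost everywhere; U^r \<le> Z^(r-p) U^p then covers
        every r \<ge> p.\<close>
      have "1 + p * (1 - 1/p) = p" using p by (simp add: field_simps)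
      then have Ip: "I p \<le> epow Z p" using I[of p] JpZ pr by simp
      have "AE x in dilation_measure. ennreal (U x powr p) \<le> I p"
        unfolding I_def U_def V_def N_def by (rule weighted_sup_bound[OF ug p True])
      then have ae: "AE x in dilation_measure. ennreal (U x) \<le> Z"
      proof (rule AE_mp, intro AE_I2 impI)
        fix x assume "ennreal (U x powr p) \<le> I p"
        then have "epow (ennreal (U x)) p \<le> epow Z p"
          using Ip p U0[of x] by (simp add: epow_ennreal)
        then show "ennreal (U x) \<le> Z" using p by (subst (asm) epow_le_iff) auto
      qed
      have "J r \<le> (\<integral>\<^sup>+x. epow Z (r - p) * ennreal (U x powr p) \<partial>dilation_measure)"
        unfolding J_def
      proof (rule nn_integral_mono_AE, rule AE_mp[OF ae], intro AE_I2 impI)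
        fix x assume x: "ennreal (U x) \<le> Z"
        have "ennreal (U x powr r) = epow (ennreal (U x)) ((r - p) + p)"
          using p pr U0[of x] by (simp add: epow_ennreal)
        also have "\<dots> = epow (ennreal (U x)) (r - p) * epow (ennreal (U x)) p"
          using p pr by (intro epow_add) auto
        also have "\<dots> \<le> epow Z (r - p) * epow (ennreal (U x)) p"
          using x pr by (intro mult_right_mono epow_mono) auto
        finally show "ennreal (U x powr r) \<le> epow Z (r - p) * ennreal (U x powr p)"
          using p U0[of x] by (simp add: epow_ennreal)
      qed
      also have "\<dots> = epow Z (r - p) * J p"
        unfolding J_def using Um by (intro nn_integral_cmult) simp
      also have "\<dots> \<le> epow Z (r - p) * epow Z p" by (intro mult_left_mono JpZ) simp
      also have "\<dots> = epow Z r" using epow_add[of "r - p" p Z] p pr by simp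
      finally show ?thesis .
    next
      case False
      then have dim: "DIM('a) \<ge> 2" using DIM_positive[where 'a='a] by (simp add: Suc_leI le_neq_implies_less numeral_2_eq_2 del: DIM_positive)
      then have N2: "N \<ge> 2" by (simp add: N_def)
      show ?thesis
      proof (rule real_interval_continuation[where P="\<lambda>t. J t \<le> epow Z t", OF pr JpZ])
        show "J x \<le> epow Z x" if "\<And>n. p \<le> f n" "\<And>n. J (f n) \<le> epow Z (f n)" "f \<longlonglongrightarrow> x" for f x
        proof -
          have "p \<le> x" using that(1,3) by (intro LIMSEQ_le_const[OF that(3)]) auto
          moreover have "0 < f n" for n using that(1)[of n] p by linarith
          ultimately show ?thesis
            using that p unfolding J_def by (intro nn_integral_powr_bound_limit[OF Um U0 that(3) _ _ Z]) auto
        qed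
        show "J z \<le> epow Z z" if "p \<le> x" "x \<le> z" "z \<le> y" "J x \<le> epow Z x" "J y \<le> epow Z y" for x y z
          using that p unfolding J_def by (intro nn_integral_powr_bound_interpolate[OF Um U0, of x z y]) auto
        show "\<exists>y>x. J y \<le> epow Z y" if x: "p \<le> x" "x < r" "J x \<le> epow Z x" for x
        proof -
          define s where "s = 1 + x * (1 - 1/p)"
          have s: "1 \<le> s" using x p by (simp add: s_def)
          define \<nu> where "\<nu> = N / (N - 1)"
          have \<nu>: "0 < \<nu>" using N2 by (simp add: \<nu>_def)
          have "J (\<nu> * s) \<le> epow (I s) \<nu>"
            unfolding J_def I_def U_def V_def N_def \<nu>_def by (rule weighted_Gagliardo[OF ug s dim])
          also have "\<dots> \<le> epow (epow Z s) \<nu>"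
            using I[of x] x \<nu> by (intro epow_mono) (auto simp: s_def)
          also have "\<dots> = epow Z (\<nu> * s)" using s \<nu> by (simp add: epow_epow mult.commute)
          finally have "J (\<nu> * s) \<le> epow Z (\<nu> * s)" .
          moreover have "x < \<nu> * s"
          proof -
            \<comment> \<open>This is x < \<nu>s after clearing denominators. For p < N it says that
              x is below the critical exponent; for p \<ge> N the left-hand side is not
              positive.\<close>
            have "x * (N - p) < N * p"
            proof (cases "p < N")
              case True
              then have "x < N * p / (N - p)" using crit x(2) by (simp add: N_def)
              then show ?thesis using True by (simp add: field_simps)
            next
              case False
              then have "x * (N - p) \<le> 0" using x p by (intro mult_nonneg_nonpos) auto
              also have "0 < N * p" using N2 p by simp
              finally show ?thesis .
            qed
            then have "x * (p * (N - 1)) < N * (p + x * (p - 1))" by (simp add: algebra_simps)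
            moreover have "N * (p + x * (p - 1)) = (\<nu> * s) * (p * (N - 1))"
              using N2 p by (simp add: \<nu>_def s_def field_simps)
            moreover have "0 < p * (N - 1)" using p N2 by simp
            ultimately show ?thesis by (simp only: mult_less_cancel_right_pos)
          qed
          ultimately show ?thesis by blast
        qed
      qed
    qed
    then show ?thesis by (simp add: J_def Z_def e_def E_def U_def V_def)
  qed
  show ?thesis using C(1) main by blast
qed

section \<open>Translation into the weighted norms of the statement\<close>

lemma wint_dilation_measure:
  fixes f :: "'a::euclidean_space \<Rightarrow> 'b::{real_normed_vector, second_countable_topology}"
  assumes [measurable]: "f \<in> borel_measurable borel" and d: "d = t * \<kappa> - real DIM('a)"
  shows "wint d t f = (\<integral>\<^sup>+x. ennreal ((norm x powr \<kappa> * norm (f x)) powr t) \<partial>dilation_measure)"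
proof -
  have "(\<integral>\<^sup>+x. ennreal ((norm x powr \<kappa> * norm (f x)) powr t) \<partial>dilation_measure) =
    (\<integral>\<^sup>+x. ennreal (norm x powr (- real DIM('a))) * ennreal ((norm x powr \<kappa> * norm (f x)) powr t) \<partial>lborel)"
    by (rule nn_integral_dilation_measure) measurable
  also have "\<dots> = wint d t f"
    unfolding wint_def
  proof (rule nn_integral_cong)
    fix x :: 'a
    have "norm x powr d = norm x powr (- real DIM('a)) * norm x powr (\<kappa> * t)"
      unfolding powr_add[symmetric] by (simp add: d mult.commute)
    then show "ennreal (norm x powr (- real DIM('a))) * ennreal ((norm x powr \<kappa> * norm (f x)) powr t) =
      ennreal (norm x powr d * norm (f x) powr t)"
      by (simp add: powr_mult powr_powr ennreal_mult[symmetric] mult.assoc)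
  qed
  finally show ?thesis ..
qed

lemma wnorm_eq_epow: "0 < s \<Longrightarrow> wnorm d s u = epow (wint d s u) (1 / s)"
  by (simp add: wnorm_def epow_def)

lemma epow_eq_rpow:
  assumes "x < \<infinity>" shows "epow x t = ennreal (rpow (enn2real x) t)"
  using assms by (auto simp: epow_def rpow_def)

theorem theorem10p2:
  fixes a b p q r :: real
  defines "N \<equiv> real CARD('n::finite)"
  assumes hp: "1 \<le> p" and hq: "1 \<le> q" and hr: "1 \<le> r"
    and hab: "(a + N) / q = (b - p + N) / p" and hne: "(b - p + N) / p \<noteq> 0"
  shows
    "(p \<le> r \<and> below_pstar CARD('n) p r \<longrightarrow>
       (\<exists>C>0. \<forall>(u :: real^'n \<Rightarrow> real) g. in_W q p a b u g \<longrightarrow>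
          wnorm (r * (b - p + N) / p - N) r u \<le> ennreal C * wnorm b p g))
     \<and>
     ((r = p \<and> p = q) \<or> (p \<noteq> q \<and> min p q \<le> r \<and> r \<le> max p q) \<longrightarrow>
       (let \<theta> = (if p \<noteq> q then p * (r - q) / (r * (p - q)) else 0) in
        \<exists>C>0. \<forall>(u :: real^'n \<Rightarrow> real) g. in_W q p a b u g \<longrightarrow>
          wnorm (r * (b - p + N) / p - N) r u
            \<le> ennreal (C * rpow (enn2real (wnorm b p g)) \<theta> * rpow (enn2real (wnorm a q u)) (1 - \<theta>))))"
proof -
  \<comment> \<open>By the balance condition \<kappa> is also (a + N)/q, so the three weights are
    r\<kappa> - N, q\<kappa> - N and p(\<kappa> + 1) - N.\<close>
  define \<kappa> where "\<kappa> = (b - p + N) / p"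
  have \<kappa>: "\<kappa> \<noteq> 0" using hne by (simp add: \<kappa>_def)
  have ND: "N = real DIM(real^'n)" by (simp add: N_def)
  have c1: "r * (b - p + N) / p - N = r * \<kappa> - real DIM(real^'n)" unfolding ND[symmetric] by (simp add: \<kappa>_def)
  have "p * \<kappa> = b - p + N" using hp by (simp add: \<kappa>_def)
  then have cb: "b = p * (\<kappa> + 1) - real DIM(real^'n)" unfolding ND[symmetric] by (simp add: algebra_simps)
  have "\<kappa> = (a + N) / q" unfolding \<kappa>_def by (rule hab[symmetric])
  then have "q * \<kappa> = a + N" using hq by simp
  then have ca: "a = q * \<kappa> - real DIM(real^'n)" unfolding ND[symmetric] by (simp add: algebra_simps)
  have pos: "0 < p" "0 < q" "0 < r" using hp hq hr by auto
  define J where "J t u = (\<integral>\<^sup>+x. ennreal ((norm x powr \<kappa> * \<bar>u x\<bar>) powr t) \<partial>dilation_measure)" for t and u :: "real^'n \<Rightarrow> real"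
  define E where "E g = (\<integral>\<^sup>+x. ennreal ((norm x powr (\<kappa> + 1) * norm (g x)) powr p) \<partial>dilation_measure)" for g :: "real^'n \<Rightarrow> real^'n"
  have W: "C1_limit u g" "wint (r * (b - p + N) / p - N) r u = J r u" "wint a q u = J q u" "wint b p g = E g"
    "J q u < \<infinity>" "E g < \<infinity>" if "in_W q p a b u g" for u g
  proof -
    show ug: "C1_limit u g" using that by (auto simp: in_W_def intro: weak_grad_imp_C1_limit)
    then have m: "u \<in> borel_measurable borel" "g \<in> borel_measurable borel" by (auto simp: C1_limit_def)
    show "wint (r * (b - p + N) / p - N) r u = J r u" "wint a q u = J q u" "wint b p g = E g"
      using wint_dilation_measure[OF m(1) c1] wint_dilation_measure[OF m(1) ca] wint_dilation_measure[OF m(2) cb]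
      by (simp_all add: J_def E_def)
    then show "J q u < \<infinity>" "E g < \<infinity>" using that by (auto simp: in_W_def)
  qed
  have sob: "\<exists>C>0. \<forall>u g. in_W q p a b u g \<longrightarrow> J t u \<le> epow (ennreal C * epow (E g) (1/p)) t"
    if pt: "p \<le> t" and bt: "below_pstar CARD('n) p t" for t
  proof -
    have "p < real DIM(real^'n) \<Longrightarrow> t \<le> real DIM(real^'n) * p / (real DIM(real^'n) - p)"
      using bt by (simp add: below_pstar_def)
    from weighted_Sobolev[OF hp hq \<kappa> pt this] obtain C where C: "0 < C"
      "\<And>(u :: real^'n \<Rightarrow> real) g. C1_limit u g \<Longrightarrow> J q u < \<infinity> \<Longrightarrow> E g < \<infinity> \<Longrightarrow>
        J t u \<le> epow (ennreal C * epow (E g) (1/p)) t"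
      unfolding J_def E_def by blast
    then show ?thesis using W(1,5,6) by blast
  qed
  \<comment> \<open>Admits the exponent p itself in \<open>sob\<close>; this is Hardy's inequality,
    the ingredient of part (ii).\<close>
  have pp: "below_pstar CARD('n) p p"
  proof (unfold below_pstar_def, intro impI)
    assume "p < real CARD('n)"
    then have "p * (real CARD('n) - p) \<le> real CARD('n) * p" using pos by (simp add: algebra_simps)
    then show "p \<le> real CARD('n) * p / (real CARD('n) - p)"
      using \<open>p < real CARD('n)\<close> by (simp add: pos_le_divide_eq)
  qed
  show ?thesis
  proof (intro conjI impI)
    assume "p \<le> r \<and> below_pstar CARD('n) p r"
    then obtain C where C: "0 < C" "\<And>u g. in_W q p a b u g \<Longrightarrow> J r u \<le> epow (ennreal C * epow (E g) (1/p)) r"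
      using sob[of r] by blast
    show "\<exists>C>0. \<forall>(u :: real^'n \<Rightarrow> real) g. in_W q p a b u g \<longrightarrow>
      wnorm (r * (b - p + N) / p - N) r u \<le> ennreal C * wnorm b p g"
    proof (intro exI[of _ C] conjI allI impI C(1))
      fix u :: "real^'n \<Rightarrow> real" and g assume ug: "in_W q p a b u g"
      have "epow (J r u) (1/r) \<le> epow (epow (ennreal C * epow (E g) (1/p)) r) (1/r)"
        using pos by (intro epow_mono C(2) ug) auto
      then show "wnorm (r * (b - p + N) / p - N) r u \<le> ennreal C * wnorm b p g"
        using pos by (simp add: wnorm_eq_epow W[OF ug] epow_epow)
    qed
  next
    assume r: "r = p \<and> p = q \<or> p \<noteq> q \<and> min p q \<le> r \<and> r \<le> max p q"
    define \<theta> where "\<theta> = (if p \<noteq> q then p * (r - q) / (r * (p - q)) else 0)"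
    \<comment> \<open>\<open>l\<close> interpolates the integrals, r = l p + (1 - l) q, whereas
      \<theta> interpolates the norms: taking roots gives \<theta> = p l/r and 1 - \<theta> = q(1 -
      l)/r. For p = q the value 0 selects the L^q norm alone.\<close>
    define l where "l = (if p \<noteq> q then (r - q) / (p - q) else 0)"
    have l: "0 \<le> l" "l \<le> 1" "r = l * p + (1 - l) * q"
    proof -
      show "0 \<le> l" "l \<le> 1" using r by (auto simp: l_def divide_simps min_def max_def split: if_splits)
      have "l * (p - q) = r - q" using r by (auto simp: l_def)
      then show "r = l * p + (1 - l) * q" by (simp add: algebra_simps)
    qed
    have \<theta>: "\<theta> = p * (l / r)" by (simp add: \<theta>_def l_def)
    have \<theta>': "1 - \<theta> = q * ((1 - l) / r)"
    proof -
      have "(1 - \<theta>) * r = (1 - l) * q" using pos l(3) by (simp add: \<theta> algebra_simps)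
      then show ?thesis using pos by (simp add: field_simps)
    qed
    have \<theta>0: "0 \<le> \<theta>" "0 \<le> 1 - \<theta>" unfolding \<theta>' using l pos by (simp_all add: \<theta>)
    obtain C where C: "0 < C" "\<And>u g. in_W q p a b u g \<Longrightarrow> J p u \<le> epow (ennreal C * epow (E g) (1/p)) p"
      using sob[OF order_refl pp] by blast
    show "let \<theta> = (if p \<noteq> q then p * (r - q) / (r * (p - q)) else 0) in
        \<exists>C>0. \<forall>(u :: real^'n \<Rightarrow> real) g. in_W q p a b u g \<longrightarrow>
          wnorm (r * (b - p + N) / p - N) r u
            \<le> ennreal (C * rpow (enn2real (wnorm b p g)) \<theta> * rpow (enn2real (wnorm a q u)) (1 - \<theta>))"
      unfolding \<theta>_def[symmetric] Let_def
    \<comment> \<open>The Hardy constant enters through the gradient factor alone, which is raised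
      to \<theta>.\<close>
    proof (intro exI[of _ "C powr \<theta>"] conjI allI impI)
      show "0 < C powr \<theta>" using C by simp
      fix u :: "real^'n \<Rightarrow> real" and g assume ug: "in_W q p a b u g"
      have um: "(\<lambda>x. norm x powr \<kappa> * \<bar>u x\<bar>) \<in> borel_measurable dilation_measure"
        using W(1)[OF ug] by (auto simp: C1_limit_def)
      define e f where "e = wnorm b p g" and "f = wnorm a q u"
      have e: "e = epow (E g) (1/p)" and f: "f = epow (J q u) (1/q)"
        using pos by (simp_all add: e_def f_def wnorm_eq_epow W[OF ug])
      \<comment> \<open>Both norms are finite on the space, so passing to real numbers by
        \<open>enn2real\<close> loses nothing.\<close>
      have fin: "e < \<infinity>" "f < \<infinity>" using W(5,6)[OF ug] pos by (auto simp: e f epow_def)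
      have "J r u \<le> epow (J p u) l * epow (J q u) (1 - l)"
        unfolding J_def l(3) by (rule nn_integral_powr_interpolate[OF um _ pos(1,2) l(1,2)]) simp
      then have "epow (J r u) (1/r) \<le> epow (epow (J p u) l * epow (J q u) (1 - l)) (1/r)"
        using pos by (intro epow_mono) auto
      also have "\<dots> = epow (J p u) (l / r) * epow (J q u) ((1 - l) / r)"
        using l pos by (simp add: epow_mult epow_epow)
      also have "\<dots> \<le> epow (epow (ennreal C * e) p) (l / r) * epow (J q u) ((1 - l) / r)"
        using C(2)[OF ug] l pos by (intro mult_right_mono epow_mono) (auto simp: e)
      also have "epow (epow (ennreal C * e) p) (l / r) = epow (ennreal C) \<theta> * epow e \<theta>"
        using pos l by (simp add: epow_epow epow_mult \<theta>)
      also have "epow (J q u) ((1 - l) / r) = epow f (1 - \<theta>)"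
      proof -
        have "epow f q = J q u" using pos by (simp add: f epow_epow)
        then have "epow (J q u) ((1 - l) / r) = epow (epow f q) ((1 - l) / r)" by simp
        also have "\<dots> = epow f (1 - \<theta>)" unfolding \<theta>' using pos l by (intro epow_epow) auto
        finally show ?thesis .
      qed
      also have "epow (ennreal C) \<theta> * epow e \<theta> * epow f (1 - \<theta>) =
        ennreal (C powr \<theta> * rpow (enn2real e) \<theta> * rpow (enn2real f) (1 - \<theta>))"
        using C(1) fin by (simp add: epow_ennreal epow_eq_rpow ennreal_mult rpow_def)
      finally show "wnorm (r * (b - p + N) / p - N) r u \<le>
        ennreal (C powr \<theta> * rpow (enn2real (wnorm b p g)) \<theta> * rpow (enn2real (wnorm a q u)) (1 - \<theta>))"
        using pos by (simp add: wnorm_eq_epow[of r] W(2)[OF ug] e_def[symmetric] f_def[symmetric])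
    qed
  qed
qed

end
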